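(* Let $\Bbbk$ be an algebraically closed field of characteristic $p>0$, let $d \ge 1$, and let $\mathbf{w} \in \mathbb{R}^d_{li}$. The field $K_{\mathbf{w}} = \Bbbk^{\mathbb{Q}^d}(\mathcal{A}_{\mathbf{w}})$ of $p$-discrete series in direction $\mathbf{w}$ is algebraically closed.
   Context: $\mathbb{R}^d_{li}$ denotes the set of vectors in $\mathbb{R}^d$ whose coordinates are linearly independent over $\mathbb{Q}$. A cone in $\mathbb{R}^d$ is a convex set closed under multiplication by positive scalars; it is pointed if its closure does not contain a line. The dual cone of $C$ is $C^\vee = \{\mathbf{x} \in \mathbb{R}^d : \mathbf{x}\cdot\mathbf{y} \ge 0 \text{ for all } \mathbf{y} \in C\}$, and $\mathrm{int}(C)$ is the interior of $C$. For $A \subseteq \mathbb{Q}^d$, $\boldsymbol{\gamma} \in \mathbb{Q}^d$ and $\mathbf{w} \in \mathbb{R}^d_{li}$ set $A^+_{\boldsymbol{\gamma},\mathbf{w}} = \{\mathbf{a}\in A : \mathbf{w}\cdot\mathbf{a} > \mathbf{w}\cdot\boldsymbol{\gamma}\}$ and $A^-_{\boldsymbol{\gamma},\mathbf{w}} = \{\mathbf{a}\in A : \mathbf{w}\cdot\mathbf{a} < \mathbf{w}\cdot\boldsymbol{\gamma}\}$. A set $A \subseteq \mathbb{Q}^d$ is $p$-discrete with respect to $\mathbf{w}$ if: (a) there is an open cone $\sigma$ containing $\mathbf{w}$ such that $\{\mathbf{w}'\cdot\mathbf{a} : \mathbf{a}\in A\}$ is well ordered for every $\mathbf{w}' \in \sigma\cap\mathbb{R}^d_{li}$;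 (b) there are an integer $N>0$, $\boldsymbol{\gamma}\in\mathbb{Q}^d$, and a pointed cone $C$ with $\mathbf{w}\in\mathrm{int}(C^\vee)$ such that $A \subseteq (\boldsymbol{\gamma}+C)\cap\bigcup_{j\ge 0}\frac{1}{Np^j}\mathbb{Z}^d$; (c) for any sequence $\{\mathbf{a}_i\}$ in $A$, if $\{\mathbf{w}\cdot\mathbf{a}_i\}$ converges in $\mathbb{R}$ then $\{\mathbf{a}_i\}$ converges to a point of $\mathbb{Q}^d$; (d) for every $\boldsymbol{\gamma}'\in\mathbb{Q}^d$ there is an open cone $\sigma_{\boldsymbol{\gamma}'}$ containing $\mathbf{w}$ such that for all $\mathbf{w}'\in\sigma_{\boldsymbol{\gamma}'}\cap\mathbb{R}^d_{li}$ we have $A^+_{\boldsymbol{\gamma}',\mathbf{w}'}=A^+_{\boldsymbol{\gamma}',\mathbf{w}}$ and $A^-_{\boldsymbol{\gamma}',\mathbf{w}'}=A^-_{\boldsymbol{\gamma}',\mathbf{w}}$. $\mathcal{A}_{\mathbf{w}}$ is the set of all $A \subset \mathbb{Q}^d$ that are $p$-discrete with respect to $\mathbf{w}$. $K_{\mathbf{w}} = \Bbbk^{\mathbb{Q}^d}(\mathcal{A}_{\mathbf{w}})$ is the set of all functions $\varphi\colon\mathbb{Q}^d\to\Bbbk$ whose support $\mathrm{supp}(\varphi)=\{\mathbf{u} : \varphi(\mathbf{u})\ne 0\}$ lies in $\mathcal{A}_{\mathbf{w}}$, written as formal power series $\sum_{\mathbf{u}}\varphi(\mathbf{u})\mathbf{t}^{\mathbf{u}}$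 in $t_1,\dots,t_d$, with pointwise addition and multiplication $(\varphi\psi)(\mathbf{u})=\sum_{\mathbf{u}_1+\mathbf{u}_2=\mathbf{u}}\varphi(\mathbf{u}_1)\psi(\mathbf{u}_2)$; with these operations it is a field. *)

theory Defs
  imports "HOL-Analysis.Analysis" "HOL-Algebra.Algebraic_Closure"
begin

definition rvec :: "rat ^ 'd \<Rightarrow> real ^ 'd" where
  "rvec a = (\<chi> i. of_rat (a $ i))"

definition Rli :: "(real ^ 'd) set" where
  "Rli = {w. \<forall>c :: 'd \<Rightarrow> rat. (\<Sum>i\<in>UNIV. of_rat (c i) * w $ i) = 0 \<longrightarrow> (\<forall>i. c i = 0)}"

(* Unlike the library's cone and conic, only strictly positive scalars are used,
   so a cone need not contain 0; this is what makes proper open cones possible. *)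
definition convex_cone :: "(real ^ 'd) set \<Rightarrow> bool" where
  "convex_cone C \<longleftrightarrow> convex C \<and> (\<forall>x\<in>C. \<forall>c>0. c *\<^sub>R x \<in> C)"

definition pointed_cone :: "(real ^ 'd) set \<Rightarrow> bool" where
  "pointed_cone C \<longleftrightarrow> convex_cone C \<and>
     \<not> (\<exists>x v. v \<noteq> 0 \<and> range (\<lambda>t::real. x + t *\<^sub>R v) \<subseteq> closure C)"

definition dual_cone :: "(real ^ 'd) set \<Rightarrow> (real ^ 'd) set" where
  "dual_cone C = {x. \<forall>y\<in>C. x \<bullet> y \<ge> 0}"

definition well_ordered :: "real set \<Rightarrow> bool" where
  "well_ordered S \<longleftrightarrow> well_order_on S {(x, y). x \<in> S \<and> y \<in> S \<and> x \<le> y}"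

definition upper_part :: "(rat ^ 'd) set \<Rightarrow> rat ^ 'd \<Rightarrow> real ^ 'd \<Rightarrow> (rat ^ 'd) set" where
  "upper_part A \<gamma> w = {a \<in> A. w \<bullet> rvec a > w \<bullet> rvec \<gamma>}"

definition lower_part :: "(rat ^ 'd) set \<Rightarrow> rat ^ 'd \<Rightarrow> real ^ 'd \<Rightarrow> (rat ^ 'd) set" where
  "lower_part A \<gamma> w = {a \<in> A. w \<bullet> rvec a < w \<bullet> rvec \<gamma>}"

(* The lattice (1/m) Z^d. *)
definition lattice_over :: "int \<Rightarrow> (rat ^ 'd) set" where
  "lattice_over m = {a. \<exists>z :: int ^ 'd. \<forall>i. a $ i = of_int (z $ i) / of_int m}"

definition p_discrete :: "nat \<Rightarrow> real ^ 'd \<Rightarrow> (rat ^ 'd) set \<Rightarrow> bool" where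
  "p_discrete p w A \<longleftrightarrow>
     (\<exists>\<sigma>. open \<sigma> \<and> convex_cone \<sigma> \<and> w \<in> \<sigma> \<and>
        (\<forall>w' \<in> \<sigma> \<inter> Rli. well_ordered ((\<lambda>a. w' \<bullet> rvec a) ` A))) \<and>
     (\<exists>(N::int) (\<gamma>::rat ^ 'd) C. N > 0 \<and> pointed_cone C \<and> w \<in> interior (dual_cone C) \<and>
        A \<subseteq> {a. rvec a \<in> (+) (rvec \<gamma>) ` C} \<inter> (\<Union>j::nat. lattice_over (N * int p ^ j))) \<and>
     (\<forall>a :: nat \<Rightarrow> rat ^ 'd. (\<forall>i. a i \<in> A) \<longrightarrow> convergent (\<lambda>i. w \<bullet> rvec (a i)) \<longrightarrow>
        (\<exists>q. (\<lambda>i. rvec (a i)) \<longlonglongrightarrow> rvec q)) \<and>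
     (\<forall>\<gamma>'. \<exists>\<sigma>. open \<sigma> \<and> convex_cone \<sigma> \<and> w \<in> \<sigma> \<and>
        (\<forall>w' \<in> \<sigma> \<inter> Rli. upper_part A \<gamma>' w' = upper_part A \<gamma>' w \<and>
                         lower_part A \<gamma>' w' = lower_part A \<gamma>' w))"

definition p_discrete_sets :: "nat \<Rightarrow> real ^ 'd \<Rightarrow> (rat ^ 'd) set set" where
  "p_discrete_sets p w = {A. p_discrete p w A}"

definition supp :: "(rat ^ 'd \<Rightarrow> 'k::zero) \<Rightarrow> (rat ^ 'd) set" where
  "supp \<phi> = {u. \<phi> u \<noteq> 0}"

(* The product is the convolution over pairs u1 + u2 = u; restricting to the supports
   drops only zero terms, and is needed because a library sum over an infinite
   index set is 0. *)
definition series_ring :: "(rat ^ 'd) set set \<Rightarrow> (rat ^ 'd \<Rightarrow> 'k::field) ring" where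
  "series_ring \<A> = \<lparr>
     carrier = {\<phi>. supp \<phi> \<in> \<A>},
     monoid.mult = (\<lambda>\<phi> \<psi> u.
       \<Sum>(u1, u2) \<in> {(u1, u2). u1 \<in> supp \<phi> \<and> u2 \<in> supp \<psi> \<and> u1 + u2 = u}. \<phi> u1 * \<psi> u2),
     one = (\<lambda>u. if u = 0 then 1 else 0),
     ring.zero = (\<lambda>u. 0),
     add = (\<lambda>\<phi> \<psi> u. \<phi> u + \<psi> u)\<rparr>"

end

theory Submission
  imports Defs
begin

text \<open>
  Every element algebraic over a field \<open>K\<close> of characteristic \<open>p\<close> is a root of an additive polynomial
  \<open>\<Sum>i\<le>n. c\<^sub>i x^(p^i)\<close>, because its powers \<open>x^(p^i)\<close> are linearly dependent.  If \<open>K\<close> is perfect, closed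
  under Artin-Schreier extensions, and contains a nonzero root \<open>\<alpha>\<close> of every nontrivial separable additive
  polynomial, then by induction on \<open>n\<close> all roots lie in \<open>K\<close>: after scaling by \<open>\<alpha>\<close>, Abel summation
  turns the equation for \<open>x\<close> into a shorter one for \<open>x^p - x\<close>.

  For \<open>K\<^sub>w\<close> the nonzero root is found by one Newton polygon step followed by a recursion along the
  well-ordered semigroup generated by the exponents of the coefficients; inverses and the
  nonnegative part of Artin-Schreier equations come from the same recursion, and negative exponents are treated by
  the explicit series of iterated \<open>p\<close>-th roots.  That these supports remain \<open>p\<close>-discrete is checked on a
  sequential reformulation of \<open>p\<close>-discreteness.
\<close>

section \<open>Fields in which additive polynomials have roots\<close>

text \<open>The obstacle is visible in one variable: a root of x^p - x = 1/t is the sum of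
  t^(-1/p^j) over j > 0, whose exponents accumulate at 0 and have unbounded powers of p as
  denominators. Refining a root of an arbitrary polynomial one exponent after another would have to
  continue through such limit points while the support stays p-discrete. Additive polynomials avoid
  this: the Frobenius acts on series term by term, so y^(p^i) has no mixed terms, and once the
  linear coefficient is a unit at exponent 0, each coefficient of y at a nonzero exponent is
  determined by those at smaller exponents, all inside one monoid. Artin-Schreier equations with
  negative exponents fall outside this recursion, but there a root can be written down. An additive
  polynomial without linear term is, over a perfect field, the p-th power of a shorter one, which is
  why separable ones suffice. Rational independence of the coordinates of w gives distinct exponents
  distinct values, so exponents can be compared like real numbers.\<close>

lemma (in cring) binomial_finsum:
  assumes x: "x \<in> carrier R" and y: "y \<in> carrier R"
  shows "(x \<oplus> y) [^] n = (\<Oplus>k\<in>{..n}. [(n choose k)] \<cdot> (x [^] k \<otimes> y [^] (n - k)))"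
proof (induction n)
  case 0
  then show ?case by simp
next
  case (Suc n)
  have c: "[m] \<cdot> (x [^] i \<otimes> y [^] j) \<in> carrier R" for m i j :: nat
    using x y by simp
  have "(x \<oplus> y) [^] Suc n
      = (\<Oplus>k\<in>{..n}. [(n choose k)] \<cdot> (x [^] k \<otimes> y [^] (n - k))) \<otimes> x
        \<oplus> (\<Oplus>k\<in>{..n}. [(n choose k)] \<cdot> (x [^] k \<otimes> y [^] (n - k))) \<otimes> y"
    using x y Suc by (simp add: r_distr)
  also have "(\<Oplus>k\<in>{..n}. [(n choose k)] \<cdot> (x [^] k \<otimes> y [^] (n - k))) \<otimes> x
      = (\<Oplus>k\<in>{..n}. [(n choose k)] \<cdot> (x [^] Suc k \<otimes> y [^] (n - k)))"
    using x y c
    by (subst finsum_ldistr)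
       (auto intro!: finsum_cong' simp: add_pow_ldistr add_pow_rdistr m_ac)
  also have "(\<Oplus>k\<in>{..n}. [(n choose k)] \<cdot> (x [^] k \<otimes> y [^] (n - k))) \<otimes> y
      = (\<Oplus>k\<in>{..n}. [(n choose k)] \<cdot> (x [^] k \<otimes> y [^] (Suc n - k)))"
    using x y c
    by (subst finsum_ldistr)
       (auto intro!: finsum_cong' simp: add_pow_ldistr add_pow_rdistr m_ac Suc_diff_le)
  \<comment> \<open>The new top term has \<open>n choose Suc n = 0\<close>. Enlarging the range here
    and then splitting off the index 0 aligns this sum with the first one, as Pascal's rule
    needs.\<close>
  also have "\<dots> = (\<Oplus>k\<in>{..Suc n}. [(n choose k)] \<cdot> (x [^] k \<otimes> y [^] (Suc n - k)))"
    using c x y by (subst finsum_Suc) (auto simp: binomial_eq_0)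
  also have "\<dots> = (\<Oplus>k\<in>{..n}. [(n choose Suc k)] \<cdot> (x [^] Suc k \<otimes> y [^] (n - k)))
      \<oplus> y [^] Suc n"
    using c x y by (subst finsum_Suc2) auto
  also have "(\<Oplus>k\<in>{..n}. [(n choose k)] \<cdot> (x [^] Suc k \<otimes> y [^] (n - k))) \<oplus> \<dots>
     = (\<Oplus>k\<in>{..n}. [(Suc n choose Suc k)] \<cdot> (x [^] Suc k \<otimes> y [^] (n - k))) \<oplus> y [^] Suc n"
  proof -
    have "(\<Oplus>k\<in>{..n}. [(Suc n choose Suc k)] \<cdot> (x [^] Suc k \<otimes> y [^] (n - k)))
      = (\<Oplus>k\<in>{..n}. [(n choose k)] \<cdot> (x [^] Suc k \<otimes> y [^] (n - k))
          \<oplus> [(n choose Suc k)] \<cdot> (x [^] Suc k \<otimes> y [^] (n - k)))"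
      using x y c by (intro finsum_cong') (auto simp: add.nat_pow_mult)
    also have "\<dots> = (\<Oplus>k\<in>{..n}. [(n choose k)] \<cdot> (x [^] Suc k \<otimes> y [^] (n - k)))
          \<oplus> (\<Oplus>k\<in>{..n}. [(n choose Suc k)] \<cdot> (x [^] Suc k \<otimes> y [^] (n - k)))"
      by (intro finsum_addf) (use x y in auto)
    finally show ?thesis
      using x y c by (simp add: a_assoc del: nat_pow_Suc)
  qed
  also have "\<dots> = (\<Oplus>k\<in>{..Suc n}. [(Suc n choose k)] \<cdot> (x [^] k \<otimes> y [^] (Suc n - k)))"
    using c x y by (subst finsum_Suc2) auto
  finally show ?case .
qed

section \<open>Frobenius and the prime field in characteristic p\<close>

lemma (in cring) add_pow_eq_zero_of_dvd:
  assumes "[(p::nat)] \<cdot> \<one> = \<zero>" "p dvd n" "x \<in> carrier R"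
  shows "[n] \<cdot> x = \<zero>"
proof -
  obtain m where n: "n = p * m" using assms(2) by blast
  have "[p] \<cdot> x = ([p] \<cdot> \<one>) \<otimes> x"
    using assms(3) by (simp add: add_pow_ldistr)
  also have "\<dots> = \<zero>" using assms by simp
  finally show ?thesis
    using assms(3) unfolding n by (simp add: add.nat_pow_pow[symmetric])
qed

lemma (in cring) freshmans_dream_pow:
  fixes p :: nat
  assumes p: "Factorial_Ring.prime p" "[p] \<cdot> \<one> = \<zero>" and x: "x \<in> carrier R" and y: "y \<in> carrier R"
  shows "(x \<oplus> y) [^] p = x [^] p \<oplus> y [^] p"
proof -
  \<comment> \<open>The form \<open>p = Suc (Suc q)\<close> allows both end terms to be split off;
    the terms in between have binomial coefficients divisible by p.\<close>
  have "2 \<le> p" by (rule prime_ge_2_nat[OF p(1)])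
  then obtain q where "p = 2 + q" using le_Suc_ex by blast
  then have q: "p = Suc (Suc q)" by simp
  let ?f = "\<lambda>k. [(p choose k)] \<cdot> (x [^] k \<otimes> y [^] (p - k))"
  have c: "?f k \<in> carrier R" for k using x y by simp
  have z: "?f (Suc k) = \<zero>" if "k \<le> q" for k
    using that p x y q by (intro add_pow_eq_zero_of_dvd[OF p(2)] dvd_choose_prime) auto
  have "(x \<oplus> y) [^] p = (\<Oplus>k\<in>{..p}. ?f k)"
    by (rule binomial_finsum[OF x y])
  also have "\<dots> = (\<Oplus>k\<in>{..Suc q}. ?f (Suc k)) \<oplus> ?f 0"
    using c unfolding q by (subst finsum_Suc2) auto
  also have "(\<Oplus>k\<in>{..Suc q}. ?f (Suc k)) = ?f p \<oplus> (\<Oplus>k\<in>{..q}. ?f (Suc k))"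
    using x y unfolding q by (subst finsum_Suc) auto
  also have "(\<Oplus>k\<in>{..q}. ?f (Suc k)) = (\<Oplus>k\<in>{..q}. \<zero>)"
    using z by (intro finsum_cong') auto
  also have "\<dots> = \<zero>" by (rule finsum_zero) 
  finally show ?thesis using x y by simp
qed


lemma (in domain) nat_pow_eq_zero_iff:
  assumes "x \<in> carrier R" "x [^] (n::nat) = \<zero>"
  shows "x = \<zero>"
  using assms(2)
proof (induction n)
  case (Suc n)
  then show ?case using assms(1) integral[of "x [^] n" x] by auto
qed simp

lemma (in cring) freshmans_dream_finsum:
  fixes p :: nat
  assumes p: "Factorial_Ring.prime p" "[p] \<cdot> \<one> = \<zero>"
    and "finite A" and f: "\<And>i. i \<in> A \<Longrightarrow> f i \<in> carrier R"
  shows "(\<Oplus>i\<in>A. f i) [^] p = (\<Oplus>i\<in>A. f i [^] p)"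
  using assms(3) f
proof (induction A rule: finite_induct)
  case empty
  then show ?case using prime_gt_0_nat[OF p(1)] by (simp add: nat_pow_zero)
next
  case (insert a A)
  then show ?case by (simp add: freshmans_dream_pow[OF p] Pi_iff)
qed

text \<open>Applying the additive version to (x - y) + y avoids the sign (-1)^p and with it a
  separate case p = 2.\<close>

lemma (in domain) freshmans_dream_minus:
  fixes p :: nat
  assumes p: "Factorial_Ring.prime p" "[p] \<cdot> \<one> = \<zero>"
    and x: "x \<in> carrier R" and y: "y \<in> carrier R"
  shows "(x \<ominus> y) [^] p = x [^] p \<ominus> y [^] p"
proof -
  have "x [^] p = ((x \<ominus> y) \<oplus> y) [^] p"
    using x y by (simp add: minus_eq a_assoc l_neg)
  also have "\<dots> = (x \<ominus> y) [^] p \<oplus> y [^] p"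
    using x y by (intro freshmans_dream_pow[OF p]) auto
  finally show ?thesis
    using x y by (simp add: minus_eq a_assoc r_neg)
qed

lemma (in domain) freshmans_dream_minus_pow:
  fixes p :: nat
  assumes p: "Factorial_Ring.prime p" "[p] \<cdot> \<one> = \<zero>"
    and x: "x \<in> carrier R" and y: "y \<in> carrier R"
  shows "(x \<ominus> y) [^] (p ^ i) = x [^] (p ^ i) \<ominus> y [^] (p ^ i)"
proof (induction i)
  case 0
  then show ?case using x y by simp
next
  case (Suc i)
  have "(x \<ominus> y) [^] (p ^ Suc i) = ((x \<ominus> y) [^] (p ^ i)) [^] p"
    using x y by (simp add: nat_pow_pow mult.commute)
  also have "\<dots> = x [^] (p ^ Suc i) \<ominus> y [^] (p ^ Suc i)"
    using x y by (simp add: Suc freshmans_dream_minus[OF p] nat_pow_pow mult.commute)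
  finally show ?case .
qed

lemma (in domain) prime_char_add_pow_inj:
  fixes p :: nat
  assumes p: "Factorial_Ring.prime p" "[p] \<cdot> \<one> = \<zero>"
  shows "inj_on (\<lambda>i::nat. [i] \<cdot> \<one>) {..<p}"
proof (rule linorder_inj_onI)
  fix i j :: nat
  assume ij: "i < j" "i \<in> {..<p}" "j \<in> {..<p}"
  show "[i] \<cdot> \<one> \<noteq> [j] \<cdot> \<one>"
  proof
    assume eq: "[i] \<cdot> \<one> = [j] \<cdot> \<one>"
    define k where "k = j - i"
    have "[j] \<cdot> \<one> = [i] \<cdot> \<one> \<oplus> [k] \<cdot> \<one>"
      using ij by (simp add: k_def add.nat_pow_mult)
    then have k0: "[k] \<cdot> \<one> = \<zero>"
      using eq by (metis add.nat_pow_closed add.r_cancel_one' one_closed a_comm)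
    have "coprime k p"
      using ij p(1) by (metis coprime_commute k_def less_imp_diff_less lessThan_iff
          nat_dvd_not_less prime_imp_coprime zero_less_diff)
    \<comment> \<open>Bezout: both k and p annihilate 1, so a combination of them equal to 1 would
      give 1 = 0.\<close>
    then obtain a b where ab: "k * a = p * b + 1"
      using bezout_nat[of k p] ij(1) unfolding k_def by (metis coprime_iff_gcd_eq_1 zero_less_diff less_numeral_extra(3))
    have "[(k * a)] \<cdot> \<one> = \<zero>"
      by (rule add_pow_eq_zero_of_dvd[OF k0]) auto
    moreover have "[(p * b + 1)] \<cdot> \<one> = \<one>"
      using add_pow_eq_zero_of_dvd[OF p(2), of "p * b" \<one>] by (simp add: add.nat_pow_mult[symmetric])
    ultimately show False using ab one_not_zero by simp
  qed
qed auto

text \<open>The multiples of 1 already supply p roots of X^p - X, so one more root would exceed the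
  degree.\<close>

lemma (in field) pow_prime_fixed:
  fixes p :: nat
  assumes p: "Factorial_Ring.prime p" "[p] \<cdot> \<one> = \<zero>"
    and z: "z \<in> carrier R" "z [^] p = z"
  shows "\<exists>i::nat. z = [i] \<cdot> \<one>"
proof (rule ccontr)
  assume neg: "\<not> ?thesis"
  define F where "F = (\<lambda>i::nat. [i] \<cdot> \<one>) ` {..<p}"
  have p1: "p > 1" using p(1) prime_gt_1_nat by blast
  have fixF: "([i] \<cdot> \<one>) [^] p = [i] \<cdot> \<one>" for i :: nat
  proof (induction i)
    case 0
    then show ?case using p1 by (simp add: nat_pow_zero)
  next
    case (Suc i)
    then show ?case by (simp add: freshmans_dream_pow[OF p])
  qed
  define P where "P = poly_add (monom \<one> p) (monom (\<ominus> \<one>) 1)"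
  have m: "polynomial (carrier R) (monom \<one> p)" "polynomial (carrier R) (monom (\<ominus> \<one>) 1)"
    using one_not_zero by (auto intro!: monom_is_polynomial carrier_is_subring)
  have deg: "degree P = p"
    unfolding P_def by (subst poly_add_degree_eq[OF carrier_is_subring m])
      (use p1 in \<open>auto simp: monom_def\<close>)
  have "polynomial (carrier R) P"
    unfolding P_def by (rule poly_add_closed[OF carrier_is_subring m])
  then have P: "P \<in> carrier (poly_ring R)" by (simp add: univ_poly_carrier)
  have "P \<noteq> []" using deg p1 by auto
  have ev: "eval P a = a [^] p \<ominus> a" if "a \<in> carrier R" for a
  proof -
    have "eval P a = eval (monom \<one> p) a \<oplus> eval (monom (\<ominus> \<one>) 1) a"
      unfolding P_def using that by (intro eval_poly_add monom_in_carrier) auto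
    then show ?thesis
      using that by (simp add: eval_monom minus_eq l_minus del: One_nat_def) 
  qed
  have "insert z F \<subseteq> set_mset (roots P)"
    using z fixF \<open>P \<noteq> []\<close> by (auto simp: roots_mem_iff_is_root[OF P] is_root_def ev F_def r_neg minus_eq)
  then have "card (insert z F) \<le> card (set_mset (roots P))"
    by (intro card_mono) auto
  also have "\<dots> \<le> size (roots P)"
    by (metis size_multiset_overloaded_eq sum_mono card_eq_sum One_nat_def Suc_leI count_greater_zero_iff)
  also have "\<dots> \<le> p" using size_roots_le_degree[OF P] deg by simp
  finally have "card (insert z F) \<le> p" .
  moreover have "card F = p"
    unfolding F_def using prime_char_add_pow_inj[OF p] by (simp add: card_image)
  moreover have "z \<notin> F" using neg unfolding F_def by auto
  moreover have "finite F" unfolding F_def by simp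
  ultimately show False by simp
qed

section \<open>Additive polynomials and algebraic closedness\<close>

lemma (in ring) combine_map_upt:
  assumes "f \<in> {..<n} \<rightarrow> carrier R" "g \<in> {..<n} \<rightarrow> carrier R"
  shows "combine (map f [0..<n]) (map g [0..<n]) = (\<Oplus>i\<in>{..<n}. f i \<otimes> g i)"
  using assms
proof (induction n)
  case 0
  then show ?case by simp
next
  case (Suc n)
  have "combine (map f [0..<Suc n]) (map g [0..<Suc n])
      = combine (map f [0..<n]) (map g [0..<n]) \<oplus> combine [f n] [g n]"
    using Suc.prems by (subst combine_append) (auto simp: Pi_iff)
  also have "\<dots> = (\<Oplus>i\<in>{..<Suc n}. f i \<otimes> g i)"
    using Suc by (simp add: lessThan_Suc Pi_iff a_comm)
  finally show ?case .
qed

lemma (in domain) algebraic_imp_additive_poly_root: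
  fixes p :: nat
  assumes K: "subfield K R" and x: "x \<in> carrier R" and alg: "(algebraic over K) x"
  obtains n c where "\<And>i. c i \<in> K" "\<exists>i\<le>n. c i \<noteq> \<zero>"
    "(\<Oplus>i\<in>{..n}. c i \<otimes> x [^] (p ^ i)) = \<zero>"
proof -
  define n where "n = degree (Irr K x)"
  define E where "E = simple_extension K x"
  let ?g = "\<lambda>i. x [^] (p ^ i)"
  have dim: "dimension n K E"
    unfolding n_def E_def by (rule dimension_simple_extension[OF K x alg])
  have "subring E R"
    unfolding E_def by (rule simple_extension_is_subring[OF subfieldE(1)[OF K] x])
  then have E: "x [^] (k::nat) \<in> E" for k
  proof (induction k)
    case 0
    then show ?case by (simp add: subringE(3))
  next
    case (Suc k)
    then show ?case
      using simple_extension_mem[OF subfieldE(1)[OF K] x] by (simp add: subringE(6) E_def)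
  qed
  \<comment> \<open>These are n + 1 elements of a space of dimension n. The family is a list, so
    coinciding powers do no harm: a repetition is itself a dependence.\<close>
  have "dependent K (map ?g [0..<Suc n])"
    using independent_length_le_dimension[OF K dim] E
    by (metis (no_types, lifting) image_subset_iff length_map length_upt list.set_map not_less_eq_eq diff_zero order_refl)
  moreover have "set (map ?g [0..<Suc n]) \<subseteq> carrier R" using x by auto
  ultimately obtain Ks where Ks: "length Ks = length (map ?g [0..<Suc n])"
    "combine Ks (map ?g [0..<Suc n]) = \<zero>" "set Ks \<subseteq> K" "set Ks \<noteq> {\<zero>}"
    using dependent_imp_non_trivial_combine[OF K] by metis
  define c where "c = (\<lambda>i. if i \<le> n then Ks ! i else \<zero>)"
  have len: "length Ks = Suc n" using Ks(1) by simp
  have c: "c i \<in> K" for i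
    using Ks(3) len subringE(2)[OF subfieldE(1)[OF K]] by (auto simp: c_def subset_iff)
  have Kc: "Ks = map c [0..<Suc n]"
    by (rule nth_equalityI) (use len in \<open>auto simp: c_def simp del: upt_Suc\<close>)
  have cR: "c i \<in> carrier R" for i using c subfieldE(3)[OF K] by blast
  have "(\<Oplus>i\<in>{..n}. c i \<otimes> ?g i) = \<zero>"
    using Ks(2) unfolding Kc by (subst (asm) combine_map_upt) (use cR x in \<open>auto simp: lessThan_Suc_atMost\<close>)
  moreover have "\<exists>i\<le>n. c i \<noteq> \<zero>"
  proof -
    obtain k where "k \<in> set Ks" "k \<noteq> \<zero>" using Ks(4) len by (cases Ks) auto
    then obtain i where "i < Suc n" "Ks ! i \<noteq> \<zero>" using len by (metis in_set_conv_nth)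
    then show ?thesis by (auto simp: c_def intro!: exI[of _ i])
  qed
  ultimately show thesis using that[of c n] c by blast
qed

text \<open>\<open>K\<close> sits inside an ambient field, later an algebraic closure, because
  \<open>x\<close> is not yet known to lie in \<open>K\<close>. The induction varies
  \<open>x\<close> and \<open>c\<close> together: Abel summation replaces \<open>x\<close> by
  \<open>t^p - t\<close> and the coefficients by their partial sums.\<close>

lemma (in field) additive_poly_root_in_subfield:
  fixes p :: nat
  assumes p: "Factorial_Ring.prime p" "[p] \<cdot> \<one> = \<zero>"
    and K: "subfield K R"
    and perfect: "\<And>c. c \<in> K \<Longrightarrow> \<exists>b\<in>K. b [^] p = c"
    and artin_schreier: "\<And>a. a \<in> K \<Longrightarrow> \<exists>b\<in>K. b [^] p \<ominus> b = a"
    and additive_root: "\<And>c n. \<lbrakk>\<And>i. c i \<in> K; c 0 \<noteq> \<zero>; n > 0; c n \<noteq> \<zero>\<rbrakk>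
       \<Longrightarrow> \<exists>\<alpha>\<in>K. \<alpha> \<noteq> \<zero> \<and> (\<Oplus>i\<in>{..n}. c i \<otimes> \<alpha> [^] (p ^ i)) = \<zero>"
    and "x \<in> carrier R" "\<And>i. c i \<in> K" "\<exists>i\<le>n. c i \<noteq> \<zero>"
      "(\<Oplus>i\<in>{..n}. c i \<otimes> x [^] (p ^ i)) = \<zero>"
  shows "x \<in> K"
  using assms(7-)
proof (induction n arbitrary: x c)
  case 0
  have c: "c i \<in> carrier R" for i using 0(2) subfieldE(3)[OF K] by blast
  have "x = \<zero>" using 0 c integral by auto
  then show ?case using subringE(2)[OF subfieldE(1)[OF K]] by simp
next
  case (Suc n)
  note Ksub = subfieldE(1)[OF K]
  have KR: "a \<in> carrier R" if "a \<in> K" for a using that subfieldE(3)[OF K] by blast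
  note c = Suc.prems(2) and x = Suc.prems(1)
  have cR: "c i \<in> carrier R" for i using c KR by blast
  consider (c0) "c 0 = \<zero>" | (cn) "c (Suc n) = \<zero>" | (gen) "c 0 \<noteq> \<zero>" "c (Suc n) \<noteq> \<zero>" by blast
  then show ?case
  proof cases
    case c0
    \<comment> \<open>Without a linear term the sum is the p-th power of an additive sum whose
      coefficients are p-th roots of the old ones and whose exponents are one step lower.\<close>
    have "\<forall>i. \<exists>b. b \<in> K \<and> b [^] p = c (Suc i)" using perfect c by blast
    then obtain b where b: "\<And>i. b i \<in> K" "\<And>i. b i [^] p = c (Suc i)" by metis
    have bR: "b i \<in> carrier R" for i using b KR by blast
    have "\<zero> = (\<Oplus>i\<in>{..n}. c (Suc i) \<otimes> x [^] (p ^ Suc i)) \<oplus> c 0 \<otimes> x [^] (p ^ 0)"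
      using cR x Suc.prems(4) by (subst finsum_Suc2[symmetric]) auto
    also have "\<dots> = (\<Oplus>i\<in>{..n}. c (Suc i) \<otimes> x [^] (p ^ Suc i))"
      using c0 cR x by simp
    also have "\<dots> = (\<Oplus>i\<in>{..n}. (b i \<otimes> x [^] (p ^ i)) [^] p)"
      using bR x by (intro finsum_cong') (auto simp: nat_pow_distrib nat_pow_pow b(2)[symmetric] mult.commute)
    also have "\<dots> = (\<Oplus>i\<in>{..n}. b i \<otimes> x [^] (p ^ i)) [^] p"
      using bR x by (subst freshmans_dream_finsum[OF p]) auto
    finally have "(\<Oplus>i\<in>{..n}. b i \<otimes> x [^] (p ^ i)) [^] p = \<zero>" by (rule sym)
    then have "(\<Oplus>i\<in>{..n}. b i \<otimes> x [^] (p ^ i)) = \<zero>"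
      by (rule nat_pow_eq_zero_iff[rotated]) (use bR x in \<open>auto intro!: finsum_closed\<close>)
    moreover have "\<exists>i\<le>n. b i \<noteq> \<zero>"
    proof -
      obtain i where i: "i \<le> Suc n" "c i \<noteq> \<zero>" using Suc.prems(3) by blast
      then obtain j where j: "i = Suc j" using c0 by (cases i) auto
      have "b j \<noteq> \<zero>"
        using i b(2)[of j] prime_gt_0_nat[OF p(1)] unfolding j by (auto simp: nat_pow_zero)
      then show ?thesis using i j by auto
    qed
    ultimately show ?thesis by (rule Suc.IH[OF x b(1), rotated])
  next
    case cn
    then have "(\<Oplus>i\<in>{..n}. c i \<otimes> x [^] (p ^ i)) = \<zero>"
      using Suc.prems(4) cR x by (subst (asm) finsum_Suc) auto
    moreover have "\<exists>i\<le>n. c i \<noteq> \<zero>"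
      using Suc.prems(3) cn le_Suc_eq by metis
    ultimately show ?thesis by (rule Suc.IH[OF x c, rotated])
  next
    case gen
    obtain \<alpha> where \<alpha>: "\<alpha> \<in> K" "\<alpha> \<noteq> \<zero>" "(\<Oplus>i\<in>{..Suc n}. c i \<otimes> \<alpha> [^] (p ^ i)) = \<zero>"
      using additive_root[of c "Suc n"] c gen by blast
    have \<alpha>R: "\<alpha> \<in> carrier R" using \<alpha>(1) KR by blast
    have powK: "a [^] (k::nat) \<in> K" if "a \<in> K" for a k
      using that by (induction k) (auto intro: subringE(3,6)[OF Ksub])
    define t where "t = inv \<alpha> \<otimes> x"
    have unit: "\<alpha> \<in> Units R" using \<alpha> \<alpha>R by (simp add: field_Units)
    have t: "t \<in> carrier R" "x = \<alpha> \<otimes> t"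
      unfolding t_def using unit x \<alpha>R by (auto simp: m_assoc[symmetric])
    \<comment> \<open>These are the coefficients after the substitution
      \<open>x = \<alpha> \<otimes> t\<close>. Since \<alpha> is a root, t = 1 is a root of the new
      polynomial; hence the last partial sum \<open>E (Suc n)\<close> vanishes and takes the
      boundary term of the summation with it.\<close>
    define e where "e = (\<lambda>i. c i \<otimes> \<alpha> [^] (p ^ i))"
    have e: "e i \<in> K" "e i \<in> carrier R" for i
      using subringE(6)[OF Ksub c powK[OF \<alpha>(1)]] KR by (auto simp: e_def)
    define E where "E = (\<lambda>i. \<Oplus>j\<in>{..i}. e j)"
    have E_Suc: "E (Suc i) = e (Suc i) \<oplus> E i" for i
      unfolding E_def using e by (subst finsum_Suc) auto
    have E0: "E 0 = e 0" unfolding E_def using e by simp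
    have E: "E i \<in> K" for i
      by (induction i) (auto simp: E0 E_Suc intro: e subringE(7)[OF Ksub])
    have ER: "E i \<in> carrier R" for i using E KR by blast
    define u where "u = t [^] p \<ominus> t"
    have u: "u \<in> carrier R" using t by (simp add: u_def)
    have upow: "u [^] (p ^ i) = t [^] (p ^ Suc i) \<ominus> t [^] (p ^ i)" for i
      unfolding u_def using t by (simp add: freshmans_dream_minus_pow[OF p] nat_pow_pow)
    \<comment> \<open>Abel summation\<close>
    have abel: "(\<Oplus>i\<in>{..m}. e i \<otimes> t [^] (p ^ i)) \<oplus> (\<Oplus>i\<in>{..<m}. E i \<otimes> u [^] (p ^ i))
        = E m \<otimes> t [^] (p ^ m)" for m
    proof (induction m)
      case 0
      then show ?case using e t by (simp add: E0)
    next
      case (Suc m)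
      let ?A = "\<Oplus>i\<in>{..m}. e i \<otimes> t [^] (p ^ i)" and ?B = "\<Oplus>i\<in>{..<m}. E i \<otimes> u [^] (p ^ i)"
      have cl: "?A \<in> carrier R" "?B \<in> carrier R" "t [^] (p ^ m) \<in> carrier R" "t [^] (p ^ Suc m) \<in> carrier R"
        using e ER t u by (auto intro!: finsum_closed)
      have "(\<Oplus>i\<in>{..Suc m}. e i \<otimes> t [^] (p ^ i)) \<oplus> (\<Oplus>i\<in>{..<Suc m}. E i \<otimes> u [^] (p ^ i))
         = (e (Suc m) \<otimes> t [^] (p ^ Suc m) \<oplus> ?A) \<oplus> (E m \<otimes> u [^] (p ^ m) \<oplus> ?B)"
        using e ER t u by (subst finsum_Suc) (auto simp: lessThan_Suc)
      also have "\<dots> = e (Suc m) \<otimes> t [^] (p ^ Suc m) \<oplus> (?A \<oplus> ?B) \<oplus> E m \<otimes> u [^] (p ^ m)"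
        using cl e(2) ER u by (simp add: a_ac)
      also have "\<dots> = e (Suc m) \<otimes> t [^] (p ^ Suc m) \<oplus> (E m \<otimes> t [^] (p ^ m)
          \<oplus> E m \<otimes> u [^] (p ^ m))"
        unfolding Suc using cl(3,4) e(2) ER u by (simp add: a_assoc)
      also have "E m \<otimes> t [^] (p ^ m) \<oplus> E m \<otimes> u [^] (p ^ m) = E m \<otimes> t [^] (p ^ Suc m)"
      proof -
        have "t [^] (p ^ m) \<oplus> (t [^] (p ^ Suc m) \<ominus> t [^] (p ^ m)) = t [^] (p ^ Suc m)"
          using cl(3,4) by (metis minus_eq a_comm r_neg2 a_inv_closed)
        then show ?thesis
          unfolding upow using cl(3,4) ER[of m] by (metis r_distr minus_closed)
      qed
      also have "e (Suc m) \<otimes> t [^] (p ^ Suc m) \<oplus> E m \<otimes> t [^] (p ^ Suc m)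
          = E (Suc m) \<otimes> t [^] (p ^ Suc m)"
        unfolding E_Suc using cl(4) ER e by (simp add: l_distr)
      finally show ?case .
    qed
    have "(\<Oplus>i\<in>{..Suc n}. e i \<otimes> t [^] (p ^ i)) = (\<Oplus>i\<in>{..Suc n}. c i \<otimes> x [^] (p ^ i))"
      using cR \<alpha>R t by (intro finsum_cong') (auto simp: e_def nat_pow_distrib m_assoc)
    moreover have "E (Suc n) = \<zero>" using \<alpha>(3) by (simp add: E_def e_def)
    ultimately have "(\<Oplus>i\<in>{..n}. E i \<otimes> u [^] (p ^ i)) = \<zero>"
      using abel[of "Suc n"] Suc.prems(4) ER u t by (simp add: lessThan_Suc_atMost)
    \<comment> \<open>The shorter equation is nontrivial because \<open>E 0\<close> is the old
      linear coefficient times \<alpha>.\<close>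
    moreover have "\<exists>i\<le>n. E i \<noteq> \<zero>"
      using gen(1) \<alpha>(2) \<alpha>R cR integral by (intro exI[of _ 0]) (auto simp: E0 e_def)
    ultimately have "u \<in> K" by (rule Suc.IH[OF u E, rotated])
    then obtain \<xi> where \<xi>: "\<xi> \<in> K" "\<xi> [^] p \<ominus> \<xi> = u" using artin_schreier by blast
    have \<xi>R: "\<xi> \<in> carrier R" using \<xi> KR by blast
    \<comment> \<open>Both t and \<xi> solve z^p - z = u, so their difference is fixed by the
      Frobenius and lies in the prime field, hence in \<open>K\<close>.\<close>
    have "(t \<ominus> \<xi>) [^] p = t [^] p \<ominus> \<xi> [^] p"
      by (rule freshmans_dream_minus[OF p t(1) \<xi>R])
    also have "t [^] p = u \<oplus> t" using t by (simp add: u_def minus_eq a_assoc l_neg)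
    also have "\<xi> [^] p = u \<oplus> \<xi>" using \<xi>R unfolding \<xi>(2)[symmetric] by (simp add: minus_eq a_assoc l_neg)
    also have "(u \<oplus> t) \<ominus> (u \<oplus> \<xi>) = t \<ominus> \<xi>"
    proof -
      have "(u \<oplus> t) \<ominus> (u \<oplus> \<xi>) = (u \<oplus> \<ominus> u) \<oplus> (t \<ominus> \<xi>)"
        using u t \<xi>R by (simp add: minus_eq minus_add a_ac)
      then show ?thesis using u t \<xi>R by (simp add: r_neg)
    qed
    finally obtain i :: nat where i: "t \<ominus> \<xi> = [i] \<cdot> \<one>"
      using pow_prime_fixed[OF p, of "t \<ominus> \<xi>"] t \<xi>R by auto
    have "[i] \<cdot> \<one> \<in> K"
      by (induction i) (auto intro: subringE(2,3,7)[OF Ksub])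
    then have "[i] \<cdot> \<one> \<oplus> \<xi> \<in> K" using \<xi> by (intro subringE(7)[OF Ksub])
    also have "[i] \<cdot> \<one> \<oplus> \<xi> = t"
      unfolding i[symmetric] using t \<xi>R by (simp add: minus_eq a_assoc l_neg)
    finally show ?thesis unfolding t(2) using \<alpha>(1) by (intro subringE(6)[OF Ksub])
  qed
qed

text \<open>A polynomial has its roots in an algebraic closure \<open>L\<close>. Every element of
  \<open>L\<close> lies in the image of \<open>R\<close> by the subfield lemma, so a root pulls back
  along the injective embedding \<open>h\<close>.\<close>

theorem (in field) algebraically_closed_of_additive_polys:
  fixes p :: nat
  assumes p: "Factorial_Ring.prime p" "[p] \<cdot> \<one> = \<zero>"
    and perfect: "\<And>c. c \<in> carrier R \<Longrightarrow> \<exists>b\<in>carrier R. b [^] p = c"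
    and artin_schreier: "\<And>a. a \<in> carrier R \<Longrightarrow> \<exists>b\<in>carrier R. b [^] p \<ominus> b = a"
    and additive_root: "\<And>c n. \<lbrakk>\<And>i. c i \<in> carrier R; c 0 \<noteq> \<zero>; n > 0; c n \<noteq> \<zero>\<rbrakk>
       \<Longrightarrow> \<exists>\<alpha>\<in>carrier R. \<alpha> \<noteq> \<zero> \<and> (\<Oplus>i\<in>{..n}. c i \<otimes> \<alpha> [^] (p ^ i)) = \<zero>"
  shows "algebraically_closed R"
proof (rule algebraically_closedI)
  obtain L :: "((('a list \<times> nat) multiset) \<Rightarrow> 'a) ring"
    where L: "algebraic_closure L (indexed_const ` (carrier R))" and h: "indexed_const \<in> ring_hom R L"
    using exists_closure by blast
  define h where "h = (indexed_const :: 'a \<Rightarrow> (('a list \<times> nat) multiset) \<Rightarrow> 'a)"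
  define K where "K = h ` carrier R"
  interpret L: algebraic_closure L K using L unfolding K_def h_def .
  interpret h: ring_hom_ring R L h
    by (intro ring_hom_ringI2 ring_axioms L.ring_axioms) (use h in \<open>simp add: h_def\<close>)
  have hinj: "inj_on h (carrier R)"
    using h.non_trivial_field_hom_imp_inj[OF field_axioms] L.one_not_zero h.hom_one
    by (metis imageI one_closed singletonD)
  have sub: "subfield K L" by (rule L.subfield_axioms)
  have h0: "h x = \<zero>\<^bsub>L\<^esub> \<longleftrightarrow> x = \<zero>" if "x \<in> carrier R" for x
    using hinj that by (metis h.hom_zero inj_on_eq_iff zero_closed)
  have "[p] \<cdot>\<^bsub>L\<^esub> \<one>\<^bsub>L\<^esub> = \<zero>\<^bsub>L\<^esub>"
  proof -
    have "h ([k] \<cdot> \<one>) = [k] \<cdot>\<^bsub>L\<^esub> \<one>\<^bsub>L\<^esub>" for k :: nat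
      by (induction k) auto
    from this[of p] show ?thesis using p(2) by simp
  qed
  note pL = p(1) this
  have LK: "x \<in> K" if x: "x \<in> carrier L" for x
  proof -
    obtain n c where c: "\<And>i. c i \<in> K" "\<exists>i\<le>n. c i \<noteq> \<zero>\<^bsub>L\<^esub>"
      "(\<Oplus>\<^bsub>L\<^esub>i\<in>{..n}. c i \<otimes>\<^bsub>L\<^esub> x [^]\<^bsub>L\<^esub> (p ^ i)) = \<zero>\<^bsub>L\<^esub>"
      by (rule L.algebraic_imp_additive_poly_root[OF sub x L.algebraic_extension[OF x], of p]) (rule that)
    show ?thesis
    proof (rule L.additive_poly_root_in_subfield[OF pL sub _ _ _ x c])
      fix a assume "a \<in> K"
      then obtain a' where a': "a' \<in> carrier R" "a = h a'" unfolding K_def by blast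
      obtain b where "b \<in> carrier R" "b [^] p = a'" using perfect a' by blast
      then show "\<exists>b\<in>K. b [^]\<^bsub>L\<^esub> p = a"
        using a' h.hom_nat_pow by (auto simp: K_def)
    next
      fix a assume "a \<in> K"
      then obtain a' where a': "a' \<in> carrier R" "a = h a'" unfolding K_def by blast
      obtain b where b: "b \<in> carrier R" "b [^] p \<ominus> b = a'" using artin_schreier a' by blast
      then have "h b [^]\<^bsub>L\<^esub> p \<ominus>\<^bsub>L\<^esub> h b = a"
        unfolding a'(2) b(2)[symmetric] by (simp add: minus_eq L.minus_eq h.hom_nat_pow)
      then show "\<exists>b\<in>K. b [^]\<^bsub>L\<^esub> p \<ominus>\<^bsub>L\<^esub> b = a" using b by (auto simp: K_def)
    next
      fix c :: "nat \<Rightarrow> _" and n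
      assume c: "\<And>i. c i \<in> K" "c 0 \<noteq> \<zero>\<^bsub>L\<^esub>" "n > 0" "c n \<noteq> \<zero>\<^bsub>L\<^esub>"
      then have "\<forall>i. \<exists>a. a \<in> carrier R \<and> c i = h a" unfolding K_def by blast
      then obtain a where a: "\<And>i. a i \<in> carrier R" "\<And>i. c i = h (a i)" by metis
      then have "a 0 \<noteq> \<zero>" "a n \<noteq> \<zero>" using c by auto
      then obtain \<alpha> where \<alpha>: "\<alpha> \<in> carrier R" "\<alpha> \<noteq> \<zero>" "(\<Oplus>i\<in>{..n}. a i \<otimes> \<alpha> [^] (p ^ i)) = \<zero>"
        using additive_root[of a n] a c by blast
      have "(\<Oplus>\<^bsub>L\<^esub>i\<in>{..n}. c i \<otimes>\<^bsub>L\<^esub> h \<alpha> [^]\<^bsub>L\<^esub> (p ^ i))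
          = h (\<Oplus>i\<in>{..n}. a i \<otimes> \<alpha> [^] (p ^ i))"
        using a \<alpha> by (subst h.hom_finsum) (auto intro!: L.finsum_cong' simp: h.hom_nat_pow)
      then have "(\<Oplus>\<^bsub>L\<^esub>i\<in>{..n}. c i \<otimes>\<^bsub>L\<^esub> h \<alpha> [^]\<^bsub>L\<^esub> (p ^ i)) = \<zero>\<^bsub>L\<^esub>"
        using \<alpha>(3) by simp
      then show "\<exists>\<alpha>\<in>K. \<alpha> \<noteq> \<zero>\<^bsub>L\<^esub> \<and> (\<Oplus>\<^bsub>L\<^esub>i\<in>{..n}. c i \<otimes>\<^bsub>L\<^esub> \<alpha> [^]\<^bsub>L\<^esub> (p ^ i)) = \<zero>\<^bsub>L\<^esub>"
        using \<alpha> h0 by (auto simp: K_def)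
    qed
  qed
  fix P assume P: "P \<in> carrier (poly_ring R)" "degree P > 1"
  have setP: "set P \<subseteq> carrier R" using P(1) by (simp add: univ_poly_carrier[symmetric] polynomial_incl)
  have hP: "map h P \<in> carrier (K[X]\<^bsub>L\<^esub>)"
    using h.subfield_polynomial_hom[OF carrier_is_subfield L.one_not_zero P(1)] by (simp add: K_def)
  then have "L.splitted (map h P)" by (rule L.roots_over_subfield)
  then have "size (L.roots (map h P)) = degree P" by (simp add: L.splitted_def)
  then obtain x where "x \<in># L.roots (map h P)" using P(2) by (metis multiset_nonemptyE not_less_zero size_empty)
  moreover have "map h P \<in> carrier (poly_ring L)"
    using hP L.carrier_polynomial_shell[OF subfieldE(1)[OF sub]] by blast
  ultimately have x: "x \<in> carrier L" "L.eval (map h P) x = \<zero>\<^bsub>L\<^esub>"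
    using L.roots_mem_iff_is_root by (auto simp: L.is_root_def)
  then obtain y where y: "y \<in> carrier R" "x = h y" using LK unfolding K_def by blast
  have "h (eval P y) = \<zero>\<^bsub>L\<^esub>" using h.eval_hom'[OF y(1) setP] x y by simp
  then show "\<exists>x\<in>carrier R. eval P x = \<zero>"
    using h0 eval_in_carrier[OF setP y(1)] y(1) by blast
qed

section \<open>Vectors, cones and well-ordered sets of reals\<close>

lemma rvec_add [simp]: "rvec (a + b) = rvec a + rvec b"
  by (simp add: rvec_def vec_eq_iff of_rat_add)

lemma rvec_diff [simp]: "rvec (a - b) = rvec a - rvec b"
  by (simp add: rvec_def vec_eq_iff of_rat_diff)

lemma rvec_0 [simp]: "rvec 0 = 0"
  by (simp add: rvec_def vec_eq_iff)

lemma rvec_minus [simp]: "rvec (- a) = - rvec a"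
  by (simp add: rvec_def vec_eq_iff of_rat_minus)

lemma rvec_scale [simp]: "rvec (q *s a) = of_rat q *\<^sub>R rvec a"
  by (simp add: rvec_def vec_eq_iff of_rat_mult)

lemma rvec_inject [simp]: "rvec a = rvec b \<longleftrightarrow> a = b"
  by (simp add: rvec_def vec_eq_iff)

text \<open>Rational independence in the form used throughout: a direction in \<open>Rli\<close>
  separates rational points and so orders them totally.\<close>

lemma Rli_inner_eq_iff:
  assumes "w \<in> Rli"
  shows "w \<bullet> rvec a = w \<bullet> rvec b \<longleftrightarrow> a = b"
proof
  assume eq: "w \<bullet> rvec a = w \<bullet> rvec b"
  have "(\<Sum>i\<in>UNIV. of_rat (a $ i - b $ i) * w $ i) = w \<bullet> rvec a - w \<bullet> rvec b"
    by (simp add: inner_vec_def rvec_def of_rat_diff sum_subtractf[symmetric] algebra_simps)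
  then have "(\<Sum>i\<in>UNIV. of_rat (a $ i - b $ i) * w $ i) = 0" using eq by simp
  then have "\<forall>i. a $ i - b $ i = 0"
    using assms[unfolded Rli_def mem_Collect_eq, THEN spec, of "\<lambda>i. a $ i - b $ i"] by blast
  then show "a = b" by (simp add: vec_eq_iff)
qed simp

text \<open>The complement is covered by countably many hyperplanes, one for each nonzero rational
  functional, so it is negligible, which a nonempty open set is not.\<close>

lemma Rli_dense:
  fixes U :: "(real ^ 'd) set"
  assumes "open U" "U \<noteq> {}"
  shows "\<exists>w\<in>U. w \<in> Rli"
proof -
  define H where "H = (\<lambda>c::'d \<Rightarrow> rat. {w :: real ^ 'd. (\<chi> i. of_rat (c i)) \<bullet> w = 0})"
  have sub: "- Rli \<subseteq> (\<Union>c\<in>{c. \<exists>i. c i \<noteq> 0}. H c)"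
    by (force simp: Rli_def H_def inner_vec_def)
  have "negligible (H c)" if "\<exists>i. c i \<noteq> 0" for c
    unfolding H_def by (rule negligible_hyperplane) (use that in \<open>auto simp: vec_eq_iff\<close>)
  then have "negligible (\<Union>c\<in>{c. \<exists>i. c i \<noteq> 0}. H c)"
    by (intro negligible_countable_Union) auto
  then have "negligible (- Rli :: (real ^ 'd) set)"
    using negligible_subset sub by blast
  then have "\<not> U \<subseteq> - Rli"
    using open_not_negligible[OF assms] negligible_subset by blast
  then show ?thesis by blast
qed

text \<open>Well-ordering of a set of reals, phrased with subsequences. In this form sums and unions
  are handled by passing to a subsequence once for each part, without minimal elements.\<close>

definition wqo_set :: "real set \<Rightarrow> bool" where
  "wqo_set S \<longleftrightarrow> (\<forall>f :: nat \<Rightarrow> real. range f \<subseteq> S \<longrightarrow> (\<exists>r. strict_mono (r :: nat \<Rightarrow> nat) \<and> incseq (f \<circ> r)))"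

lemma wqo_set_subset: "wqo_set S \<Longrightarrow> T \<subseteq> S \<Longrightarrow> wqo_set T"
  unfolding wqo_set_def by (meson subset_trans)

lemma wqo_setD:
  assumes "wqo_set S" "\<And>n::nat. f n \<in> S"
  shows "\<exists>r. strict_mono r \<and> incseq (f \<circ> r)"
  using assms unfolding wqo_set_def by blast

lemma incseq_comp_strict_mono:
  "incseq (f :: nat \<Rightarrow> real) \<Longrightarrow> strict_mono r \<Longrightarrow> incseq (f \<circ> r)"
  by (auto simp: monotone_def strict_mono_less_eq)


lemma wqo_set_iff_well_ordered: "wqo_set S \<longleftrightarrow> well_ordered S"
proof
  let ?r = "{(x, y). x \<in> S \<and> y \<in> S \<and> x \<le> y}"
  assume "wqo_set S"
  have "wf (?r - Id)"
  proof (rule ccontr)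
    assume "\<not> wf (?r - Id)"
    then obtain f where f: "\<And>i. (f (Suc i), f i) \<in> ?r - Id"
      unfolding wf_iff_no_infinite_down_chain by blast
    then obtain r where r: "strict_mono r" "incseq (f \<circ> r)"
      using wqo_setD[OF \<open>wqo_set S\<close>, of f] by blast
    have "f (Suc i) < f i" for i using f[of i] by auto
    then have "- f m < - f n" if "m < n" for m n
      by (intro lift_Suc_mono_less[of "\<lambda>i. - f i", OF _ that]) simp
    from this[of "r 0" "r 1"] have "f (r 1) < f (r 0)" using r(1) by (simp add: strict_mono_less)
    then show False using incseqD[OF r(2), of 0 1] by simp
  qed
  then show "well_ordered S"
    by (auto simp: well_ordered_def order_on_defs refl_on_def trans_def antisym_def total_on_def)
next
  let ?r = "{(x, y). x \<in> S \<and> y \<in> S \<and> x \<le> y}"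
  assume "well_ordered S"
  then have wf: "wf (?r - Id)" by (simp add: well_ordered_def well_order_on_def)
  show "wqo_set S"
    unfolding wqo_set_def
  proof (intro allI impI)
    fix f :: "nat \<Rightarrow> real"
    assume f: "range f \<subseteq> S"
    obtain r where r: "strict_mono r" "monoseq (\<lambda>n. f (r n))"
      using seq_monosub by blast
    obtain z where z: "z \<in> range (f \<circ> r)" "\<And>y. (y, z) \<in> ?r - Id \<Longrightarrow> y \<notin> range (f \<circ> r)"
      using wfE_min[OF wf, of "f (r 0)" "range (f \<circ> r)"] by auto
    then obtain k where k: "z = f (r k)" by auto
    have le: "f (r k) \<le> f (r n)" for n
      using z(2)[of "f (r n)"] f k by force
    show "\<exists>r. strict_mono r \<and> incseq (f \<circ> r)"
    proof (cases "incseq (f \<circ> r)")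
      case False
      then have "decseq (f \<circ> r)" using r(2) by (auto simp: monoseq_iff o_def)
      \<comment> \<open>A decreasing subsequence is constant from the index of its least value on,
        so its tail is also increasing.\<close>
      then have "f (r (n + k)) = f (r k)" for n
        using le[of "n + k"] decseqD[of "f \<circ> r" k "n + k"] by simp
      then have "incseq (f \<circ> (\<lambda>n. r (n + k)))" by (simp add: monotone_def)
      moreover have "strict_mono (\<lambda>n. r (n + k))"
        using r(1) by (simp add: strict_mono_def)
      ultimately show ?thesis by blast
    qed (use r in blast)
  qed
qed

lemma wqo_set_has_least:
  assumes "wqo_set S" "x \<in> S"
  shows "\<exists>z\<in>S. \<forall>y\<in>S. z \<le> y"
proof -
  let ?r = "{(x, y). x \<in> S \<and> y \<in> S \<and> x \<le> y}"
  have "wf (?r - Id)"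
    using assms(1) unfolding wqo_set_iff_well_ordered well_ordered_def well_order_on_def by blast
  then obtain z where z: "z \<in> S" "\<And>y. (y, z) \<in> ?r - Id \<Longrightarrow> y \<notin> S"
    using assms(2) by (rule wfE_min) (rule that)
  have "z \<le> y" if y: "y \<in> S" for y
  proof (rule ccontr)
    assume "\<not> z \<le> y"
    then have "(y, z) \<in> ?r - Id" using y z(1) by simp
    then show False using z(2) y by metis
  qed
  then show ?thesis using z(1) by (intro bexI[of _ z] ballI)
qed

lemma wqo_set_Un:
  assumes "wqo_set S" "wqo_set T"
  shows "wqo_set (S \<union> T)"
  unfolding wqo_set_def
proof (intro allI impI)
  fix f :: "nat \<Rightarrow> real"
  assume f: "range f \<subseteq> S \<union> T"
  have sub: "\<exists>r. strict_mono r \<and> incseq (f \<circ> r)" if V: "wqo_set V" "infinite {n. f n \<in> V}" for V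
  proof -
    obtain s where s: "strict_mono (s :: nat \<Rightarrow> nat)" "\<forall>n. s n \<in> {n. f n \<in> V}"
      using infinite_enumerate[OF V(2)] by blast
    have "\<exists>r. strict_mono r \<and> incseq ((f \<circ> s) \<circ> r)"
      by (rule wqo_setD[OF V(1)]) (use s in simp)
    then show ?thesis using strict_mono_o[OF s(1)] by (metis o_assoc)
  qed
  have "{n. f n \<in> S} \<union> {n. f n \<in> T} = UNIV" using f by auto
  then have "infinite {n. f n \<in> S} \<or> infinite {n. f n \<in> T}"
    by (metis finite_Un infinite_UNIV_nat)
  then show "\<exists>r. strict_mono r \<and> incseq (f \<circ> r)" using sub assms by blast
qed

lemma wqo_set_singleton [simp]: "wqo_set {x}"
  unfolding wqo_set_def
  by (intro allI impI exI[of _ id]) (auto simp: strict_mono_def monotone_def image_subset_iff)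

lemma wqo_set_scale:
  assumes "wqo_set S" "t \<ge> 0"
  shows "wqo_set ((\<lambda>x. t * x) ` S)"
  unfolding wqo_set_def
proof (intro allI impI)
  fix f :: "nat \<Rightarrow> real"
  assume "range f \<subseteq> (\<lambda>x. t * x) ` S"
  then have "\<forall>n. \<exists>g. g \<in> S \<and> f n = t * g" by blast
  then obtain g where g: "\<And>n. g n \<in> S" "\<And>n. f n = t * g n" by metis
  obtain r where "strict_mono r" "incseq (g \<circ> r)" using wqo_setD[of _ g, OF assms(1) g(1)] by blast
  then show "\<exists>r. strict_mono r \<and> incseq (f \<circ> r)"
    using assms(2) by (intro exI[of _ r]) (auto simp: monotone_def g(2) mult_left_mono)
qed

lemma wqo_set_sum:
  assumes "wqo_set S" "wqo_set T"
  shows "wqo_set {x + y |x y. x \<in> S \<and> y \<in> T}"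
  unfolding wqo_set_def
proof (intro allI impI)
  fix f :: "nat \<Rightarrow> real"
  assume "range f \<subseteq> {x + y |x y. x \<in> S \<and> y \<in> T}"
  then have "\<forall>n. \<exists>g h. g \<in> S \<and> h \<in> T \<and> f n = g + h" by blast
  then obtain g h where g: "\<And>n. g n \<in> S" "\<And>n. h n \<in> T" "\<And>n. f n = g n + h n" by metis
  obtain r where r: "strict_mono r" "incseq (g \<circ> r)" using wqo_setD[of _ g, OF assms(1) g(1)] by blast
  obtain s where s: "strict_mono s" "incseq (h \<circ> r \<circ> s)"
    using wqo_setD[OF assms(2), of "h \<circ> r"] g(2) by auto
  have "incseq (g \<circ> r \<circ> s)" by (rule incseq_comp_strict_mono[OF r(2) s(1)])
  with s(2) have "incseq (f \<circ> (r \<circ> s))" by (auto simp: monotone_def g(3) intro: add_mono)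
  then show "\<exists>r. strict_mono r \<and> incseq (f \<circ> r)" using strict_mono_o[OF r(1) s(1)] by blast
qed

section \<open>Cones around a direction\<close>

lemma Rli_scale:
  assumes "t *\<^sub>R w \<in> Rli"
  shows "w \<in> Rli"
  unfolding Rli_def
proof (intro CollectI allI impI)
  fix c :: "'a \<Rightarrow> rat" and i
  assume 0: "(\<Sum>i\<in>UNIV. of_rat (c i) * w $ i) = 0"
  have "(\<Sum>i\<in>UNIV. of_rat (c i) * (t *\<^sub>R w) $ i) = t * (\<Sum>i\<in>UNIV. of_rat (c i) * w $ i)"
    by (simp add: sum_distrib_left algebra_simps)
  then show "c i = 0" using assms 0 by (simp add: Rli_def)
qed

text \<open>Estimates are made for directions in a ball, while \<open>p_discrete\<close> speaks of
  open cones. The cone generated by the ball mediates, because well-ordering of values and the side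
  of a hyperplane do not change when the direction is scaled by a positive factor.\<close>

lemma open_cone_over_ball:
  fixes w :: "real ^ 'd"
  assumes "\<epsilon> > 0"
  obtains \<sigma> where "open \<sigma>" "convex_cone \<sigma>" "w \<in> \<sigma>"
    "\<And>x. x \<in> \<sigma> \<Longrightarrow> \<exists>t>0. \<exists>y\<in>ball w \<epsilon>. x = t *\<^sub>R y"
proof
  define \<sigma> where "\<sigma> = (\<Union>t\<in>{0<..}. ball (t *\<^sub>R w) (t * \<epsilon>))"
  show "open \<sigma>" unfolding \<sigma>_def by auto
  show "w \<in> \<sigma>" unfolding \<sigma>_def using assms by (auto intro!: bexI[of _ 1])
  have "convex \<sigma>"
    unfolding convex_def
  proof (intro ballI allI impI)
    fix x y u v
    assume xy: "x \<in> \<sigma>" "y \<in> \<sigma>" and uv: "0 \<le> u" "0 \<le> v" "u + v = (1::real)"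
    obtain s t where st: "s > 0" "t > 0" "norm (s *\<^sub>R w - x) < s * \<epsilon>" "norm (t *\<^sub>R w - y) < t * \<epsilon>"
      using xy by (auto simp: \<sigma>_def dist_norm)
    have pos: "u * s + v * t > 0"
      using st uv by (cases "u = 0") (auto intro: add_pos_nonneg)
    have "norm ((u * s + v * t) *\<^sub>R w - (u *\<^sub>R x + v *\<^sub>R y))
        = norm (u *\<^sub>R (s *\<^sub>R w - x) + v *\<^sub>R (t *\<^sub>R w - y))"
      by (simp add: algebra_simps)
    also have "\<dots> \<le> u * norm (s *\<^sub>R w - x) + v * norm (t *\<^sub>R w - y)"
      using norm_triangle_ineq[of "u *\<^sub>R (s *\<^sub>R w - x)" "v *\<^sub>R (t *\<^sub>R w - y)"] uv by simp
    also have "\<dots> < u * (s * \<epsilon>) + v * (t * \<epsilon>)"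
    proof (cases "u = 0")
      case False
      then show ?thesis using st uv by (intro add_less_le_mono mult_strict_left_mono mult_left_mono) auto
    qed (use st uv in simp)
    finally have "norm ((u * s + v * t) *\<^sub>R w - (u *\<^sub>R x + v *\<^sub>R y)) < (u * s + v * t) * \<epsilon>"
      by (simp add: algebra_simps)
    then show "u *\<^sub>R x + v *\<^sub>R y \<in> \<sigma>" unfolding \<sigma>_def using pos by (auto simp: dist_norm)
  qed
  moreover have "c *\<^sub>R x \<in> \<sigma>" if "x \<in> \<sigma>" "c > 0" for x c
  proof -
    obtain t where t: "t > 0" "norm (t *\<^sub>R w - x) < t * \<epsilon>" using \<open>x \<in> \<sigma>\<close> by (auto simp: \<sigma>_def dist_norm)
    have "norm ((c * t) *\<^sub>R w - c *\<^sub>R x) = c * norm (t *\<^sub>R w - x)"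
      using \<open>c > 0\<close> by (simp add: scaleR_diff_right[symmetric] scaleR_scaleR[symmetric] del: scaleR_scaleR)
    also have "\<dots> < c * t * \<epsilon>" using t \<open>c > 0\<close> by simp
    finally show ?thesis unfolding \<sigma>_def using t \<open>c > 0\<close> by (auto simp: dist_norm intro!: bexI[of _ "c * t"])
  qed
  ultimately show "convex_cone \<sigma>" by (simp add: convex_cone_def)
  fix x assume "x \<in> \<sigma>"
  then obtain t where t: "t > 0" "norm (t *\<^sub>R w - x) < t * \<epsilon>" by (auto simp: \<sigma>_def dist_norm)
  have "norm (w - inverse t *\<^sub>R x) = norm (inverse t *\<^sub>R (t *\<^sub>R w - x))"
    using t by (simp add: algebra_simps)
  also have "\<dots> = inverse t * norm (t *\<^sub>R w - x)" using t(1) by simp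
  also have "\<dots> < inverse t * (t * \<epsilon>)" using t by (intro mult_strict_left_mono) auto
  also have "\<dots> = \<epsilon>" using t(1) by simp
  finally show "\<exists>t>0. \<exists>y\<in>ball w \<epsilon>. x = t *\<^sub>R y"
    using t by (intro exI[of _ t] conjI bexI[of _ "inverse t *\<^sub>R x"]) (auto simp: dist_norm)
qed

text \<open>The round cone \<open>C\<close> is the normal form of the cones in condition (b). By
  Cauchy-Schwarz its defining inequality makes every direction within \<epsilon> of w nonnegative on
  \<open>C\<close>, so w is interior to the dual.\<close>

lemma narrow_cone_pointed:
  fixes w :: "real ^ 'd"
  assumes "\<epsilon> > 0"
  defines "C \<equiv> {x. \<epsilon> * norm x \<le> w \<bullet> x}"
  shows "pointed_cone C" "w \<in> interior (dual_cone C)"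
proof -
  have "convex C"
    unfolding convex_def C_def
  proof (intro ballI allI impI CollectI, elim CollectE)
    fix x y u v
    assume h: "\<epsilon> * norm x \<le> w \<bullet> x" "\<epsilon> * norm y \<le> w \<bullet> y" "0 \<le> u" "0 \<le> v" "u + v = (1::real)"
    have "\<epsilon> * norm (u *\<^sub>R x + v *\<^sub>R y) \<le> \<epsilon> * (u * norm x + v * norm y)"
      using norm_triangle_ineq[of "u *\<^sub>R x" "v *\<^sub>R y"] h assms(1) by (intro mult_left_mono) auto
    also have "\<dots> = u * (\<epsilon> * norm x) + v * (\<epsilon> * norm y)" by (simp add: algebra_simps)
    also have "\<dots> \<le> u * (w \<bullet> x) + v * (w \<bullet> y)" using h by (intro add_mono mult_left_mono)
    finally show "\<epsilon> * norm (u *\<^sub>R x + v *\<^sub>R y) \<le> w \<bullet> (u *\<^sub>R x + v *\<^sub>R y)"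
      by (simp add: inner_add_right)
  qed
  moreover have "c *\<^sub>R x \<in> C" if "x \<in> C" "c > 0" for x c
    using that mult_left_mono[of "\<epsilon> * norm x" "w \<bullet> x" c] by (simp add: C_def algebra_simps)
  ultimately have cone: "convex_cone C" by (simp add: convex_cone_def)
  have "closed C" unfolding C_def by (intro closed_Collect_le continuous_intros)
  then have clo: "closure C = C" by (rule closure_closed)
  have "v = 0" if line: "range (\<lambda>t::real. x + t *\<^sub>R v) \<subseteq> C" for x v
  proof (rule ccontr)
    assume v: "v \<noteq> 0"
    have ge: "\<epsilon> * norm (x + t *\<^sub>R v) \<le> w \<bullet> x + t * (w \<bullet> v)" for t
      using line by (auto simp: C_def inner_add_right image_subset_iff)
    \<comment> \<open>Compare the opposite points of the line at t and -t: their w-values add up to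
      a constant, while their distance grows with t.\<close>
    have "2 * \<epsilon> * t * norm v \<le> 2 * (w \<bullet> x)" for t
    proof -
      have "2 * (t * norm v) \<le> norm ((2 * t) *\<^sub>R v)"
        by (metis abs_ge_self mult.assoc mult_right_mono norm_ge_zero norm_scaleR)
      also have "\<dots> = norm ((x + t *\<^sub>R v) - (x + (- t) *\<^sub>R v))"
        by (simp add: scaleR_2[symmetric])
      also have "\<dots> \<le> norm (x + t *\<^sub>R v) + norm (x + (- t) *\<^sub>R v)" by (rule norm_triangle_ineq4)
      finally have "\<epsilon> * (2 * (t * norm v)) \<le> \<epsilon> * (norm (x + t *\<^sub>R v) + norm (x + (- t) *\<^sub>R v))"
        using assms(1) by (intro mult_left_mono) auto
      also have "\<dots> \<le> 2 * (w \<bullet> x)"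
        using ge[of t] ge[of "- t"] by (simp add: algebra_simps)
      finally show ?thesis by (simp add: algebra_simps)
    qed
    moreover have "2 * \<epsilon> * ((\<bar>w \<bullet> x\<bar> + 1) / (\<epsilon> * norm v)) * norm v = 2 * (\<bar>w \<bullet> x\<bar> + 1)"
      using assms(1) v by (simp add: field_simps)
    ultimately have "2 * (\<bar>w \<bullet> x\<bar> + 1) \<le> 2 * (w \<bullet> x)" by metis
    then have "\<bar>w \<bullet> x\<bar> + 1 \<le> w \<bullet> x" by simp
    then have "\<bar>w \<bullet> x\<bar> + 1 \<le> \<bar>w \<bullet> x\<bar>" using abs_ge_self order_trans by blast
    then show False by simp
  qed
  then show "pointed_cone C" using cone clo unfolding pointed_cone_def by metis
  have "ball w \<epsilon> \<subseteq> dual_cone C"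
  proof
    fix y assume y: "y \<in> ball w \<epsilon>"
    have "0 \<le> y \<bullet> x" if "x \<in> C" for x
    proof -
      have "(w - y) \<bullet> x \<le> norm (w - y) * norm x" by (rule norm_cauchy_schwarz)
      also have "\<dots> \<le> \<epsilon> * norm x" using y by (intro mult_right_mono) (auto simp: dist_norm)
      also have "\<dots> \<le> w \<bullet> x" using that by (simp add: C_def)
      finally show ?thesis by (simp add: inner_diff_left)
    qed
    then show "y \<in> dual_cone C" by (simp add: dual_cone_def)
  qed
  then show "w \<in> interior (dual_cone C)"
    using assms(1) by (meson centre_in_ball interior_maximal open_ball subsetD)
qed

lemma interior_dual_cone_imp_narrow:
  fixes w :: "real ^ 'd"
  assumes "w \<in> interior (dual_cone C)"
  obtains \<epsilon> where "\<epsilon> > 0" "\<And>x. x \<in> C \<Longrightarrow> \<epsilon> * norm x \<le> w \<bullet> x"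
proof -
  obtain e where e: "e > 0" "ball w e \<subseteq> dual_cone C"
    using assms mem_interior by blast
  have "e / 2 * norm x \<le> w \<bullet> x" if "x \<in> C" for x
  proof (cases "x = 0")
    case False
    \<comment> \<open>Tilt w against x as far as the ball permits; half the radius keeps the tilted
      direction inside the open ball. Its nonnegativity on x is the claimed inequality.\<close>
    let ?y = "w - (e / 2 / norm x) *\<^sub>R x"
    have "?y \<in> ball w e" using e False by (simp add: dist_norm)
    then have "?y \<in> dual_cone C" using e by blast
    then have "0 \<le> ?y \<bullet> x" using that unfolding dual_cone_def by blast
    also have "?y \<bullet> x = w \<bullet> x - e / 2 * norm x"
      using False by (simp add: inner_diff_left dot_square_norm power2_eq_square)
    finally show ?thesis by simp
  qed simp
  then show thesis using that[of "e / 2"] e by auto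
qed

section \<open>A sequential form of p-discreteness\<close>

text \<open>Given the narrow cone of condition (b), conditions (c) and (d) together say that a sequence in \<open>A\<close> of
  bounded \<open>w\<close>-value accumulates only at rational points, which it approaches from below inside some cone
  around \<open>w\<close>.  In this form they are easily transferred to sums and unions.\<close>

definition limit_from_below :: "real ^ 'd \<Rightarrow> (nat \<Rightarrow> rat ^ 'd) \<Rightarrow> bool" where
  "limit_from_below w a \<longleftrightarrow>
     (\<exists>r q. \<exists>\<epsilon>>0. strict_mono (r :: nat \<Rightarrow> nat) \<and> (\<lambda>n. rvec (a (r n))) \<longlonglongrightarrow> rvec q \<and>
        (\<forall>n. \<epsilon> * norm (rvec (q - a (r n))) \<le> w \<bullet> rvec (q - a (r n))))"

text \<open>The cone of condition (b) becomes a linear bound with an additive constant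
  \<open>M\<close> in place of an apex. Constants of this kind combine directly for sums and unions,
  where a common apex would have to be constructed.\<close>

definition tame :: "nat \<Rightarrow> real ^ 'd \<Rightarrow> (rat ^ 'd) set \<Rightarrow> bool" where
  "tame p w A \<longleftrightarrow>
     (\<exists>\<epsilon>>0. \<forall>w' \<in> ball w \<epsilon> \<inter> Rli. wqo_set ((\<lambda>a. w' \<bullet> rvec a) ` A)) \<and>
     (\<exists>N>0. A \<subseteq> (\<Union>j::nat. lattice_over (N * int p ^ j))) \<and>
     (\<exists>\<epsilon>>0. \<exists>M. \<forall>a\<in>A. \<epsilon> * norm (rvec a) \<le> w \<bullet> rvec a + M) \<and>
     (\<forall>a :: nat \<Rightarrow> rat ^ 'd. range a \<subseteq> A \<longrightarrow> (\<exists>R. \<forall>n. w \<bullet> rvec (a n) \<le> R) \<longrightarrow>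
        limit_from_below w a)"

lemma tameE_limit:
  assumes "tame p w A" "\<And>n. a n \<in> A" "\<And>n. w \<bullet> rvec (a n) \<le> R"
  obtains r q \<epsilon> where "strict_mono (r :: nat \<Rightarrow> nat)" "\<epsilon> > 0" "(\<lambda>n. rvec (a (r n))) \<longlonglongrightarrow> rvec q"
    "\<And>n. \<epsilon> * norm (rvec (q - a (r n))) \<le> w \<bullet> rvec (q - a (r n))"
proof -
  have "range a \<subseteq> A" "\<exists>R. \<forall>n. w \<bullet> rvec (a n) \<le> R" using assms by auto
  then have "\<exists>r q. \<exists>\<epsilon>>0. strict_mono (r :: nat \<Rightarrow> nat) \<and> (\<lambda>n. rvec (a (r n))) \<longlonglongrightarrow> rvec q \<and>
           (\<forall>n. \<epsilon> * norm (rvec (q - a (r n))) \<le> w \<bullet> rvec (q - a (r n)))"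
    using assms(1) unfolding tame_def limit_from_below_def by blast
  then show thesis using that by blast
qed

text \<open>A uniform angle between \<open>A\<close> and the hyperplane through \<gamma> orthogonal
  to w. If there were none, points of \<open>A\<close> seen from \<gamma> would become almost
  orthogonal to w; they stay bounded, and by rational independence a subsequence tends to \<gamma>
  itself. It does so from below inside a cone around w, which keeps the angle away from
  zero.\<close>

lemma tame_transversal:
  assumes w: "w \<in> Rli" and A: "tame p w A"
  obtains \<epsilon> where "\<epsilon> > 0" "\<And>a. a \<in> A \<Longrightarrow> \<epsilon> * norm (rvec (a - \<gamma>)) \<le> \<bar>w \<bullet> rvec (a - \<gamma>)\<bar>"
proof (rule ccontr)
  assume neg: "\<not> thesis"
  obtain e M where e: "e > 0" "\<And>a. a \<in> A \<Longrightarrow> e * norm (rvec a) \<le> w \<bullet> rvec a + M"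
    using A unfolding tame_def by blast
  \<comment> \<open>The second entry makes \<delta> tend to 0. The cap e / 2 lets half of
    \<open>e * norm (rvec (a n))\<close> be absorbed below, which yields the bound
    \<open>B\<close>.\<close>
  define \<delta> where "\<delta> = (\<lambda>n. min (e / 2) (inverse (real (Suc n))))"
  have \<delta>: "\<delta> n > 0" for n using e by (simp add: \<delta>_def)
  have "\<exists>a\<in>A. \<bar>w \<bullet> rvec (a - \<gamma>)\<bar> < \<delta> n * norm (rvec (a - \<gamma>))" for n
    using neg that[OF \<delta>[of n]] by (meson not_le)
  then obtain a where a: "\<And>n. a n \<in> A" "\<And>n. \<bar>w \<bullet> rvec (a n - \<gamma>)\<bar> < \<delta> n * norm (rvec (a n - \<gamma>))"
    by metis
  define B where "B = 2 * (\<bar>w \<bullet> rvec \<gamma>\<bar> + e * norm (rvec \<gamma>) + \<bar>M\<bar>) / e"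
  have B: "norm (rvec (a n)) \<le> B" for n
  proof -
    have 1: "e * norm (rvec (a n)) \<le> w \<bullet> rvec \<gamma> + w \<bullet> rvec (a n - \<gamma>) + M"
      using e(2)[OF a(1)[of n]] by (simp add: inner_diff_right)
    have 2: "w \<bullet> rvec (a n - \<gamma>) \<le> \<delta> n * norm (rvec (a n - \<gamma>))" using a(2)[of n] by linarith
    have 3: "\<delta> n * norm (rvec (a n - \<gamma>)) \<le> e / 2 * (norm (rvec (a n)) + norm (rvec \<gamma>))"
      using e(1) \<delta>[of n] norm_triangle_ineq4[of "rvec (a n)" "rvec \<gamma>"]
      by (intro mult_mono) (auto simp: \<delta>_def)
    have 4: "e / 2 * (norm (rvec (a n)) + norm (rvec \<gamma>)) = e * norm (rvec (a n)) / 2 + e * norm (rvec \<gamma>) / 2"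
      by (simp add: algebra_simps)
    have "norm (rvec (a n)) * e \<le> 2 * (\<bar>w \<bullet> rvec \<gamma>\<bar> + e * norm (rvec \<gamma>) + \<bar>M\<bar>)"
    proof -
      have arith: "x \<le> 2 * (\<bar>g\<bar> + y + \<bar>m\<bar>)"
        if "x \<le> g + i + m" "i \<le> d" "d \<le> x / 2 + y / 2" "0 \<le> y" for x g i m d y :: real
        using that by argo
      show ?thesis
        using arith[OF 1 2 3[unfolded 4]] e(1) by (simp add: mult.commute)
    qed
    then show ?thesis using e(1) by (simp add: B_def pos_le_divide_eq)
  qed
  have "w \<bullet> rvec (a n) \<le> norm w * B" for n
    using B[of n] norm_cauchy_schwarz[of w "rvec (a n)"] by (meson mult_left_mono norm_ge_zero order_trans)
  then obtain r q c where r: "strict_mono (r :: nat \<Rightarrow> nat)" "c > 0" "(\<lambda>n. rvec (a (r n))) \<longlonglongrightarrow> rvec q"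
    "\<And>n. c * norm (rvec (q - a (r n))) \<le> w \<bullet> rvec (q - a (r n))"
    by (rule tameE_limit[of _ _ _ a "norm w * B", OF A a(1)]) (rule that)
  have \<delta>0: "(\<lambda>n. \<delta> (r n)) \<longlonglongrightarrow> 0"
  proof (rule tendsto_sandwich[OF _ _ tendsto_const LIMSEQ_inverse_real_of_nat])
    have "r n \<ge> n" for n using r(1) by (rule seq_suble)
    then show "\<forall>\<^sub>F n in sequentially. \<delta> (r n) \<le> inverse (real (Suc n))"
      by (intro always_eventually allI) (auto simp: \<delta>_def intro!: min.coboundedI2 le_imp_inverse_le)
  qed (use \<delta> in \<open>auto intro!: always_eventually less_imp_le\<close>)
  have "(\<lambda>n. \<bar>w \<bullet> rvec (a (r n) - \<gamma>)\<bar>) \<longlonglongrightarrow> 0"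
  proof (rule tendsto_sandwich[OF _ _ tendsto_const])
    show "(\<lambda>n. \<delta> (r n) * norm (rvec (a (r n) - \<gamma>))) \<longlonglongrightarrow> 0"
    proof -
      have "(\<lambda>n. norm (rvec (a (r n) - \<gamma>))) \<longlonglongrightarrow> norm (rvec q - rvec \<gamma>)"
        using r(3) by (auto intro!: tendsto_intros)
      from tendsto_mult[OF \<delta>0 this] show ?thesis by simp
    qed
  qed (use a(2) in \<open>auto intro!: always_eventually less_imp_le\<close>)
  moreover have "(\<lambda>n. \<bar>w \<bullet> rvec (a (r n) - \<gamma>)\<bar>) \<longlonglongrightarrow> \<bar>w \<bullet> (rvec q - rvec \<gamma>)\<bar>"
    using r(3) by (auto intro!: tendsto_intros)
  ultimately have "0 = \<bar>w \<bullet> (rvec q - rvec \<gamma>)\<bar>" by (rule LIMSEQ_unique)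
  then have "w \<bullet> rvec q = w \<bullet> rvec \<gamma>" by (simp add: inner_diff_right)
  then have q: "q = \<gamma>" using Rli_inner_eq_iff[OF w] by blast
  have "c < \<delta> (r n)" for n
  proof -
    have "c * norm (rvec (a (r n) - \<gamma>)) \<le> w \<bullet> rvec (\<gamma> - a (r n))"
      using r(4)[of n] by (simp add: q norm_minus_commute)
    also have "\<dots> \<le> \<bar>w \<bullet> rvec (a (r n) - \<gamma>)\<bar>" by (simp add: inner_diff_right)
    also have "\<dots> < \<delta> (r n) * norm (rvec (a (r n) - \<gamma>))" by (rule a(2))
    finally show ?thesis by (meson mult_right_mono norm_ge_zero not_le)
  qed
  then have "c \<le> 0" using LIMSEQ_le_const[OF \<delta>0, of c] less_imp_le by blast
  then show False using r(2) by simp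
qed

text \<open>If a - \<gamma> were nearly orthogonal to w, a small tilt of w would move a to the other
  side of the hyperplane through \<gamma>.\<close>

lemma locally_constant_sides_imp_transversal:
  assumes w: "w \<in> Rli" and \<sigma>: "open \<sigma>" "w \<in> \<sigma>"
    and sides: "\<And>w'. w' \<in> \<sigma> \<inter> Rli \<Longrightarrow> upper_part A \<gamma> w' = upper_part A \<gamma> w \<and> lower_part A \<gamma> w' = lower_part A \<gamma> w"
  obtains \<epsilon> where "\<epsilon> > 0" "\<And>a. a \<in> A \<Longrightarrow> \<epsilon> * norm (rvec (a - \<gamma>)) \<le> \<bar>w \<bullet> rvec (a - \<gamma>)\<bar>"
proof -
  obtain e where e: "e > 0" "ball w e \<subseteq> \<sigma>" using \<sigma> openE by blast
  have "e / 2 * norm (rvec (a - \<gamma>)) \<le> \<bar>w \<bullet> rvec (a - \<gamma>)\<bar>" if a: "a \<in> A" for a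
  proof (rule ccontr)
    assume neg: "\<not> ?thesis"
    let ?x = "rvec (a - \<gamma>)"
    have x: "?x \<noteq> 0" using neg by auto
    then have "w \<bullet> ?x \<noteq> 0" using Rli_inner_eq_iff[OF w, of a \<gamma>] by (auto simp: inner_diff_right)
    define s where "s = sgn (w \<bullet> ?x)"
    have s: "\<bar>s\<bar> = 1" "s * (w \<bullet> ?x) = \<bar>w \<bullet> ?x\<bar>"
      using \<open>w \<bullet> ?x \<noteq> 0\<close> by (auto simp: s_def abs_sgn mult.commute)
    \<comment> \<open>The tilted direction need not be in \<open>Rli\<close>, where alone
      \<open>sides\<close> applies. Wrong-sided directions near w form an open set, so density
      supplies one in \<open>Rli\<close>; the sign s treats both sides at once.\<close>
    define U where "U = ball w e \<inter> {y. s * (y \<bullet> ?x) < 0}"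
    have "open U" unfolding U_def by (intro open_Int open_ball open_Collect_less continuous_intros)
    moreover have "w - (s * (e / 2) / norm ?x) *\<^sub>R ?x \<in> U"
    proof -
      have "norm ((s * (e / 2) / norm ?x) *\<^sub>R ?x) = e / 2"
        using x e s(1) by (simp add: abs_mult)
      then have "w - (s * (e / 2) / norm ?x) *\<^sub>R ?x \<in> ball w e" using e by (simp add: dist_norm)
      moreover have "s * ((w - (s * (e / 2) / norm ?x) *\<^sub>R ?x) \<bullet> ?x) = \<bar>w \<bullet> ?x\<bar> - s * s * (e / 2) * norm ?x"
        using x s(2) by (simp add: inner_diff_left dot_square_norm power2_eq_square algebra_simps del: rvec_diff)
      moreover have "s * s = 1" using s(1) by (metis abs_mult_self_eq mult_1)
      ultimately show ?thesis using neg by (simp add: U_def del: rvec_diff)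
    qed
    ultimately obtain w' where w': "w' \<in> U" "w' \<in> Rli" using Rli_dense by blast
    then have sd: "upper_part A \<gamma> w' = upper_part A \<gamma> w" "lower_part A \<gamma> w' = lower_part A \<gamma> w"
      using sides e by (auto simp: U_def)
    have neg': "s * (w' \<bullet> ?x) < 0" using w' by (simp add: U_def)
    have pos: "s * (w \<bullet> ?x) > 0" using s \<open>w \<bullet> ?x \<noteq> 0\<close> by simp
    consider "s = 1" | "s = -1" using s(1) by linarith
    then show False
    proof cases
      case 1
      then have "a \<in> upper_part A \<gamma> w" "a \<notin> upper_part A \<gamma> w'"
        using neg' pos a by (auto simp: upper_part_def inner_diff_right)
      then show ?thesis using sd by simp
    next
      case 2
      then have "a \<in> lower_part A \<gamma> w" "a \<notin> lower_part A \<gamma> w'"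
        using neg' pos a by (auto simp: lower_part_def inner_diff_right)
      then show ?thesis using sd by simp
    qed
  qed
  then show thesis using that[of "e / 2"] e by auto
qed

text \<open>The converse mechanism: moving w by less than \<epsilon> changes its value on x by less
  than the size of that value.\<close>

lemma abs_inner_lower_bound_imp_same_sign:
  fixes x :: "real ^ 'd"
  assumes "\<epsilon> * norm x \<le> \<bar>w \<bullet> x\<bar>" "y \<in> ball w \<epsilon>" "x \<noteq> 0"
  shows "sgn (y \<bullet> x) = sgn (w \<bullet> x)"
proof -
  have "\<bar>(w - y) \<bullet> x\<bar> \<le> norm (w - y) * norm x" by (rule Cauchy_Schwarz_ineq2)
  also have "\<dots> < \<epsilon> * norm x" using assms by (intro mult_strict_right_mono) (auto simp: dist_norm)
  finally have "\<bar>w \<bullet> x - y \<bullet> x\<bar> < \<bar>w \<bullet> x\<bar>" using assms(1) by (simp add: inner_diff_left)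
  then show ?thesis by (auto simp: sgn_real_def split: if_splits)
qed

lemma tame_imp_p_discrete:
  assumes w: "w \<in> Rli" and A: "tame p w A"
  shows "p_discrete p w A"
  unfolding p_discrete_def
proof (intro conjI)
  obtain e where e: "e > 0" "\<And>w'. w' \<in> ball w e \<inter> Rli \<Longrightarrow> wqo_set ((\<lambda>a. w' \<bullet> rvec a) ` A)"
    using A unfolding tame_def by blast
  obtain \<sigma> where \<sigma>: "open \<sigma>" "convex_cone \<sigma>" "w \<in> \<sigma>"
    "\<And>x. x \<in> \<sigma> \<Longrightarrow> \<exists>t>0. \<exists>y\<in>ball w e. x = t *\<^sub>R y"
    by (rule open_cone_over_ball[OF e(1), of w]) (rule that)
  have "well_ordered ((\<lambda>a. w' \<bullet> rvec a) ` A)" if w': "w' \<in> \<sigma> \<inter> Rli" for w'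
  proof -
    obtain t y where y: "t > 0" "y \<in> ball w e" "w' = t *\<^sub>R y" using \<sigma>(4) w' by blast
    then have "wqo_set ((\<lambda>a. y \<bullet> rvec a) ` A)" using e(2) w' Rli_scale by blast
    from wqo_set_scale[OF this, of t] y show ?thesis
      by (simp add: wqo_set_iff_well_ordered[symmetric] image_image)
  qed
  then show "\<exists>\<sigma>. open \<sigma> \<and> convex_cone \<sigma> \<and> w \<in> \<sigma> \<and>
        (\<forall>w' \<in> \<sigma> \<inter> Rli. well_ordered ((\<lambda>a. w' \<bullet> rvec a) ` A))"
    using \<sigma> by blast
  have wqo: "wqo_set ((\<lambda>a. w \<bullet> rvec a) ` A)" using e w by simp
  obtain N where N: "N > 0" "A \<subseteq> (\<Union>j::nat. lattice_over (N * int p ^ j))"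
    using A unfolding tame_def by blast
  have "\<exists>\<gamma> \<epsilon>. \<epsilon> > 0 \<and> (\<forall>a\<in>A. \<epsilon> * norm (rvec (a - \<gamma>)) \<le> w \<bullet> rvec (a - \<gamma>))"
  proof (cases "A = {}")
    case False
    then obtain b where b: "b \<in> A" by blast
    obtain z where z: "z \<in> (\<lambda>a. w \<bullet> rvec a) ` A" "\<And>y. y \<in> (\<lambda>a. w \<bullet> rvec a) ` A \<Longrightarrow> z \<le> y"
      using wqo_set_has_least[OF wqo imageI[OF b]] by blast
    then obtain \<gamma> where \<gamma>: "z = w \<bullet> rvec \<gamma>" by blast
    obtain c where c: "c > 0" "\<And>a. a \<in> A \<Longrightarrow> c * norm (rvec (a - \<gamma>)) \<le> \<bar>w \<bullet> rvec (a - \<gamma>)\<bar>"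
      by (rule tame_transversal[OF w A]) (rule that)
    have "\<bar>w \<bullet> rvec (a - \<gamma>)\<bar> = w \<bullet> rvec (a - \<gamma>)" if "a \<in> A" for a
      using z(2) that \<gamma> by (simp add: inner_diff_right)
    then show ?thesis using c by metis
  qed (auto intro: exI[of _ 1])
  then obtain \<gamma> c where c: "c > 0" "\<And>a. a \<in> A \<Longrightarrow> c * norm (rvec (a - \<gamma>)) \<le> w \<bullet> rvec (a - \<gamma>)"
    by blast
  have "rvec a \<in> (+) (rvec \<gamma>) ` {x. c * norm x \<le> w \<bullet> x}" if "a \<in> A" for a
    using c(2)[OF that] by (auto simp: image_iff intro!: exI[of _ "rvec (a - \<gamma>)"])
  then have "A \<subseteq> {a. rvec a \<in> (+) (rvec \<gamma>) ` {x. c * norm x \<le> w \<bullet> x}} \<inter> (\<Union>j::nat. lattice_over (N * int p ^ j))"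
    using N by blast
  then show "\<exists>(N::int) (\<gamma>::rat ^ 'a) C. N > 0 \<and> pointed_cone C \<and> w \<in> interior (dual_cone C) \<and>
        A \<subseteq> {a. rvec a \<in> (+) (rvec \<gamma>) ` C} \<inter> (\<Union>j::nat. lattice_over (N * int p ^ j))"
    using narrow_cone_pointed[OF c(1), of w] N(1) by blast
  show "\<forall>a :: nat \<Rightarrow> rat ^ 'a. (\<forall>i. a i \<in> A) \<longrightarrow> convergent (\<lambda>i. w \<bullet> rvec (a i)) \<longrightarrow>
        (\<exists>q. (\<lambda>i. rvec (a i)) \<longlonglongrightarrow> rvec q)"
  proof (intro allI impI)
    fix a :: "nat \<Rightarrow> rat ^ 'a"
    assume a: "\<forall>i. a i \<in> A" and conv: "convergent (\<lambda>i. w \<bullet> rvec (a i))"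
    obtain l where l: "(\<lambda>i. w \<bullet> rvec (a i)) \<longlonglongrightarrow> l" using conv by (auto simp: convergent_def)
    obtain R where R: "\<And>i. w \<bullet> rvec (a i) \<le> R"
      using convergent_imp_Bseq[OF conv] unfolding Bseq_def by (metis abs_le_D1 real_norm_def)
    \<comment> \<open>Every subsequence has a further one with a rational limit of value l. Rational
      independence allows just one such point, so the whole sequence converges to it.\<close>
    have lim: "\<exists>r' q. strict_mono r' \<and> (\<lambda>n. rvec (a (r (r' n)))) \<longlonglongrightarrow> rvec q \<and> w \<bullet> rvec q = l"
      if r: "strict_mono (r :: nat \<Rightarrow> nat)" for r
    proof -
      obtain r' q c where r': "strict_mono (r' :: nat \<Rightarrow> nat)" "(\<lambda>n. rvec (a (r (r' n)))) \<longlonglongrightarrow> rvec q"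
        by (rule tameE_limit[of _ _ _ "\<lambda>n. a (r n)" R, OF A a[rule_format] R]) (rule that)
      have "(\<lambda>n. w \<bullet> rvec (a (r (r' n)))) \<longlonglongrightarrow> w \<bullet> rvec q"
        using r'(2) by (intro tendsto_intros)
      moreover have "(\<lambda>n. w \<bullet> rvec (a (r (r' n)))) \<longlonglongrightarrow> l"
        using LIMSEQ_subseq_LIMSEQ[OF l strict_mono_o[OF r r'(1)]] by (simp add: o_def)
      ultimately show ?thesis using r' LIMSEQ_unique by blast
    qed
    obtain q where q: "w \<bullet> rvec q = l" using lim[OF strict_mono_id] by blast
    have "(\<lambda>i. rvec (a i)) \<longlonglongrightarrow> rvec q"
    proof (rule ccontr)
      assume "\<not> (\<lambda>i. rvec (a i)) \<longlonglongrightarrow> rvec q"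
      then obtain d where d: "d > 0" "\<And>N. \<exists>n\<ge>N. dist (rvec (a n)) (rvec q) \<ge> d"
        unfolding lim_sequentially by (meson not_le)
      then have "infinite {n. dist (rvec (a n)) (rvec q) \<ge> d}"
        unfolding infinite_nat_iff_unbounded_le by blast
      then obtain r where r: "strict_mono (r :: nat \<Rightarrow> nat)" "\<And>n. dist (rvec (a (r n))) (rvec q) \<ge> d"
        using infinite_enumerate[of "{n. dist (rvec (a n)) (rvec q) \<ge> d}"] by auto
      obtain r' q' where r': "strict_mono r'" "(\<lambda>n. rvec (a (r (r' n)))) \<longlonglongrightarrow> rvec q'" "w \<bullet> rvec q' = l"
        using lim[OF r(1)] by blast
      have "q' = q" using r'(3) q Rli_inner_eq_iff[OF w] by metis
      then obtain n where "dist (rvec (a (r (r' n)))) (rvec q) < d"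
        using r'(2) d(1) unfolding lim_sequentially by blast
      then show False using r(2)[of "r' n"] by simp
    qed
    then show "\<exists>q. (\<lambda>i. rvec (a i)) \<longlonglongrightarrow> rvec q" by blast
  qed
  show "\<forall>\<gamma>'. \<exists>\<sigma>. open \<sigma> \<and> convex_cone \<sigma> \<and> w \<in> \<sigma> \<and>
        (\<forall>w' \<in> \<sigma> \<inter> Rli. upper_part A \<gamma>' w' = upper_part A \<gamma>' w \<and>
                         lower_part A \<gamma>' w' = lower_part A \<gamma>' w)"
  proof
    fix \<gamma>'
    obtain c where c: "c > 0" "\<And>a. a \<in> A \<Longrightarrow> c * norm (rvec (a - \<gamma>')) \<le> \<bar>w \<bullet> rvec (a - \<gamma>')\<bar>"
      by (rule tame_transversal[OF w A]) (rule that)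
    obtain \<sigma> where \<sigma>: "open \<sigma>" "convex_cone \<sigma>" "w \<in> \<sigma>"
      "\<And>x. x \<in> \<sigma> \<Longrightarrow> \<exists>t>0. \<exists>y\<in>ball w c. x = t *\<^sub>R y"
      by (rule open_cone_over_ball[OF c(1), of w]) (rule that)
    have "sgn (w' \<bullet> rvec (a - \<gamma>')) = sgn (w \<bullet> rvec (a - \<gamma>'))" if "w' \<in> \<sigma>" "a \<in> A" for w' a
    proof (cases "a = \<gamma>'")
      case False
      obtain t y where y: "t > 0" "y \<in> ball w c" "w' = t *\<^sub>R y" using \<sigma>(4) \<open>w' \<in> \<sigma>\<close> by blast
      have "sgn (y \<bullet> rvec (a - \<gamma>')) = sgn (w \<bullet> rvec (a - \<gamma>'))"
        using abs_inner_lower_bound_imp_same_sign[OF c(2)[OF that(2)] y(2)] False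
        by (simp del: rvec_diff add: rvec_0[symmetric] del: rvec_0)
      then show ?thesis using y by (simp add: sgn_mult)
    qed simp
    then have "0 < w' \<bullet> rvec (a - \<gamma>') \<longleftrightarrow> 0 < w \<bullet> rvec (a - \<gamma>')"
        "w' \<bullet> rvec (a - \<gamma>') < 0 \<longleftrightarrow> w \<bullet> rvec (a - \<gamma>') < 0" if "w' \<in> \<sigma>" "a \<in> A" for w' a
      using that by (metis sgn_greater, metis sgn_less)
    then have "upper_part A \<gamma>' w' = upper_part A \<gamma>' w \<and> lower_part A \<gamma>' w' = lower_part A \<gamma>' w"
      if "w' \<in> \<sigma> \<inter> Rli" for w'
      using that by (auto simp: upper_part_def lower_part_def inner_diff_right)
    then show "\<exists>\<sigma>. open \<sigma> \<and> convex_cone \<sigma> \<and> w \<in> \<sigma> \<and>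
        (\<forall>w' \<in> \<sigma> \<inter> Rli. upper_part A \<gamma>' w' = upper_part A \<gamma>' w \<and>
                         lower_part A \<gamma>' w' = lower_part A \<gamma>' w)"
      using \<sigma> by blast
  qed
qed

lemma p_discrete_imp_tame:
  assumes w: "w \<in> Rli" and A: "p_discrete p w A"
  shows "tame p w A"
  unfolding tame_def
proof (intro conjI)
  note pd = A[unfolded p_discrete_def]
  obtain \<sigma> where \<sigma>: "open \<sigma>" "w \<in> \<sigma>" "\<And>w'. w' \<in> \<sigma> \<inter> Rli \<Longrightarrow> well_ordered ((\<lambda>a. w' \<bullet> rvec a) ` A)"
    using pd[THEN conjunct1] by blast
  obtain e where e: "e > 0" "ball w e \<subseteq> \<sigma>" using \<sigma> openE by blast
  then show "\<exists>\<epsilon>>0. \<forall>w' \<in> ball w \<epsilon> \<inter> Rli. wqo_set ((\<lambda>a. w' \<bullet> rvec a) ` A)"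
    using \<sigma>(3) unfolding wqo_set_iff_well_ordered by blast
  have wqo: "wqo_set ((\<lambda>a. w \<bullet> rvec a) ` A)"
    using \<sigma> w unfolding wqo_set_iff_well_ordered by blast
  obtain N \<gamma> C where C: "N > 0" "pointed_cone C" "w \<in> interior (dual_cone C)"
      "A \<subseteq> {a. rvec a \<in> (+) (rvec \<gamma>) ` C} \<inter> (\<Union>j::nat. lattice_over (N * int p ^ j))"
    using pd[THEN conjunct2, THEN conjunct1] by blast
  then show "\<exists>N>0. A \<subseteq> (\<Union>j::nat. lattice_over (N * int p ^ j))" by blast
  obtain c where c: "c > 0" "\<And>x. x \<in> C \<Longrightarrow> c * norm x \<le> w \<bullet> x"
    by (rule interior_dual_cone_imp_narrow[OF C(3)]) (rule that)
  \<comment> \<open>The constant absorbs the apex \<gamma> of the translated cone.\<close>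
  define M where "M = c * norm (rvec \<gamma>) - w \<bullet> rvec \<gamma>"
  have M: "c * norm (rvec a) \<le> w \<bullet> rvec a + M" if "a \<in> A" for a
  proof -
    obtain x where x: "x \<in> C" "rvec a = rvec \<gamma> + x" using C(4) \<open>a \<in> A\<close> by blast
    have "c * norm (rvec a) \<le> c * (norm (rvec \<gamma>) + norm x)"
      unfolding x(2) using c(1) by (intro mult_left_mono norm_triangle_ineq) auto
    also have "\<dots> \<le> c * norm (rvec \<gamma>) + w \<bullet> x" using c(2)[OF x(1)] by (simp add: algebra_simps)
    finally show ?thesis by (simp add: x(2) M_def inner_add_right)
  qed
  then show "\<exists>\<epsilon>>0. \<exists>M. \<forall>a\<in>A. \<epsilon> * norm (rvec a) \<le> w \<bullet> rvec a + M" using c(1) by blast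
  show "\<forall>a :: nat \<Rightarrow> rat ^ 'a. range a \<subseteq> A \<longrightarrow> (\<exists>R. \<forall>n. w \<bullet> rvec (a n) \<le> R) \<longrightarrow>
        limit_from_below w a"
  proof (intro allI impI)
    fix a :: "nat \<Rightarrow> rat ^ 'a"
    assume a: "range a \<subseteq> A" and "\<exists>R. \<forall>n. w \<bullet> rvec (a n) \<le> R"
    then obtain R where R: "\<And>n. w \<bullet> rvec (a n) \<le> R" by blast
    \<comment> \<open>Passing to increasing values gives convergence, so that (c) applies, and at
      the same time puts the sequence below its limit.\<close>
    obtain r where r: "strict_mono r" "incseq ((\<lambda>n. w \<bullet> rvec (a n)) \<circ> r)"
      using wqo_setD[OF wqo, of "\<lambda>n. w \<bullet> rvec (a n)"] a by blast
    then obtain l where l: "(\<lambda>n. w \<bullet> rvec (a (r n))) \<longlonglongrightarrow> l"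
      using incseq_convergent[OF r(2), of R] R unfolding o_def by metis
    then have "convergent (\<lambda>n. w \<bullet> rvec (a (r n)))" by (auto simp: convergent_def)
    moreover have "\<forall>n. a (r n) \<in> A" using a by auto
    ultimately obtain q where q: "(\<lambda>n. rvec (a (r n))) \<longlonglongrightarrow> rvec q"
      using pd[THEN conjunct2, THEN conjunct2, THEN conjunct1, THEN spec, of "\<lambda>n. a (r n)"] by blast
    have "(\<lambda>n. w \<bullet> rvec (a (r n))) \<longlonglongrightarrow> w \<bullet> rvec q" using q by (intro tendsto_intros)
    then have le: "w \<bullet> rvec (a (r n)) \<le> w \<bullet> rvec q" for n
      using incseq_le[OF r(2)] by (auto simp: o_def)
    \<comment> \<open>Condition (d) at the limit q itself sharpens the mere inequality
      \<open>le\<close> to approach inside a cone.\<close>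
    obtain \<sigma> where \<sigma>: "open \<sigma>" "w \<in> \<sigma>" "\<And>w'. w' \<in> \<sigma> \<inter> Rli \<Longrightarrow>
        upper_part A q w' = upper_part A q w \<and> lower_part A q w' = lower_part A q w"
      using pd[THEN conjunct2, THEN conjunct2, THEN conjunct2, THEN spec, of q] by blast
    obtain d where d: "d > 0" "\<And>a. a \<in> A \<Longrightarrow> d * norm (rvec (a - q)) \<le> \<bar>w \<bullet> rvec (a - q)\<bar>"
      by (rule locally_constant_sides_imp_transversal[OF w \<sigma>]) (assumption | rule that)+
    have "d * norm (rvec (q - a (r n))) \<le> w \<bullet> rvec (q - a (r n))" for n
      using d(2)[of "a (r n)"] a le[of n] by (auto simp: inner_diff_right norm_minus_commute)
    then show "limit_from_below w a"
      using r(1) q d(1) unfolding limit_from_below_def by blast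
  qed
qed

section \<open>Closure properties\<close>

definition p_lattice :: "nat \<Rightarrow> int \<Rightarrow> (rat ^ 'd) set" where
  "p_lattice p N = (\<Union>j::nat. lattice_over (N * int p ^ j))"

lemma lattice_over_iff: "a \<in> lattice_over m \<longleftrightarrow> (\<forall>i. \<exists>z::int. a $ i = of_int z / of_int m)"
proof
  assume "\<forall>i. \<exists>z::int. a $ i = of_int z / of_int m"
  then obtain z :: "'a \<Rightarrow> int" where "\<And>i. a $ i = of_int (z i) / of_int m" by metis
  then show "a \<in> lattice_over m"
    unfolding lattice_over_def by (intro CollectI exI[of _ "\<chi> i. z i"]) simp
qed (auto simp: lattice_over_def)

lemma lattice_over_mono:
  assumes "m dvd n" "n \<noteq> 0"
  shows "lattice_over m \<subseteq> lattice_over n"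
proof
  fix a :: "rat ^ 'd"
  assume a: "a \<in> lattice_over m"
  obtain k where k: "n = m * k" using assms(1) by blast
  have "\<exists>z::int. a $ i = of_int z / of_int n" for i
  proof -
    obtain z :: int where "a $ i = of_int z / of_int m" using a lattice_over_iff by blast
    then have "a $ i = of_int (z * k) / of_int n" using assms(2) by (simp add: k)
    then show ?thesis by blast
  qed
  then show "a \<in> lattice_over n" by (simp add: lattice_over_iff)
qed

lemma lattice_over_add:
  assumes "a \<in> lattice_over m" "b \<in> lattice_over m"
  shows "a + b \<in> lattice_over m"
  unfolding lattice_over_iff
proof
  fix i
  obtain x y :: int where "a $ i = of_int x / of_int m" "b $ i = of_int y / of_int m"
    using assms unfolding lattice_over_iff by metis
  then have "(a + b) $ i = of_int (x + y) / of_int m" by (simp add: add_divide_distrib)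
  then show "\<exists>z::int. (a + b) $ i = of_int z / of_int m" by blast
qed

lemma zero_in_p_lattice: "0 \<in> p_lattice p N"
  by (auto simp: p_lattice_def lattice_over_iff intro!: exI[of _ 0])

lemma p_lattice_add:
  assumes "p > 0" "N > 0" "a \<in> p_lattice p N" "b \<in> p_lattice p N"
  shows "a + b \<in> p_lattice p N"
proof -
  obtain j k where "a \<in> lattice_over (N * int p ^ j)" "b \<in> lattice_over (N * int p ^ k)"
    using assms(3,4) unfolding p_lattice_def by blast
  then have "a \<in> lattice_over (N * int p ^ (j + k))" "b \<in> lattice_over (N * int p ^ (j + k))"
    using lattice_over_mono[of "N * int p ^ j" "N * int p ^ (j + k)"]
      lattice_over_mono[of "N * int p ^ k" "N * int p ^ (j + k)"] assms(1,2)
    by (auto simp: power_add)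
  then show ?thesis unfolding p_lattice_def using lattice_over_add by blast
qed

lemma p_lattice_mono:
  assumes "p > 0" "N' > 0" "N dvd N'"
  shows "p_lattice p N \<subseteq> p_lattice p N'"
  unfolding p_lattice_def using assms by (intro UN_mono lattice_over_mono) (auto simp: mult_dvd_mono)

lemma p_lattice_scale:
  assumes "p > 0" "N > 0" "n > 0" "a \<in> p_lattice p N"
  shows "(of_int m / of_int n) *s a \<in> p_lattice p (N * n)"
proof -
  obtain j where j: "a \<in> lattice_over (N * int p ^ j)"
    using assms(4) unfolding p_lattice_def by blast
  have "(of_int m / of_int n) *s a \<in> lattice_over (N * n * int p ^ j)"
    unfolding lattice_over_iff
  proof
    fix i
    obtain x :: int where "a $ i = of_int x / of_int (N * int p ^ j)"
      using j unfolding lattice_over_iff by blast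
    then have "((of_int m / of_int n) *s a) $ i = of_int (m * x) / of_int (N * n * int p ^ j)"
      by simp
    then show "\<exists>z::int. ((of_int m / of_int n) *s a) $ i = of_int z / of_int (N * n * int p ^ j)" by blast
  qed
  then show ?thesis unfolding p_lattice_def by blast
qed

text \<open>In contrast to \<open>p_lattice_scale\<close> the number \<open>N\<close> does not grow,
  so the union over all k still lies in a single lattice.\<close>

lemma p_lattice_divide_power:
  assumes "p > 0" "a \<in> p_lattice p N"
  shows "(1 / of_nat p ^ k) *s a \<in> p_lattice p N"
proof -
  obtain j where j: "a \<in> lattice_over (N * int p ^ j)"
    using assms(2) unfolding p_lattice_def by blast
  have "(1 / of_nat p ^ k) *s a \<in> lattice_over (N * int p ^ (j + k))"
    unfolding lattice_over_iff
  proof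
    fix i
    obtain x :: int where "a $ i = of_int x / of_int (N * int p ^ j)"
      using j unfolding lattice_over_iff by blast
    then have "((1 / of_nat p ^ k) *s a) $ i = of_int x / of_int (N * int p ^ (j + k))"
      by (simp add: power_add)
    then show "\<exists>z::int. ((1 / of_nat p ^ k) *s a) $ i = of_int z / of_int (N * int p ^ (j + k))" by blast
  qed
  then show ?thesis unfolding p_lattice_def by blast
qed

lemma ex_p_lattice: "\<exists>N>0. a \<in> p_lattice p N"
proof -
  define den where "den = (\<lambda>i. snd (quotient_of (a $ i)))"
  define N where "N = (\<Prod>i\<in>UNIV. den i)"
  have pos: "den i > 0" for i by (simp add: den_def quotient_of_denom_pos')
  then have "N > 0" unfolding N_def by (intro prod_pos) auto
  have "\<exists>z::int. a $ i = of_int z / of_int (N * int p ^ 0)" for i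
  proof -
    have "a $ i = of_int (fst (quotient_of (a $ i))) / of_int (den i)"
      unfolding den_def by (rule quotient_of_div) simp
    moreover have "den i dvd N" unfolding N_def by (rule dvd_prodI) auto
    then obtain k where "N = den i * k" by blast
    ultimately have "a $ i = of_int (fst (quotient_of (a $ i)) * k) / of_int N"
      using \<open>N > 0\<close> by auto
    then have "\<exists>z::int. a $ i = of_int z / of_int N" by blast
    then show ?thesis by simp
  qed
  then have "a \<in> lattice_over (N * int p ^ 0)" unfolding lattice_over_iff by blast
  then show ?thesis using \<open>N > 0\<close> unfolding p_lattice_def by blast
qed

section \<open>Unions, sums and multiples of tame sets\<close>

lemma wqo_set_UN_finite:
  assumes "finite I" "\<And>i. i \<in> I \<Longrightarrow> wqo_set (S i)"
  shows "wqo_set (\<Union>i\<in>I. S i)"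
  using assms
proof (induction I rule: finite_induct)
  case empty
  have "wqo_set {}" by (rule wqo_set_subset[OF wqo_set_singleton[of 0]]) simp
  then show ?case by simp
next
  case (insert i I)
  then show ?case by (simp add: wqo_set_Un)
qed

text \<open>A descending chain stays below its first member, so only parts bounded above matter.
  There the infinite unions considered later reduce to finite ones.\<close>

lemma wqo_set_local:
  assumes "\<And>x. x \<in> S \<Longrightarrow> wqo_set (S \<inter> {..x})"
  shows "wqo_set S"
proof -
  let ?r = "{(x, y). x \<in> S \<and> y \<in> S \<and> x \<le> y}"
  have "wf (?r - Id)"
    unfolding wf_eq_minimal
  proof (intro allI impI)
    fix Q x
    assume x: "x \<in> (Q :: real set)"
    show "\<exists>z\<in>Q. \<forall>y. (y, z) \<in> ?r - Id \<longrightarrow> y \<notin> Q"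
    proof (cases "x \<in> S")
      case True
      have "wqo_set (Q \<inter> (S \<inter> {..x}))" by (rule wqo_set_subset[OF assms[OF True]]) auto
      then obtain z where "z \<in> Q \<inter> (S \<inter> {..x})" "\<forall>y\<in>Q \<inter> (S \<inter> {..x}). z \<le> y"
        using wqo_set_has_least[of "Q \<inter> (S \<inter> {..x})" x] x True by auto
      then show ?thesis by (intro bexI[of _ z]) force+
    qed (use x in auto)
  qed
  then show ?thesis
    by (auto simp: wqo_set_iff_well_ordered well_ordered_def order_on_defs refl_on_def trans_def
        antisym_def total_on_def)
qed

lemma tameI:
  assumes "\<epsilon> > 0" "\<And>w'. w' \<in> ball w \<epsilon> \<Longrightarrow> w' \<in> Rli \<Longrightarrow> wqo_set ((\<lambda>a. w' \<bullet> rvec a) ` A)"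
    and "N > 0" "A \<subseteq> p_lattice p N"
    and "c > 0" "\<And>a. a \<in> A \<Longrightarrow> c * norm (rvec a) \<le> w \<bullet> rvec a + M"
    and "\<And>a R. (\<And>n. a n \<in> A) \<Longrightarrow> (\<And>n. w \<bullet> rvec (a n) \<le> R) \<Longrightarrow> limit_from_below w a"
  shows "tame p w A"
proof -
  have 1: "\<exists>\<epsilon>>0. \<forall>w' \<in> ball w \<epsilon> \<inter> Rli. wqo_set ((\<lambda>a. w' \<bullet> rvec a) ` A)"
    using assms(1,2) by blast
  have 2: "\<exists>N>0. A \<subseteq> (\<Union>j::nat. lattice_over (N * int p ^ j))"
    using assms(3,4) unfolding p_lattice_def by blast
  have 3: "\<exists>c>0. \<exists>M. \<forall>a\<in>A. c * norm (rvec a) \<le> w \<bullet> rvec a + M"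
    using assms(5,6) by blast
  have 4: "\<forall>a :: nat \<Rightarrow> _. range a \<subseteq> A \<longrightarrow> (\<exists>R. \<forall>n. w \<bullet> rvec (a n) \<le> R) \<longrightarrow> limit_from_below w a"
    using assms(7) by (auto simp: image_subset_iff)
  show ?thesis unfolding tame_def using 1 2 3 4 by (intro conjI)
qed

lemma tameD_limit: "tame p w A \<Longrightarrow> (\<And>n. a n \<in> A) \<Longrightarrow> (\<And>n. w \<bullet> rvec (a n) \<le> R) \<Longrightarrow> limit_from_below w a"
  unfolding tame_def by blast

lemma tameE:
  assumes "tame p w A"
  obtains \<epsilon> N c M where "\<epsilon> > 0" "\<And>w'. w' \<in> ball w \<epsilon> \<Longrightarrow> w' \<in> Rli \<Longrightarrow> wqo_set ((\<lambda>a. w' \<bullet> rvec a) ` A)"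
    "N > 0" "A \<subseteq> p_lattice p N"
    "c > 0" "\<And>a. a \<in> A \<Longrightarrow> c * norm (rvec a) \<le> w \<bullet> rvec a + M"
  using assms unfolding tame_def p_lattice_def by blast

lemma tame_subset:
  assumes "tame p w B" "A \<subseteq> B"
  shows "tame p w A"
proof -
  obtain \<epsilon> N c M where B: "\<epsilon> > 0" "\<And>w'. w' \<in> ball w \<epsilon> \<Longrightarrow> w' \<in> Rli \<Longrightarrow> wqo_set ((\<lambda>a. w' \<bullet> rvec a) ` B)"
    "N > 0" "B \<subseteq> p_lattice p N" "c > 0" "\<And>a. a \<in> B \<Longrightarrow> c * norm (rvec a) \<le> w \<bullet> rvec a + M"
    by (rule tameE[OF assms(1)]) (rule that)
  show ?thesis
  proof (rule tameI[OF B(1) _ B(3) _ B(5)])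
    show "wqo_set ((\<lambda>a. w' \<bullet> rvec a) ` A)" if "w' \<in> ball w \<epsilon>" "w' \<in> Rli" for w'
      by (rule wqo_set_subset[OF B(2)[OF that]]) (use assms(2) in blast)
  qed (use B assms tameD_limit[OF assms(1)] in blast)+
qed

lemma tame_singleton: "tame p w {\<gamma>}"
proof -
  obtain N where N: "N > 0" "\<gamma> \<in> p_lattice p N" using ex_p_lattice by blast
  show ?thesis
  proof (rule tameI[where \<epsilon> = 1 and c = 1 and N = N and M = "norm (rvec \<gamma>) - w \<bullet> rvec \<gamma>"])
    fix a :: "nat \<Rightarrow> _"
    assume "\<And>n. a n \<in> {\<gamma>}"
    then show "limit_from_below w a"
      unfolding limit_from_below_def
      by (intro exI[of _ id] exI[of _ \<gamma>] exI[of _ 1]) (auto simp: strict_mono_def)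
  qed (use N in auto)
qed

text \<open>\<open>limit_from_below\<close> asks only for a subsequence, so infinitely many terms in
  a tame set are enough. This is what makes pigeonhole arguments on unions possible.\<close>

lemma limit_from_below_subseq:
  assumes "tame p w V" "infinite {n. a n \<in> V}" "\<And>n. w \<bullet> rvec (a n) \<le> R"
  shows "limit_from_below w a"
proof -
  obtain s where s: "strict_mono (s :: nat \<Rightarrow> nat)" "\<forall>n. s n \<in> {n. a n \<in> V}"
    using infinite_enumerate[OF assms(2)] by blast
  have "limit_from_below w (\<lambda>n. a (s n))"
    by (rule tameD_limit[OF assms(1), of _ R]) (use s assms(3) in auto)
  then obtain r q \<epsilon> where "\<epsilon> > 0" "strict_mono (r :: nat \<Rightarrow> nat)" "(\<lambda>n. rvec (a (s (r n)))) \<longlonglongrightarrow> rvec q"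
        "\<forall>n. \<epsilon> * norm (rvec (q - a (s (r n)))) \<le> w \<bullet> rvec (q - a (s (r n)))"
    unfolding limit_from_below_def by blast
  then show ?thesis
    unfolding limit_from_below_def using strict_mono_o[OF s(1)]
    by (intro exI[of _ "s \<circ> r"] exI[of _ q] exI[of _ \<epsilon>]) (simp add: o_def)
qed

lemma tame_Un:
  assumes p: "p > 0" and "tame p w A" "tame p w B"
  shows "tame p w (A \<union> B)"
proof -
  obtain e1 N1 c1 M1 where A: "e1 > 0" "\<And>w'. w' \<in> ball w e1 \<Longrightarrow> w' \<in> Rli \<Longrightarrow> wqo_set ((\<lambda>a. w' \<bullet> rvec a) ` A)"
    "N1 > 0" "A \<subseteq> p_lattice p N1" "c1 > 0" "\<And>a. a \<in> A \<Longrightarrow> c1 * norm (rvec a) \<le> w \<bullet> rvec a + M1"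
    by (rule tameE[OF assms(2)]) (rule that)
  obtain e2 N2 c2 M2 where B: "e2 > 0" "\<And>w'. w' \<in> ball w e2 \<Longrightarrow> w' \<in> Rli \<Longrightarrow> wqo_set ((\<lambda>a. w' \<bullet> rvec a) ` B)"
    "N2 > 0" "B \<subseteq> p_lattice p N2" "c2 > 0" "\<And>a. a \<in> B \<Longrightarrow> c2 * norm (rvec a) \<le> w \<bullet> rvec a + M2"
    by (rule tameE[OF assms(3)]) (rule that)
  show ?thesis
  proof (rule tameI[where \<epsilon> = "min e1 e2" and N = "N1 * N2" and c = "min c1 c2" and M = "max M1 M2"])
    show "wqo_set ((\<lambda>a. w' \<bullet> rvec a) ` (A \<union> B))" if "w' \<in> ball w (min e1 e2)" "w' \<in> Rli" for w'
      using that by (auto simp: image_Un intro!: wqo_set_Un A B)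
    show "A \<union> B \<subseteq> p_lattice p (N1 * N2)"
      using p_lattice_mono[OF p, of "N1 * N2" N1] p_lattice_mono[OF p, of "N1 * N2" N2] A(3,4) B(3,4) by auto
    show "min c1 c2 * norm (rvec a) \<le> w \<bullet> rvec a + max M1 M2" if "a \<in> A \<union> B" for a
    proof -
      have "min c1 c2 * norm (rvec a) \<le> c1 * norm (rvec a)" "min c1 c2 * norm (rvec a) \<le> c2 * norm (rvec a)"
        by (auto intro!: mult_right_mono)
      then show ?thesis using that A(6)[of a] B(6)[of a] by auto
    qed
    fix a :: "nat \<Rightarrow> _" and R
    assume a: "\<And>n. a n \<in> A \<union> B" "\<And>n. w \<bullet> rvec (a n) \<le> R"
    have "{n. a n \<in> A} \<union> {n. a n \<in> B} = UNIV" using a(1) by auto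
    then have "infinite {n. a n \<in> A} \<or> infinite {n. a n \<in> B}"
      by (metis finite_Un infinite_UNIV_nat)
    then show "limit_from_below w a"
      by (elim disjE) (rule limit_from_below_subseq[OF assms(2) _ a(2)] limit_from_below_subseq[OF assms(3) _ a(2)], assumption)+
  qed (use A B in auto)
qed

lemma tame_UN_finite:
  assumes "p > 0" "finite I" "\<And>i. i \<in> I \<Longrightarrow> tame p w (A i)"
  shows "tame p w (\<Union>i\<in>I. A i)"
  using assms(2,3)
proof (induction I rule: finite_induct)
  case empty
  show ?case by (rule tame_subset[OF tame_singleton[of p w 0]]) simp
next
  case (insert i I)
  then show ?case by (simp add: tame_Un[OF assms(1)])
qed

definition sumset :: "(rat ^ 'd) set \<Rightarrow> (rat ^ 'd) set \<Rightarrow> (rat ^ 'd) set" where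
  "sumset A B = {a + b |a b. a \<in> A \<and> b \<in> B}"

lemma tame_sumset:
  assumes p: "p > 0" and "tame p w A" "tame p w B"
  shows "tame p w (sumset A B)"
proof -
  obtain e1 N1 c1 M1 where A: "e1 > 0" "\<And>w'. w' \<in> ball w e1 \<Longrightarrow> w' \<in> Rli \<Longrightarrow> wqo_set ((\<lambda>a. w' \<bullet> rvec a) ` A)"
    "N1 > 0" "A \<subseteq> p_lattice p N1" "c1 > 0" "\<And>a. a \<in> A \<Longrightarrow> c1 * norm (rvec a) \<le> w \<bullet> rvec a + M1"
    by (rule tameE[OF assms(2)]) (rule that)
  obtain e2 N2 c2 M2 where B: "e2 > 0" "\<And>w'. w' \<in> ball w e2 \<Longrightarrow> w' \<in> Rli \<Longrightarrow> wqo_set ((\<lambda>a. w' \<bullet> rvec a) ` B)"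
    "N2 > 0" "B \<subseteq> p_lattice p N2" "c2 > 0" "\<And>a. a \<in> B \<Longrightarrow> c2 * norm (rvec a) \<le> w \<bullet> rvec a + M2"
    by (rule tameE[OF assms(3)]) (rule that)
  show ?thesis
  proof (rule tameI[where \<epsilon> = "min e1 e2" and N = "N1 * N2" and c = "min c1 c2" and M = "M1 + M2"])
    show "wqo_set ((\<lambda>a. w' \<bullet> rvec a) ` sumset A B)" if w': "w' \<in> ball w (min e1 e2)" "w' \<in> Rli" for w'
    proof -
      have "wqo_set {x + y |x y. x \<in> (\<lambda>a. w' \<bullet> rvec a) ` A \<and> y \<in> (\<lambda>a. w' \<bullet> rvec a) ` B}"
        using w' by (intro wqo_set_sum A B) auto
      then show ?thesis
        by (rule wqo_set_subset) (auto simp: sumset_def inner_add_right, blast)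
    qed
    show "sumset A B \<subseteq> p_lattice p (N1 * N2)"
      using p_lattice_mono[OF p, of "N1 * N2" N1] p_lattice_mono[OF p, of "N1 * N2" N2] A(3,4) B(3,4)
      by (auto simp: sumset_def intro!: p_lattice_add[OF p])
    show "min c1 c2 * norm (rvec a) \<le> w \<bullet> rvec a + (M1 + M2)" if a: "a \<in> sumset A B" for a
    proof -
      obtain x y where xy: "a = x + y" "x \<in> A" "y \<in> B" using a by (auto simp: sumset_def)
      have "min c1 c2 * norm (rvec a) \<le> min c1 c2 * (norm (rvec x) + norm (rvec y))"
        using A(5) B(5) norm_triangle_ineq[of "rvec x" "rvec y"] by (intro mult_left_mono) (auto simp: xy)
      also have "\<dots> \<le> c1 * norm (rvec x) + c2 * norm (rvec y)"
        unfolding distrib_left by (intro add_mono mult_right_mono) auto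
      finally show ?thesis using A(6)[OF xy(2)] B(6)[OF xy(3)] by (simp add: xy(1) inner_add_right)
    qed
    fix s :: "nat \<Rightarrow> _" and R
    assume s: "\<And>n. s n \<in> sumset A B" "\<And>n. w \<bullet> rvec (s n) \<le> R"
    have "\<exists>a b. a \<in> A \<and> b \<in> B \<and> s n = a + b" for n using s(1)[of n] by (auto simp: sumset_def)
    then obtain a b where ab: "\<And>n. a n \<in> A" "\<And>n. b n \<in> B" "\<And>n. s n = a n + b n" by metis
    \<comment> \<open>Lower bounds for both summands turn the upper bound for the sum into upper
      bounds for each, as the limit property of \<open>A\<close> and \<open>B\<close>
      requires.\<close>
    have lower: "w \<bullet> rvec (a n) \<ge> - M1" "w \<bullet> rvec (b n) \<ge> - M2" for n
    proof -
      have "0 \<le> c1 * norm (rvec (a n))" "0 \<le> c2 * norm (rvec (b n))" using A(5) B(5) by auto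
      then show "w \<bullet> rvec (a n) \<ge> - M1" "w \<bullet> rvec (b n) \<ge> - M2"
        using A(6)[OF ab(1)[of n]] B(6)[OF ab(2)[of n]] by linarith+
    qed
    have aR: "w \<bullet> rvec (a n) \<le> R + M2" and bR: "w \<bullet> rvec (b n) \<le> R + M1" for n
      using s(2)[of n] lower[of n] by (auto simp: ab(3) inner_add_right)
    obtain r q \<delta> where r: "strict_mono (r :: nat \<Rightarrow> nat)" "\<delta> > 0" "(\<lambda>n. rvec (a (r n))) \<longlonglongrightarrow> rvec q"
      "\<And>n. \<delta> * norm (rvec (q - a (r n))) \<le> w \<bullet> rvec (q - a (r n))"
      by (rule tameE_limit[of p w A a, OF assms(2) ab(1) aR]) (rule that)
    obtain r' q' \<delta>' where r': "strict_mono (r' :: nat \<Rightarrow> nat)" "\<delta>' > 0" "(\<lambda>n. rvec (b (r (r' n)))) \<longlonglongrightarrow> rvec q'"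
      "\<And>n. \<delta>' * norm (rvec (q' - b (r (r' n)))) \<le> w \<bullet> rvec (q' - b (r (r' n)))"
      by (rule tameE_limit[of p w B "\<lambda>n. b (r n)", OF assms(3) ab(2) bR]) (rule that)
    have lim: "(\<lambda>n. rvec (s (r (r' n)))) \<longlonglongrightarrow> rvec (q + q')"
      using tendsto_add[OF LIMSEQ_subseq_LIMSEQ[OF r(3) r'(1)] r'(3)] by (simp add: ab(3) o_def)
    have side: "min \<delta> \<delta>' * norm (rvec ((q + q') - s (r (r' n)))) \<le> w \<bullet> rvec ((q + q') - s (r (r' n)))" for n
    proof -
      let ?x = "q - a (r (r' n))" and ?y = "q' - b (r (r' n))"
      have eq: "(q + q') - s (r (r' n)) = ?x + ?y" by (simp add: ab(3))
      have "min \<delta> \<delta>' * norm (rvec (?x + ?y)) \<le> min \<delta> \<delta>' * (norm (rvec ?x) + norm (rvec ?y))"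
        unfolding rvec_add using r(2) r'(2) by (intro mult_left_mono norm_triangle_ineq) auto
      also have "\<dots> \<le> \<delta> * norm (rvec ?x) + \<delta>' * norm (rvec ?y)"
        unfolding distrib_left by (intro add_mono mult_right_mono) auto
      also have "\<dots> \<le> w \<bullet> rvec ?x + w \<bullet> rvec ?y" by (intro add_mono r(4) r'(4))
      finally show ?thesis unfolding eq by (simp only: rvec_add inner_add_right)
    qed
    show "limit_from_below w s"
      unfolding limit_from_below_def
    proof (intro exI conjI)
      show "strict_mono (r \<circ> r')" by (rule strict_mono_o[OF r(1) r'(1)])
      show "(\<lambda>n. rvec (s ((r \<circ> r') n))) \<longlonglongrightarrow> rvec (q + q')" using lim by simp
      show "\<forall>n. min \<delta> \<delta>' * norm (rvec ((q + q') - s ((r \<circ> r') n))) \<le> w \<bullet> rvec ((q + q') - s ((r \<circ> r') n))"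
        using side by (simp only: o_apply) blast
    qed (use r(2) r'(2) in auto)
  qed (use A B in auto)
qed

lemma tame_scale:
  assumes p: "p > 0" and A: "tame p w A" and q: "q > 0"
  shows "tame p w ((*s) q ` A)"
proof -
  obtain e N c M where A': "e > 0" "\<And>w'. w' \<in> ball w e \<Longrightarrow> w' \<in> Rli \<Longrightarrow> wqo_set ((\<lambda>a. w' \<bullet> rvec a) ` A)"
    "N > 0" "A \<subseteq> p_lattice p N" "c > 0" "\<And>a. a \<in> A \<Longrightarrow> c * norm (rvec a) \<le> w \<bullet> rvec a + M"
    by (rule tameE[OF A]) (rule that)
  define m n where "m = fst (quotient_of q)" and "n = snd (quotient_of q)"
  then have mn: "q = of_int m / of_int n" "n > 0"
    by (auto intro: quotient_of_div simp: quotient_of_denom_pos')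
  define t :: real where "t = of_rat q"
  have t: "t > 0" using q by (simp add: t_def)
  show ?thesis
  proof (rule tameI[OF A'(1) _ _ _ A'(5)])
    show "wqo_set ((\<lambda>a. w' \<bullet> rvec a) ` (*s) q ` A)" if "w' \<in> ball w e" "w' \<in> Rli" for w'
      using wqo_set_scale[OF A'(2)[OF that], of t] t by (simp add: image_image t_def)
    show "N * n > 0" using A'(3) mn by simp
    show "(*s) q ` A \<subseteq> p_lattice p (N * n)"
      unfolding mn(1) using p_lattice_scale[OF p A'(3) mn(2)] A'(4) by blast
    show "c * norm (rvec a) \<le> w \<bullet> rvec a + t * M" if a: "a \<in> (*s) q ` A" for a
    proof -
      obtain b where b: "a = q *s b" "b \<in> A" using a by blast
      have "t * (c * norm (rvec b)) \<le> t * (w \<bullet> rvec b + M)"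
        using t A'(6)[OF b(2)] by (intro mult_left_mono) auto
      then show ?thesis using t by (simp add: b(1) t_def[symmetric] algebra_simps)
    qed
    fix s :: "nat \<Rightarrow> _" and R
    assume s: "\<And>n. s n \<in> (*s) q ` A" "\<And>n. w \<bullet> rvec (s n) \<le> R"
    have "\<forall>n. \<exists>a. a \<in> A \<and> s n = q *s a" using s(1) by blast
    then obtain a where a: "\<And>n. a n \<in> A" "\<And>n. s n = q *s a n" by metis
    have aR: "w \<bullet> rvec (a n) \<le> R / t" for n
      using s(2)[of n] t by (simp add: a(2) t_def[symmetric] pos_le_divide_eq mult.commute)
    obtain r x \<delta> where r: "strict_mono (r :: nat \<Rightarrow> nat)" "\<delta> > 0" "(\<lambda>n. rvec (a (r n))) \<longlonglongrightarrow> rvec x"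
      "\<And>n. \<delta> * norm (rvec (x - a (r n))) \<le> w \<bullet> rvec (x - a (r n))"
      by (rule tameE_limit[of p w A a, OF A a(1) aR]) (rule that)
    have lim: "(\<lambda>n. rvec (s (r n))) \<longlonglongrightarrow> rvec (q *s x)"
      unfolding a(2) rvec_scale by (intro tendsto_intros r(3))
    have side: "\<delta> * norm (rvec (q *s x - s (r n))) \<le> w \<bullet> rvec (q *s x - s (r n))" for n
    proof -
      have eq: "q *s x - s (r n) = q *s (x - a (r n))" by (simp add: a(2) vector_ssub_ldistrib)
      have "t * (\<delta> * norm (rvec (x - a (r n)))) \<le> t * (w \<bullet> rvec (x - a (r n)))"
        using t r(4)[of n] by (intro mult_left_mono) auto
      then show ?thesis
        unfolding eq rvec_scale t_def[symmetric] using t by (simp add: algebra_simps del: rvec_diff)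
    qed
    show "limit_from_below w s"
      unfolding limit_from_below_def using r(1,2) lim side by blast
  qed
qed

section \<open>Generated monoids and iterated division by p\<close>

fun n_fold_sums :: "(rat ^ 'd) set \<Rightarrow> nat \<Rightarrow> (rat ^ 'd) set" where
  "n_fold_sums E 0 = {0}"
| "n_fold_sums E (Suc m) = sumset (n_fold_sums E m) E"

text \<open>The additive monoid generated by \<open>E\<close>.\<close>

definition sums_of :: "(rat ^ 'd) set \<Rightarrow> (rat ^ 'd) set" where
  "sums_of E = (\<Union>m. n_fold_sums E m)"

lemma zero_in_sums_of: "0 \<in> sums_of E"
  unfolding sums_of_def by (auto intro: exI[of _ 0])

lemma subset_sums_of: "E \<subseteq> sums_of E"
proof -
  have "E \<subseteq> n_fold_sums E 1" by (auto simp: sumset_def)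
  then show ?thesis unfolding sums_of_def by blast
qed

lemma sums_of_add:
  assumes a: "a \<in> sums_of E" and b: "b \<in> sums_of E"
  shows "a + b \<in> sums_of E"
proof -
  obtain m where "b \<in> n_fold_sums E m" using b unfolding sums_of_def by blast
  then show ?thesis
  proof (induction m arbitrary: b)
    case 0
    then show ?case using a by simp
  next
    case (Suc m)
    then obtain x y where xy: "b = x + y" "x \<in> n_fold_sums E m" "y \<in> E" by (auto simp: sumset_def)
    then have "a + x \<in> sums_of E" using Suc.IH by blast
    then obtain k where "a + x \<in> n_fold_sums E k" unfolding sums_of_def by blast
    then have "(a + x) + y \<in> n_fold_sums E (Suc k)" using xy by (auto simp: sumset_def)
    then show ?case unfolding sums_of_def xy(1) add.assoc by blast
  qed
qed

lemma sums_of_mult_nat: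
  assumes "a \<in> sums_of E"
  shows "of_nat k *s a \<in> sums_of E"
proof (induction k)
  case 0
  then show ?case using zero_in_sums_of by simp
next
  case (Suc k)
  then show ?case using sums_of_add[OF Suc assms] by (simp add: vector_sadd_rdistrib add.commute)
qed

lemma n_fold_sums_lower_bound:
  assumes "\<And>e. e \<in> E \<Longrightarrow> v \<le> w \<bullet> rvec e" "a \<in> n_fold_sums E m"
  shows "real m * v \<le> w \<bullet> rvec a"
  using assms(2)
proof (induction m arbitrary: a)
  case (Suc m)
  then obtain x y where xy: "a = x + y" "x \<in> n_fold_sums E m" "y \<in> E" by (auto simp: sumset_def)
  then show ?case using Suc.IH[OF xy(2)] assms(1)[OF xy(3)] by (simp add: inner_add_right algebra_simps)
qed simp

lemma sums_of_pos:
  assumes "\<And>e. e \<in> E \<Longrightarrow> 0 < w \<bullet> rvec e" "a \<in> sums_of E"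
  shows "a = 0 \<or> 0 < w \<bullet> rvec a"
proof -
  obtain m where "a \<in> n_fold_sums E m" using assms(2) unfolding sums_of_def by blast
  then show ?thesis
  proof (induction m arbitrary: a)
    case (Suc m)
    then obtain x y where xy: "a = x + y" "x \<in> n_fold_sums E m" "y \<in> E" by (auto simp: sumset_def)
    then show ?case using Suc.IH[OF xy(2)] assms(1)[OF xy(3)] by (auto simp: inner_add_right)
  qed simp
qed

text \<open>The minimum of \<open>w\<close> on \<open>E\<close> bounds the number of summands of an element of bounded value,
  so locally the generated semigroup is a finite union of iterated sumsets.\<close>

lemma tame_sums_of:
  assumes p: "p > 0" and w: "w \<in> Rli" and E: "tame p w E" and pos: "\<And>e. e \<in> E \<Longrightarrow> 0 < w \<bullet> rvec e"
  shows "tame p w (sums_of E)"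
proof -
  obtain e N c0 M where E': "e > 0" "\<And>w'. w' \<in> ball w e \<Longrightarrow> w' \<in> Rli \<Longrightarrow> wqo_set ((\<lambda>a. w' \<bullet> rvec a) ` E)"
    "N > 0" "E \<subseteq> p_lattice p N" "c0 > 0" "\<And>a. a \<in> E \<Longrightarrow> c0 * norm (rvec a) \<le> w \<bullet> rvec a + M"
    by (rule tameE[OF E]) (rule that)
  have "\<exists>v>0. \<forall>e\<in>E. v \<le> w \<bullet> rvec e"
  proof (cases "E = {}")
    case False
    then obtain x where x: "x \<in> E" by blast
    have "wqo_set ((\<lambda>a. w \<bullet> rvec a) ` E)" using E'(1) w by (intro E'(2)) auto
    then obtain z where "z \<in> (\<lambda>a. w \<bullet> rvec a) ` E" "\<forall>y\<in>(\<lambda>a. w \<bullet> rvec a) ` E. z \<le> y"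
      using wqo_set_has_least imageI[OF x] by meson
    then show ?thesis using pos by auto
  qed (auto intro: exI[of _ 1])
  then obtain v where v: "v > 0" "\<And>e. e \<in> E \<Longrightarrow> v \<le> w \<bullet> rvec e" by blast
  obtain c where c: "c > 0" "\<And>a. a \<in> E \<Longrightarrow> c * norm (rvec (a - 0)) \<le> \<bar>w \<bullet> rvec (a - 0)\<bar>"
    by (rule tame_transversal[OF w E]) (rule that)
  have c': "c * norm (rvec a) \<le> w \<bullet> rvec a" if "a \<in> E" for a
    using c(2)[OF that] pos[OF that] by simp
  have fin: "tame p w (n_fold_sums E m)" for m
    by (induction m) (auto intro: tame_singleton tame_sumset[OF p _ E])
  show ?thesis
  proof (rule tameI[where \<epsilon> = "min e (c / 2)" and N = N and c = c and M = 0])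
    fix w'
    assume w': "w' \<in> ball w (min e (c / 2))" "w' \<in> Rli"
    \<comment> \<open>By the cone inequality \<open>c'\<close>, moving w by less than c / 2 costs at
      most half of the value. So the number of summands is bounded for the nearby directions w' as
      well.\<close>
    have low: "v / 2 \<le> w' \<bullet> rvec a" if a: "a \<in> E" for a
    proof -
      have "(w - w') \<bullet> rvec a \<le> norm (w - w') * norm (rvec a)" by (rule norm_cauchy_schwarz)
      also have "\<dots> \<le> c / 2 * norm (rvec a)" using w' by (intro mult_right_mono) (auto simp: dist_norm)
      finally have 1: "w \<bullet> rvec a - w' \<bullet> rvec a \<le> c * norm (rvec a) / 2"
        by (simp add: inner_diff_left)
      show ?thesis using 1 c'[OF a] v(2)[OF a] by linarith
    qed
    have wqo: "wqo_set ((\<lambda>a. w' \<bullet> rvec a) ` n_fold_sums E m)" for m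
    proof (induction m)
      case 0
      then show ?case by simp
    next
      case (Suc m)
      have "wqo_set ((\<lambda>a. w' \<bullet> rvec a) ` E)" using w' by (intro E'(2)) auto
      from wqo_set_sum[OF Suc this] show ?case
        by (rule wqo_set_subset) (auto simp: sumset_def inner_add_right, blast)
    qed
    show "wqo_set ((\<lambda>a. w' \<bullet> rvec a) ` sums_of E)"
    proof (rule wqo_set_local)
      fix x
      obtain k :: nat where k: "2 * x / v < real k" using reals_Archimedean2 by blast
      have "(\<lambda>a. w' \<bullet> rvec a) ` sums_of E \<inter> {..x} \<subseteq> (\<Union>m\<in>{..k}. (\<lambda>a. w' \<bullet> rvec a) ` n_fold_sums E m)"
      proof
        fix y
        assume y: "y \<in> (\<lambda>a. w' \<bullet> rvec a) ` sums_of E \<inter> {..x}"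
        then obtain a m where a: "y = w' \<bullet> rvec a" "a \<in> n_fold_sums E m" unfolding sums_of_def by blast
        have "real m * (v / 2) \<le> x"
          using n_fold_sums_lower_bound[OF low a(2)] y a(1) by simp
        then have "real m \<le> 2 * x / v" using v(1) by (simp add: pos_le_divide_eq mult.commute)
        then have "m \<le> k" using k by linarith
        then show "y \<in> (\<Union>m\<in>{..k}. (\<lambda>a. w' \<bullet> rvec a) ` n_fold_sums E m)" using a by blast
      qed
      then show "wqo_set ((\<lambda>a. w' \<bullet> rvec a) ` sums_of E \<inter> {..x})"
        by (rule wqo_set_subset[rotated]) (auto intro: wqo_set_UN_finite wqo)
    qed
  next
    show "sums_of E \<subseteq> p_lattice p N"
    proof
      fix a assume "a \<in> sums_of E"
      then obtain m where "a \<in> n_fold_sums E m" unfolding sums_of_def by blast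
      then show "a \<in> p_lattice p N"
      proof (induction m arbitrary: a)
        case 0
        then show ?case by (simp add: zero_in_p_lattice)
      next
        case (Suc m)
        then show ?case using E'(4) by (auto simp: sumset_def intro!: p_lattice_add[OF p E'(3)])
      qed
    qed
    show "c * norm (rvec a) \<le> w \<bullet> rvec a + 0" if a: "a \<in> sums_of E" for a
    proof -
      obtain m where "a \<in> n_fold_sums E m" using a unfolding sums_of_def by blast
      then have "c * norm (rvec a) \<le> w \<bullet> rvec a"
      proof (induction m arbitrary: a)
        case (Suc m)
        then obtain x y where xy: "a = x + y" "x \<in> n_fold_sums E m" "y \<in> E" by (auto simp: sumset_def)
        have "c * norm (rvec a) \<le> c * (norm (rvec x) + norm (rvec y))"
          unfolding xy(1) rvec_add using c(1) by (intro mult_left_mono norm_triangle_ineq) auto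
        also have "\<dots> \<le> w \<bullet> rvec a"
          using Suc.IH[OF xy(2)] c'[OF xy(3)] by (simp add: xy(1) inner_add_right distrib_left)
        finally show ?case .
      qed simp
      then show ?thesis by simp
    qed
    fix s :: "nat \<Rightarrow> _" and R
    assume s: "\<And>n. s n \<in> sums_of E" "\<And>n. w \<bullet> rvec (s n) \<le> R"
    obtain k :: nat where k: "R / v < real k" using reals_Archimedean2 by blast
    have mem: "s n \<in> (\<Union>m\<in>{..k}. n_fold_sums E m)" for n
    proof -
      obtain m where m: "s n \<in> n_fold_sums E m" using s(1)[of n] unfolding sums_of_def by blast
      have "real m * v \<le> R" using n_fold_sums_lower_bound[OF v(2) m] s(2)[of n] by simp
      then have "real m \<le> R / v" using v(1) by (simp add: pos_le_divide_eq)
      then have "m \<le> k" using k by linarith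
      then show ?thesis using m by blast
    qed
    have "tame p w (\<Union>m\<in>{..k}. n_fold_sums E m)"
      by (rule tame_UN_finite[OF p]) (auto intro: fin)
    then show "limit_from_below w s" using mem s(2) by (rule tameD_limit)
  qed (use E' c in auto)
qed

text \<open>Supports of Artin-Schreier roots have this shape. The elements of \<open>A\<close> form
  a bounded set of negative values, so their quotients by p^i rise to 0: only finitely many i reach
  below a given negative number, and the new limit 0 is approached inside the cone that contains
  \<open>- A\<close>. With a positive value in \<open>A\<close> the quotients would descend
  forever.\<close>

lemma tame_UN_divide_powers:
  assumes p: "p > 1" and w: "w \<in> Rli" and A: "tame p w A" and neg: "\<And>a. a \<in> A \<Longrightarrow> w \<bullet> rvec a < 0"
  shows "tame p w (\<Union>i. (*s) (1 / of_nat p ^ i) ` A)"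
proof -
  let ?D = "\<lambda>i. (*s) (1 / of_nat p ^ i) ` A"
  have p0: "p > 0" using p by simp
  obtain e N c0 M where A': "e > 0" "\<And>w'. w' \<in> ball w e \<Longrightarrow> w' \<in> Rli \<Longrightarrow> wqo_set ((\<lambda>a. w' \<bullet> rvec a) ` A)"
    "N > 0" "A \<subseteq> p_lattice p N" "c0 > 0" "\<And>a. a \<in> A \<Longrightarrow> c0 * norm (rvec a) \<le> w \<bullet> rvec a + M"
    by (rule tameE[OF A]) (rule that)
  obtain c where c: "c > 0" "\<And>a. a \<in> A \<Longrightarrow> c * norm (rvec (a - 0)) \<le> \<bar>w \<bullet> rvec (a - 0)\<bar>"
    by (rule tame_transversal[OF w A]) (rule that)
  have c': "c * norm (rvec a) \<le> - (w \<bullet> rvec a)" if "a \<in> A" for a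
    using c(2)[OF that] neg[OF that] by simp
  \<comment> \<open>On negative values the cone bound of \<open>A\<close> becomes a bound on the
    norm.\<close>
  define K where "K = \<bar>M\<bar> / c0"
  have K: "norm (rvec a) \<le> K" if "a \<in> A" for a
    using A'(6)[OF that] neg[OF that] A'(5) by (simp add: K_def pos_le_divide_eq mult.commute)
  have K0: "K \<ge> 0" using A'(5) by (simp add: K_def)
  have fin: "tame p w (?D i)" for i
    by (rule tame_scale[OF p0 A]) (use p0 in simp)
  have ge: "real k \<le> real p ^ k" for k
    using p by (metis less_exp of_nat_le_iff of_nat_power less_imp_le order_trans power_mono
        One_nat_def Suc_leI numeral_2_eq_2 zero_le)
  show ?thesis
  \<comment> \<open>The union is a bounded set, so slope 1 works with a large enough M. The radius c
    keeps nearby directions negative on \<open>A\<close>.\<close>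
  proof (rule tameI[where \<epsilon> = "min e c" and N = N and c = 1 and M = "K + norm w * K"])
    fix w'
    assume w': "w' \<in> ball w (min e c)" "w' \<in> Rli"
    have neg': "w' \<bullet> rvec a < 0" if a: "a \<in> A" for a
    proof -
      have "rvec (a - 0) \<noteq> 0" using neg[OF a] by auto
      then have "sgn (w' \<bullet> rvec (a - 0)) = sgn (w \<bullet> rvec (a - 0))"
        using w' c(2)[OF a] by (intro abs_inner_lower_bound_imp_same_sign[of c]) auto
      then show ?thesis using neg[OF a] by (simp add: sgn_if split: if_splits)
    qed
    define B where "B = norm w' * K"
    have low: "- B \<le> w' \<bullet> rvec a" if a: "a \<in> A" for a
    proof -
      have "\<bar>w' \<bullet> rvec a\<bar> \<le> norm w' * norm (rvec a)" by (rule Cauchy_Schwarz_ineq2)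
      also have "\<dots> \<le> B" unfolding B_def by (intro mult_left_mono K a) auto
      finally show ?thesis by simp
    qed
    have wqo: "wqo_set ((\<lambda>a. w' \<bullet> rvec a) ` ?D i)" for i
    proof -
      have "wqo_set ((\<lambda>a. w' \<bullet> rvec a) ` A)" using w' by (intro A'(2)) auto
      from wqo_set_scale[OF this, of "1 / real p ^ i"] show ?thesis
        by (simp add: image_image of_rat_divide of_rat_power)
    qed
    show "wqo_set ((\<lambda>a. w' \<bullet> rvec a) ` (\<Union>i. ?D i))"
    proof (rule wqo_set_local)
      fix x
      assume "x \<in> (\<lambda>a. w' \<bullet> rvec a) ` (\<Union>i. ?D i)"
      then obtain i a where a: "a \<in> A" "x = w' \<bullet> rvec ((1 / of_nat p ^ i) *s a)" by blast
      then have x: "a \<in> A" "x = (1 / real p ^ i) * (w' \<bullet> rvec a)"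
        by (auto simp: of_rat_divide of_rat_power)
      have x0: "x < 0" unfolding x(2) using neg'[OF x(1)] p0 by (intro mult_pos_neg) auto
      obtain k :: nat where k: "B / - x < real k" using reals_Archimedean2 by blast
      have "(\<lambda>a. w' \<bullet> rvec a) ` (\<Union>i. ?D i) \<inter> {..x} \<subseteq> (\<Union>i\<in>{..k}. (\<lambda>a. w' \<bullet> rvec a) ` ?D i)"
      proof
        fix y
        assume y: "y \<in> (\<lambda>a. w' \<bullet> rvec a) ` (\<Union>i. ?D i) \<inter> {..x}"
        then obtain i a where a: "a \<in> A" "y = w' \<bullet> rvec ((1 / of_nat p ^ i) *s a)" by blast
        then have y': "y = (1 / real p ^ i) * (w' \<bullet> rvec a)" by (simp add: of_rat_divide of_rat_power)
        have "real p ^ i * - x \<le> real p ^ i * - y" using y by (intro mult_left_mono) auto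
        also have "\<dots> = - (w' \<bullet> rvec a)" using p0 by (simp add: y')
        also have "\<dots> \<le> B" using low[OF a(1)] by simp
        finally have "real p ^ i \<le> B / - x" by (subst pos_le_divide_eq) (use x0 in auto)
        then have "i \<le> k" using ge[of i] k by linarith
        then show "y \<in> (\<Union>i\<in>{..k}. (\<lambda>a. w' \<bullet> rvec a) ` ?D i)" using a by blast
      qed
      then show "wqo_set ((\<lambda>a. w' \<bullet> rvec a) ` (\<Union>i. ?D i) \<inter> {..x})"
        by (rule wqo_set_subset[rotated]) (intro wqo_set_UN_finite wqo, auto)
    qed
  next
    show "(\<Union>i. ?D i) \<subseteq> p_lattice p N"
      using p_lattice_divide_power[OF p0] A'(4) by blast
    show "1 * norm (rvec x) \<le> w \<bullet> rvec x + (K + norm w * K)" if x: "x \<in> (\<Union>i. ?D i)" for x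
    proof -
      obtain i a where a: "a \<in> A" "x = (1 / of_nat p ^ i) *s a" using x by blast
      have "1 \<le> real p ^ i" using p by simp
      then have "norm (rvec x) \<le> norm (rvec a)"
        by (simp add: a(2) of_rat_divide of_rat_power divide_le_eq mult_le_cancel_left1)
      then have nx: "norm (rvec x) \<le> K" using K[OF a(1)] by simp
      have "\<bar>w \<bullet> rvec x\<bar> \<le> norm w * norm (rvec x)" by (rule Cauchy_Schwarz_ineq2)
      also have "\<dots> \<le> norm w * K" by (intro mult_left_mono nx) auto
      finally show ?thesis using nx by simp
    qed
    fix s :: "nat \<Rightarrow> _" and R
    assume s: "\<And>n. s n \<in> (\<Union>i. ?D i)" "\<And>n. w \<bullet> rvec (s n) \<le> R"
    have "\<forall>n. \<exists>i a. a \<in> A \<and> s n = (1 / of_nat p ^ i) *s a" using s(1) by blast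
    then obtain i a where ia: "\<And>n. a n \<in> A" "\<And>n. s n = (1 / of_nat p ^ i n) *s a n" by metis
    show "limit_from_below w s"
    \<comment> \<open>Either infinitely many terms lie in a finite part of the union, which is tame,
      or the divisors tend to infinity and the sequence tends to 0.\<close>
    proof (cases "\<exists>k. infinite {n. i n \<le> k}")
      case True
      then obtain k where k: "infinite {n. i n \<le> k}" by blast
      have "{n. i n \<le> k} \<subseteq> {n. s n \<in> (\<Union>i\<in>{..k}. ?D i)}" using ia by auto
      then have "infinite {n. s n \<in> (\<Union>i\<in>{..k}. ?D i)}" using k infinite_super by blast
      moreover have "tame p w (\<Union>i\<in>{..k}. ?D i)" by (intro tame_UN_finite p0 fin) auto
      ultimately show ?thesis by (intro limit_from_below_subseq[of p w _ s R] s(2))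
    next
      case False
      have "filterlim i at_top sequentially"
        unfolding filterlim_at_top
      proof
        fix Z
        have "finite {n. \<not> Z \<le> i n}"
          by (rule finite_subset[of _ "{n. i n \<le> Z}"]) (use False in auto)
        then show "\<forall>\<^sub>F n in sequentially. Z \<le> i n"
          by (simp add: cofinite_eq_sequentially[symmetric] eventually_cofinite)
      qed
      moreover have "(\<lambda>k. K / real p ^ k) \<longlonglongrightarrow> 0"
        using p by (intro LIMSEQ_divide_realpow_zero) auto
      ultimately have lim: "(\<lambda>n. K / real p ^ i n) \<longlonglongrightarrow> 0"
        using filterlim_compose by blast
      have "(\<lambda>n. rvec (s n)) \<longlonglongrightarrow> 0"
      proof (rule Lim_null_comparison[OF _ lim], intro always_eventually allI)
        fix n
        show "norm (rvec (s n)) \<le> K / real p ^ i n"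
          using K[OF ia(1)[of n]] by (simp add: ia(2) of_rat_divide of_rat_power divide_right_mono)
      qed
      moreover have "c * norm (rvec (0 - s n)) \<le> w \<bullet> rvec (0 - s n)" for n
      proof -
        have "(1 / real p ^ i n) * (c * norm (rvec (a n))) \<le> (1 / real p ^ i n) * - (w \<bullet> rvec (a n))"
          by (intro mult_left_mono c' ia(1)) auto
        then show ?thesis by (simp add: ia(2) of_rat_divide of_rat_power)
      qed
      ultimately show ?thesis
        unfolding limit_from_below_def using c(1)
        by (intro exI[of _ id] exI[of _ 0] exI[of _ c]) (auto simp: strict_mono_def)
    qed
  qed (use A' c in auto)
qed

section \<open>The ring of p-discrete series\<close>

lemma p_discrete_sets_eq_tame:
  "w \<in> Rli \<Longrightarrow> p_discrete_sets p w = {A. tame p w A}"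
  unfolding p_discrete_sets_def using tame_imp_p_discrete p_discrete_imp_tame by blast

definition conv_pairs :: "(rat ^ 'd) set \<Rightarrow> (rat ^ 'd) set \<Rightarrow> rat ^ 'd \<Rightarrow> ((rat ^ 'd) \<times> (rat ^ 'd)) set" where
  "conv_pairs A B u = {(a, b). a \<in> A \<and> b \<in> B \<and> a + b = u}"

lemma tame_wqo:
  assumes "w \<in> Rli" "tame p w A"
  shows "wqo_set ((\<lambda>a. w \<bullet> rvec a) ` A)"
proof -
  obtain e where "e > 0" "\<forall>w' \<in> ball w e \<inter> Rli. wqo_set ((\<lambda>a. w' \<bullet> rvec a) ` A)"
    using assms(2) unfolding tame_def by blast
  then show ?thesis using assms(1) by simp
qed

text \<open>Among infinitely many pairs there would be a sequence along which the values of both a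
  and u - a are nondecreasing; then a would be constant, against injectivity.\<close>

lemma finite_conv_pairs:
  assumes w: "w \<in> Rli" and "tame p w A" "tame p w B"
  shows "finite (conv_pairs A B u)"
proof (rule ccontr)
  assume "infinite (conv_pairs A B u)"
  moreover have "inj_on fst (conv_pairs A B u)"
    by (auto simp: conv_pairs_def inj_on_def)
  ultimately have "infinite (fst ` conv_pairs A B u)" using finite_imageD by blast
  then obtain a :: "nat \<Rightarrow> _" where a: "inj a" "range a \<subseteq> fst ` conv_pairs A B u"
    using infinite_countable_subset by blast
  have mem: "a n \<in> A" "u - a n \<in> B" for n
  proof -
    have "a n \<in> fst ` conv_pairs A B u" using a(2) by blast
    then obtain z where "z \<in> conv_pairs A B u" "a n = fst z" by blast
    then show "a n \<in> A" "u - a n \<in> B" by (auto simp: conv_pairs_def)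
  qed
  have "\<exists>r. strict_mono r \<and> incseq ((\<lambda>n. w \<bullet> rvec (a n)) \<circ> r)"
    by (rule wqo_setD[OF tame_wqo[OF w assms(2)]]) (use mem in auto)
  then obtain r where r: "strict_mono (r :: nat \<Rightarrow> nat)" "incseq ((\<lambda>n. w \<bullet> rvec (a n)) \<circ> r)" by blast
  have "\<exists>s. strict_mono s \<and> incseq ((\<lambda>n. w \<bullet> rvec (u - a (r n))) \<circ> s)"
    by (rule wqo_setD[OF tame_wqo[OF w assms(3)]]) (use mem in blast)
  then obtain s where s: "strict_mono (s :: nat \<Rightarrow> nat)" "incseq ((\<lambda>n. w \<bullet> rvec (u - a (r n))) \<circ> s)" by blast
  have lt: "s 0 < s 1" using s(1) by (simp add: strict_mono_less)
  have "w \<bullet> rvec (a (r (s 0))) \<le> w \<bullet> rvec (a (r (s 1)))"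
    using incseqD[OF r(2), of "s 0" "s 1"] lt by simp
  moreover have "w \<bullet> rvec (a (r (s 1))) \<le> w \<bullet> rvec (a (r (s 0)))"
    using incseqD[OF s(2), of 0 1] by (simp add: inner_diff_right)
  ultimately have "a (r (s 0)) = a (r (s 1))" using Rli_inner_eq_iff[OF w] by (meson order_antisym)
  then have "r (s 0) = r (s 1)" using a(1) by (simp add: inj_eq)
  then show False using lt r(1) by (simp add: strict_mono_eq)
qed

lemma tame_zero: "tame p w {}"
  by (rule tame_subset[OF tame_singleton[of p w 0]]) simp

definition monomial :: "rat ^ 'd \<Rightarrow> 'k \<Rightarrow> rat ^ 'd \<Rightarrow> 'k::zero" where
  "monomial q c = (\<lambda>u. if u = q then c else 0)"

lemma supp_monomial: "supp (monomial q c) \<subseteq> {q}"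
  by (auto simp: supp_def monomial_def)

lemma supp_zero [simp]: "supp (\<lambda>u. 0) = {}"
  by (simp add: supp_def)

section \<open>Ring operations on series\<close>

locale p_discrete_series =
  fixes w :: "real ^ 'd" and p :: nat and K :: "(rat ^ 'd \<Rightarrow> 'k::alg_closed_field) ring" (structure)
  assumes w: "w \<in> Rli" and p: "Factorial_Ring.prime p" and char: "CHAR('k) = p"
    and K_def: "K = series_ring (p_discrete_sets p w)"
begin

abbreviation v :: "rat ^ 'd \<Rightarrow> real" where "v a \<equiv> w \<bullet> rvec a"

lemma p_gt_0: "p > 0" and p_gt_1: "p > 1"
  using p prime_gt_0_nat prime_gt_1_nat by auto

lemma v_eq_iff: "v a = v b \<longleftrightarrow> a = b"
  by (rule Rli_inner_eq_iff[OF w])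

lemma carrier_iff: "\<phi> \<in> carrier K \<longleftrightarrow> tame p w (supp \<phi>)"
  by (simp add: K_def series_ring_def p_discrete_sets_eq_tame[OF w])

lemma zero_eq: "\<zero> = (\<lambda>u. 0)" by (simp add: K_def series_ring_def)
lemma one_eq: "\<one> = monomial 0 1" by (simp add: K_def series_ring_def monomial_def)
lemma add_eq: "\<phi> \<oplus> \<psi> = (\<lambda>u. \<phi> u + \<psi> u)" by (simp add: K_def series_ring_def)
lemma mult_eq: "\<phi> \<otimes> \<psi> = (\<lambda>u. \<Sum>(a, b)\<in>conv_pairs (supp \<phi>) (supp \<psi>) u. \<phi> a * \<psi> b)"
  by (simp add: K_def series_ring_def conv_pairs_def)

text \<open>Products of different series can thus be summed over one common index set, although the
  definition uses the exact supports.\<close>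

lemma mult_eq_on:
  assumes "tame p w A" "tame p w B" "supp \<phi> \<subseteq> A" "supp \<psi> \<subseteq> B"
  shows "(\<phi> \<otimes> \<psi>) u = (\<Sum>(a, b)\<in>conv_pairs A B u. \<phi> a * \<psi> b)"
  unfolding mult_eq
  by (rule sum.mono_neutral_left)
     (use assms finite_conv_pairs[OF w assms(1,2)] in \<open>auto simp: conv_pairs_def supp_def\<close>)

lemma supp_add: "supp (\<phi> \<oplus> \<psi>) \<subseteq> supp \<phi> \<union> supp \<psi>"
  by (auto simp: supp_def add_eq)

lemma supp_mult: "supp (\<phi> \<otimes> \<psi>) \<subseteq> sumset (supp \<phi>) (supp \<psi>)"
proof
  fix u assume "u \<in> supp (\<phi> \<otimes> \<psi>)"
  then have "conv_pairs (supp \<phi>) (supp \<psi>) u \<noteq> {}"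
    by (auto simp: supp_def mult_eq)
  then show "u \<in> sumset (supp \<phi>) (supp \<psi>)" by (auto simp: conv_pairs_def sumset_def)
qed

lemma carrierI: "tame p w A \<Longrightarrow> supp \<phi> \<subseteq> A \<Longrightarrow> \<phi> \<in> carrier K"
  unfolding carrier_iff by (rule tame_subset)

lemma monomial_closed: "monomial q c \<in> carrier K"
  by (rule carrierI[OF tame_singleton supp_monomial])

lemma add_closed': "\<phi> \<in> carrier K \<Longrightarrow> \<psi> \<in> carrier K \<Longrightarrow> \<phi> \<oplus> \<psi> \<in> carrier K"
  by (rule carrierI[OF tame_Un[OF p_gt_0] supp_add]) (auto simp: carrier_iff)

lemma mult_closed': "\<phi> \<in> carrier K \<Longrightarrow> \<psi> \<in> carrier K \<Longrightarrow> \<phi> \<otimes> \<psi> \<in> carrier K"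
  by (rule carrierI[OF tame_sumset[OF p_gt_0] supp_mult]) (auto simp: carrier_iff)

lemma mult_monomial:
  assumes "\<phi> \<in> carrier K"
  shows "monomial q c \<otimes> \<phi> = (\<lambda>u. c * \<phi> (u - q))"
proof
  fix u
  \<comment> \<open>Inserting \<open>u - q\<close> leaves exactly one pair in the convolution,
    whether or not the coefficient there vanishes.\<close>
  let ?B = "insert (u - q) (supp \<phi>)"
  have B: "tame p w ?B"
    using tame_Un[OF p_gt_0 tame_singleton[of p w "u - q"]] assms by (simp add: carrier_iff)
  have "(monomial q c \<otimes> \<phi>) u = (\<Sum>(a, b)\<in>conv_pairs {q} ?B u. monomial q c a * \<phi> b)"
    by (rule mult_eq_on[OF tame_singleton B supp_monomial]) auto
  also have "conv_pairs {q} ?B u = {(q, u - q)}" by (auto simp: conv_pairs_def)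
  finally show "(monomial q c \<otimes> \<phi>) u = c * \<phi> (u - q)" by (simp add: monomial_def)
qed

lemma mult_comm': "\<phi> \<otimes> \<psi> = \<psi> \<otimes> \<phi>"
proof
  fix u
  show "(\<phi> \<otimes> \<psi>) u = (\<psi> \<otimes> \<phi>) u"
    unfolding mult_eq
    by (rule sum.reindex_bij_witness[where i = prod.swap and j = prod.swap])
       (auto simp: conv_pairs_def add.commute mult.commute)
qed

lemma mult_assoc':
  assumes "\<phi> \<in> carrier K" "\<psi> \<in> carrier K" "\<theta> \<in> carrier K"
  shows "(\<phi> \<otimes> \<psi>) \<otimes> \<theta> = \<phi> \<otimes> (\<psi> \<otimes> \<theta>)"
proof
  fix u
  let ?A = "supp \<phi>" and ?B = "supp \<psi>" and ?C = "supp \<theta>"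
  have t: "tame p w ?A" "tame p w ?B" "tame p w ?C"
    using assms by (auto simp: carrier_iff)
  note ts = tame_sumset[OF p_gt_0]
  have fin: "finite (conv_pairs A B x)" if "tame p w A" "tame p w B" for A B x
    by (rule finite_conv_pairs[OF w that])
  define T where "T = {(a, b, c). a \<in> ?A \<and> b \<in> ?B \<and> c \<in> ?C \<and> a + b + c = u}"
  have "((\<phi> \<otimes> \<psi>) \<otimes> \<theta>) u = (\<Sum>(x, c)\<in>conv_pairs (sumset ?A ?B) ?C u. (\<phi> \<otimes> \<psi>) x * \<theta> c)"
    by (rule mult_eq_on[OF ts[OF t(1,2)] t(3) supp_mult]) simp
  also have "\<dots> = (\<Sum>(x, c)\<in>conv_pairs (sumset ?A ?B) ?C u. \<Sum>(a, b)\<in>conv_pairs ?A ?B x. \<phi> a * \<psi> b * \<theta> c)"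
    by (intro sum.cong refl) (auto simp: mult_eq sum_distrib_right intro!: sum.cong)
  also have "\<dots> = (\<Sum>(y, z)\<in>Sigma (conv_pairs (sumset ?A ?B) ?C u) (\<lambda>y. conv_pairs ?A ?B (fst y)).
      \<phi> (fst z) * \<psi> (snd z) * \<theta> (snd y))"
    unfolding case_prod_unfold fst_conv snd_conv
    by (subst sum.Sigma) (auto intro!: fin ts t simp: case_prod_unfold)
  also have "\<dots> = (\<Sum>(a, b, c)\<in>T. \<phi> a * \<psi> b * \<theta> c)"
    by (rule sum.reindex_bij_witness[where i = "\<lambda>(a, b, c). ((a + b, c), (a, b))"
          and j = "\<lambda>((x, c), (a, b)). (a, b, c)"])
       (auto simp: conv_pairs_def T_def sumset_def)
  finally have 1: "((\<phi> \<otimes> \<psi>) \<otimes> \<theta>) u = (\<Sum>(a, b, c)\<in>T. \<phi> a * \<psi> b * \<theta> c)" .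
  have "(\<phi> \<otimes> (\<psi> \<otimes> \<theta>)) u = (\<Sum>(a, x)\<in>conv_pairs ?A (sumset ?B ?C) u. \<phi> a * (\<psi> \<otimes> \<theta>) x)"
    by (rule mult_eq_on[OF t(1) ts[OF t(2,3)] _ supp_mult]) simp
  also have "\<dots> = (\<Sum>(a, x)\<in>conv_pairs ?A (sumset ?B ?C) u. \<Sum>(b, c)\<in>conv_pairs ?B ?C x. \<phi> a * \<psi> b * \<theta> c)"
    by (intro sum.cong refl) (auto simp: mult_eq sum_distrib_left mult.assoc intro!: sum.cong)
  also have "\<dots> = (\<Sum>(y, z)\<in>Sigma (conv_pairs ?A (sumset ?B ?C) u) (\<lambda>y. conv_pairs ?B ?C (snd y)).
      \<phi> (fst y) * \<psi> (fst z) * \<theta> (snd z))"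
    unfolding case_prod_unfold fst_conv snd_conv
    by (subst sum.Sigma) (auto intro!: fin ts t simp: case_prod_unfold)
  also have "\<dots> = (\<Sum>(a, b, c)\<in>T. \<phi> a * \<psi> b * \<theta> c)"
    by (rule sum.reindex_bij_witness[where i = "\<lambda>(a, b, c). ((a, b + c), (b, c))"
          and j = "\<lambda>((a, x), (b, c)). (a, b, c)"])
       (auto simp: conv_pairs_def T_def sumset_def add.assoc)
  finally show "((\<phi> \<otimes> \<psi>) \<otimes> \<theta>) u = (\<phi> \<otimes> (\<psi> \<otimes> \<theta>)) u" using 1 by simp
qed

lemma distrib':
  assumes "\<phi> \<in> carrier K" "\<psi> \<in> carrier K" "\<theta> \<in> carrier K"
  shows "(\<phi> \<oplus> \<psi>) \<otimes> \<theta> = \<phi> \<otimes> \<theta> \<oplus> \<psi> \<otimes> \<theta>"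
proof
  fix u
  let ?A = "supp \<phi> \<union> supp \<psi>" and ?C = "supp \<theta>"
  have t: "tame p w ?A" "tame p w ?C"
    using assms by (auto simp: carrier_iff intro!: tame_Un p_gt_0)
  have "((\<phi> \<oplus> \<psi>) \<otimes> \<theta>) u = (\<Sum>(a, c)\<in>conv_pairs ?A ?C u. (\<phi> \<oplus> \<psi>) a * \<theta> c)"
    by (rule mult_eq_on[OF t supp_add]) simp
  also have "\<dots> = (\<Sum>(a, c)\<in>conv_pairs ?A ?C u. \<phi> a * \<theta> c) + (\<Sum>(a, c)\<in>conv_pairs ?A ?C u. \<psi> a * \<theta> c)"
    by (simp add: add_eq case_prod_unfold distrib_right sum.distrib)
  also have "(\<Sum>(a, c)\<in>conv_pairs ?A ?C u. \<phi> a * \<theta> c) = (\<phi> \<otimes> \<theta>) u"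
    by (rule mult_eq_on[OF t, symmetric]) auto
  also have "(\<Sum>(a, c)\<in>conv_pairs ?A ?C u. \<psi> a * \<theta> c) = (\<psi> \<otimes> \<theta>) u"
    by (rule mult_eq_on[OF t, symmetric]) auto
  finally show "((\<phi> \<oplus> \<psi>) \<otimes> \<theta>) u = (\<phi> \<otimes> \<theta> \<oplus> \<psi> \<otimes> \<theta>) u" by (simp add: add_eq)
qed

lemma neg_closed: "\<phi> \<in> carrier K \<Longrightarrow> (\<lambda>u. - \<phi> u) \<in> carrier K"
  by (rule carrierI[of "supp \<phi>"]) (auto simp: carrier_iff supp_def)

sublocale cring K
proof (rule cringI)
  show "abelian_group K"
  proof (rule abelian_groupI)
    fix \<phi> assume "\<phi> \<in> carrier K"
    then show "\<exists>\<psi>\<in>carrier K. \<psi> \<oplus> \<phi> = \<zero>"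
      by (intro bexI[of _ "\<lambda>u. - \<phi> u"] neg_closed) (auto simp: add_eq zero_eq)
  next
    show "\<zero> \<in> carrier K" by (simp add: carrier_iff zero_eq tame_zero)
  qed (rule add_closed'; assumption | auto simp: add_eq zero_eq algebra_simps)+
  show "comm_monoid K"
  proof (rule comm_monoidI)
    show "\<one> \<in> carrier K" unfolding one_eq by (rule monomial_closed)
    show "\<one> \<otimes> \<phi> = \<phi>" if "\<phi> \<in> carrier K" for \<phi>
      using mult_monomial[OF that, of 0 1] by (simp add: one_eq)
  qed (rule mult_closed' mult_assoc' mult_comm'; assumption)+
qed (rule distrib')

lemma a_inv_eq: "\<phi> \<in> carrier K \<Longrightarrow> \<ominus> \<phi> = (\<lambda>u. - \<phi> u)"
  by (rule minus_equality) (auto simp: neg_closed add_eq zero_eq)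

lemma a_minus_eq: "\<phi> \<in> carrier K \<Longrightarrow> \<psi> \<in> carrier K \<Longrightarrow> \<phi> \<ominus> \<psi> = (\<lambda>u. \<phi> u - \<psi> u)"
  by (simp add: a_minus_def a_inv_eq add_eq)

lemma finsum_eq:
  assumes "finite A" "\<And>i. i \<in> A \<Longrightarrow> f i \<in> carrier K"
  shows "(\<Oplus>i\<in>A. f i) u = (\<Sum>i\<in>A. f i u)"
  using assms
proof (induction A rule: finite_induct)
  case empty
  then show ?case by (simp add: zero_eq)
next
  case (insert a A)
  then show ?case by (subst finsum_insert) (auto simp: add_eq)
qed

lemma monomial_mult: "monomial q c \<otimes> monomial q' c' = monomial (q + q') (c * c')"
  by (subst mult_monomial[OF monomial_closed]) (auto simp: monomial_def fun_eq_iff algebra_simps)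

lemma monomial_pow: "monomial q c [^] (n::nat) = monomial (of_nat n *s q) (c ^ n)"
proof (induction n)
  case 0
  then show ?case by (simp add: one_eq)
next
  case (Suc n)
  then show ?case by (simp add: monomial_mult vector_sadd_rdistrib add.commute mult.commute)
qed

section \<open>Characteristic and Frobenius of the series ring\<close>

lemma char_eq_zero: "[p] \<cdot> \<one> = \<zero>"
proof -
  have "[n] \<cdot> \<one> = monomial 0 (of_nat n)" for n :: nat
  proof (induction n)
    case 0
    then show ?case by (simp add: zero_eq monomial_def fun_eq_iff)
  next
    case (Suc n)
    then show ?case by (auto simp: one_eq add_eq monomial_def fun_eq_iff)
  qed
  moreover have "(of_nat p :: 'k) = 0" using of_nat_CHAR[where ?'a = 'k] char by simp
  ultimately show ?thesis by (simp add: zero_eq monomial_def fun_eq_iff)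
qed

text \<open>Stated for \<open>Suc n\<close> because the strict inequality fails for the empty
  product.\<close>

lemma pow_supp_less:
  assumes "\<phi> \<in> carrier K" "\<And>a. a \<in> supp \<phi> \<Longrightarrow> v a < c" "u \<in> supp (\<phi> [^] Suc n)"
  shows "v u < real (Suc n) * c"
  using assms(3)
proof (induction n arbitrary: u)
  case 0
  then show ?case using assms(1,2) by simp
next
  case (Suc n)
  then have "u \<in> sumset (supp (\<phi> [^] Suc n)) (supp \<phi>)" using supp_mult[of "\<phi> [^] Suc n" \<phi>] by auto
  then obtain x y where xy: "u = x + y" "x \<in> supp (\<phi> [^] Suc n)" "y \<in> supp \<phi>"
    unfolding sumset_def by blast
  then show ?case using Suc.IH[OF xy(2)] assms(2)[OF xy(3)] by (simp add: inner_add_right algebra_simps)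
qed

lemma pow_supp_greater:
  assumes "\<phi> \<in> carrier K" "\<And>a. a \<in> supp \<phi> \<Longrightarrow> v a > c" "u \<in> supp (\<phi> [^] Suc n)"
  shows "v u > real (Suc n) * c"
  using assms(3)
proof (induction n arbitrary: u)
  case 0
  then show ?case using assms(1,2) by simp
next
  case (Suc n)
  then have "u \<in> sumset (supp (\<phi> [^] Suc n)) (supp \<phi>)" using supp_mult[of "\<phi> [^] Suc n" \<phi>] by auto
  then obtain x y where xy: "u = x + y" "x \<in> supp (\<phi> [^] Suc n)" "y \<in> supp \<phi>"
    unfolding sumset_def by blast
  then show ?case using Suc.IH[OF xy(2)] assms(2)[OF xy(3)] by (simp add: inner_add_right algebra_simps)
qed

text \<open>The closed form of the p^i-th power: coefficients are raised to p^i and exponents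
  multiplied by p^i, so the coefficient at u is read off at u / p^i.\<close>

definition frob :: "nat \<Rightarrow> (rat ^ 'd \<Rightarrow> 'k) \<Rightarrow> rat ^ 'd \<Rightarrow> 'k" where
  "frob i \<phi> = (\<lambda>u. \<phi> ((1 / of_nat p ^ i) *s u) ^ (p ^ i))"

text \<open>Split \<open>\<phi>\<close> at \<open>r = u / p\<close>: \<open>p\<close>-fold sums of exponents all below \<open>r\<close> (or all above \<open>r\<close>) miss \<open>u\<close>,
  so the coefficient of \<open>\<phi>\<^sup>p\<close> at \<open>u\<close> comes from the monomial at \<open>r\<close> alone.\<close>

lemma pow_p_eq_frob:
  assumes \<phi>: "\<phi> \<in> carrier K"
  shows "\<phi> [^] p = frob 1 \<phi>"
proof
  fix u :: "rat ^ 'd"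
  obtain n where n: "p = Suc n" using p_gt_0 gr0_implies_Suc by blast
  define r where "r = (1 / of_nat p) *s u"
  have u: "u = of_nat p *s r" 
  proof -
    have "of_nat p * (1 / of_nat p) = (1 :: rat)" using p_gt_0 by simp
    then show ?thesis by (simp only: r_def vector_smult_assoc vector_smult_lid)
  qed
  have vu: "v u = real p * v r" by (simp add: u)
  define lo where "lo = (\<lambda>a. if v a < v r then \<phi> a else 0)"
  define hi where "hi = (\<lambda>a. if v a > v r then \<phi> a else 0)"
  have sup: "supp lo \<subseteq> supp \<phi>" "supp hi \<subseteq> supp \<phi>" by (auto simp: supp_def lo_def hi_def)
  then have cl: "lo \<in> carrier K" "hi \<in> carrier K" "monomial r (\<phi> r) \<in> carrier K"
    using \<phi> tame_subset monomial_closed by (auto simp: carrier_iff)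
  have "\<phi> = lo \<oplus> monomial r (\<phi> r) \<oplus> hi"
    by (auto simp: fun_eq_iff add_eq lo_def hi_def monomial_def v_eq_iff dest: order_antisym not_less[THEN iffD1])
  then have "\<phi> [^] p = (lo \<oplus> monomial r (\<phi> r) \<oplus> hi) [^] p" by simp
  also have "\<dots> = lo [^] p \<oplus> monomial r (\<phi> r) [^] p \<oplus> hi [^] p"
    using cl by (simp add: freshmans_dream_pow[OF p char_eq_zero])
  finally have "(\<phi> [^] p) u = (lo [^] p) u + (monomial r (\<phi> r) [^] p) u + (hi [^] p) u"
    by (simp add: add_eq)
  moreover have "(lo [^] p) u = 0"
  proof (rule ccontr)
    assume "(lo [^] p) u \<noteq> 0"
    then have "v u < real p * v r"
      unfolding n by (intro pow_supp_less[OF cl(1)]) (auto simp: supp_def lo_def split: if_splits)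
    then show False using vu by simp
  qed
  moreover have "(hi [^] p) u = 0"
  proof (rule ccontr)
    assume "(hi [^] p) u \<noteq> 0"
    then have "v u > real p * v r"
      unfolding n by (intro pow_supp_greater[OF cl(2)]) (auto simp: supp_def hi_def split: if_splits)
    then show False using vu by simp
  qed
  moreover have "(monomial r (\<phi> r) [^] p) u = \<phi> r ^ p"
    by (simp add: monomial_pow u[symmetric]) (simp add: monomial_def)
  ultimately show "(\<phi> [^] p) u = frob 1 \<phi> u" by (simp add: frob_def r_def)
qed

lemma pow_p_power_eq_frob:
  assumes \<phi>: "\<phi> \<in> carrier K"
  shows "\<phi> [^] (p ^ i) = frob i \<phi>"
proof (induction i)
  case 0
  then show ?case using \<phi> by (simp add: frob_def)
next
  case (Suc i)
  have "\<phi> [^] (p ^ Suc i) = (\<phi> [^] (p ^ i)) [^] p" using \<phi> by (simp add: nat_pow_pow mult.commute)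
  also have "\<dots> = frob 1 (frob i \<phi>)"
  proof -
    have "frob i \<phi> \<in> carrier K" using Suc nat_pow_closed[OF \<phi>] by metis
    then show ?thesis unfolding Suc by (rule pow_p_eq_frob)
  qed
  also have "\<dots> = frob (Suc i) \<phi>"
    by (simp add: frob_def fun_eq_iff power_mult[symmetric] mult.commute)
  finally show ?case .
qed

end

section \<open>Additive equations over p-discrete series\<close>

lemma wf_inverse_image_wqo:
  assumes "wqo_set (f ` S)"
  shows "wf {(x, y). x \<in> S \<and> y \<in> S \<and> f x < (f y :: real)}"
proof -
  have "wf ({(x, y). x \<in> f ` S \<and> y \<in> f ` S \<and> x \<le> y} - Id)"
    using assms unfolding wqo_set_iff_well_ordered well_ordered_def well_order_on_def by blast
  then have "wf (inv_image ({(x, y). x \<in> f ` S \<and> y \<in> f ` S \<and> x \<le> y} - Id) f)"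
    by (rule wf_inv_image)
  then show ?thesis by (rule wf_subset) (auto simp: in_inv_image)
qed

context p_discrete_series
begin

lemma ex_least_in_supp:
  assumes "\<phi> \<in> carrier K" "\<phi> \<noteq> \<zero>"
  obtains \<gamma> where "\<phi> \<gamma> \<noteq> 0" "\<And>u. \<phi> u \<noteq> 0 \<Longrightarrow> v \<gamma> \<le> v u"
proof -
  obtain a where a: "\<phi> a \<noteq> 0" using assms(2) by (auto simp: zero_eq)
  then have "v a \<in> v ` supp \<phi>" by (simp add: supp_def)
  then obtain z where z: "z \<in> v ` supp \<phi>" "\<forall>y\<in>v ` supp \<phi>. z \<le> y"
    using wqo_set_has_least[OF tame_wqo[OF w, of p "supp \<phi>"]] assms(1) unfolding carrier_iff by blast
  then obtain \<gamma> where "\<gamma> \<in> supp \<phi>" "z = v \<gamma>" by blast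
  then show thesis using that[of \<gamma>] z(2) by (auto simp: supp_def)
qed

text \<open>In \<open>\<Sum>i\<le>n. c\<^sub>i y^(p^i) = e\<close> with nonnegative exponents, the coefficient of \<open>y\<close> at \<open>u\<close> occurs
  at exponent \<open>u\<close> only through \<open>c\<^sub>0(0) y(u)\<close>; all other terms involve \<open>y\<close> at smaller exponents.\<close>

lemma additive_equation_solvable:
  assumes E: "tame p w E" "\<And>a. a \<in> E \<Longrightarrow> 0 < v a"
    and c: "\<And>i. i \<le> n \<Longrightarrow> supp (c i) \<subseteq> insert 0 E" and e: "supp e \<subseteq> insert 0 E"
    and c00: "c 0 0 \<noteq> 0"
    and x0: "(\<Sum>i\<le>n. c i 0 * x0 ^ (p ^ i)) = e 0"
  obtains y where "y \<in> carrier K" "y 0 = x0" "(\<Oplus>i\<in>{..n}. c i \<otimes> y [^] (p ^ i)) = e"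
proof -
  \<comment> \<open>The monoid contains the exponents of all \<open>c i\<close> and of
    \<open>e\<close>, and multiplication by p^i preserves it, so all products below have their
    support in it.\<close>
  define S where "S = sums_of E"
  have S: "tame p w S" unfolding S_def by (rule tame_sums_of[OF p_gt_0 w E])
  have S0: "0 \<in> S" unfolding S_def by (rule zero_in_sums_of)
  have Sadd: "a + b \<in> S" if "a \<in> S" "b \<in> S" for a b
    using that unfolding S_def by (rule sums_of_add)
  have Spos: "a = 0 \<or> 0 < v a" if "a \<in> S" for a
    using sums_of_pos[OF E(2)] that unfolding S_def by blast
  have sub: "insert 0 E \<subseteq> S" using subset_sums_of zero_in_sums_of unfolding S_def by blast
  define less where "less = {(x, y). x \<in> S \<and> y \<in> S \<and> v x < v y}"
  have wf: "wf less"
    unfolding less_def by (rule wf_inverse_image_wqo[OF tame_wqo[OF w S]])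
  \<comment> \<open>The coefficient at u of the left-hand side without the single term c_0(0) g(u),
    for which the recursion solves.\<close>
  define rest where "rest = (\<lambda>g u. \<Sum>i\<le>n. \<Sum>(a, b)\<in>conv_pairs S S u.
      if i = 0 \<and> a = 0 then 0 else c i a * g ((1 / of_nat p ^ i) *s b) ^ (p ^ i))"
  \<comment> \<open>The guard by \<open>less\<close> makes the recursion well-founded by form;
    \<open>rest_term\<close> shows later that it removes no nonzero value. The value at 0 is
    prescribed, since there all powers x0^(p^i) occur and the equation is not linear in the
    unknown.\<close>
  define F where "F = (\<lambda>g u. if u = 0 then x0 else if u \<notin> S then 0
      else (e u - rest (\<lambda>b. if (b, u) \<in> less then g b else 0) u) / c 0 0)"
  define y where "y = wfrec less F"
  have y: "y u = F y u" for u
  proof -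
    have "y u = F (cut y less u) u" unfolding y_def by (rule wfrec[OF wf])
    also have "\<dots> = F y u"
    proof -
      have "(\<lambda>b. if (b, u) \<in> less then cut y less u b else 0) = (\<lambda>b. if (b, u) \<in> less then y b else 0)"
        by (auto simp: cut_apply)
      then show ?thesis unfolding F_def by simp
    qed
    finally show ?thesis .
  qed
  have y0: "y 0 = x0" by (subst y) (simp add: F_def)
  have yS: "y u = 0" if "u \<notin> S" for u
    using that S0 by (subst y) (auto simp: F_def)
  have suppy: "supp y \<subseteq> S" using yS by (auto simp: supp_def)
  then have yK: "y \<in> carrier K" by (rule carrierI[OF S])
  have fS: "supp (frob i y) \<subseteq> S" for i
  proof
    fix u assume "u \<in> supp (frob i y)"
    then have "y ((1 / of_nat p ^ i) *s u) \<noteq> 0" using p_gt_0 by (auto simp: supp_def frob_def)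
    then have "of_nat (p ^ i) *s ((1 / of_nat p ^ i) *s u) \<in> S"
      using yS sums_of_mult_nat unfolding S_def by blast
    moreover have "of_nat (p ^ i) * (1 / of_nat p ^ i) = (1 :: rat)" using p_gt_0 by simp
    ultimately show "u \<in> S" by (simp only: vector_smult_assoc vector_smult_lid)
  qed
  have cS: "supp (c i) \<subseteq> S" if "i \<le> n" for i using c[OF that] sub by blast
  have cK: "c i \<in> carrier K" if "i \<le> n" for i using carrierI[OF S cS[OF that]] .
  have eS: "e u = 0" if "u \<notin> S" for u using e sub that by (auto simp: supp_def)
  have "(\<Oplus>i\<in>{..n}. c i \<otimes> y [^] (p ^ i)) u = e u" for u
  proof -
    have "(\<Oplus>i\<in>{..n}. c i \<otimes> y [^] (p ^ i)) u = (\<Sum>i\<le>n. (c i \<otimes> frob i y) u)"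
    proof (subst finsum_eq)
      show "c i \<otimes> y [^] (p ^ i) \<in> carrier K" if "i \<in> {..n}" for i
        using cK yK that by simp
    qed (simp_all add: pow_p_power_eq_frob[OF yK])
    also have "\<dots> = (\<Sum>i\<le>n. \<Sum>(a, b)\<in>conv_pairs S S u. c i a * frob i y b)"
      by (intro sum.cong refl mult_eq_on[OF S S]) (auto simp: cS fS)
    finally have eq: "(\<Oplus>i\<in>{..n}. c i \<otimes> y [^] (p ^ i)) u
        = (\<Sum>i\<le>n. \<Sum>(a, b)\<in>conv_pairs S S u. c i a * frob i y b)" .
    consider "u = 0" | "u \<notin> S" | "u \<noteq> 0" "u \<in> S" by blast
    then show ?thesis
    proof cases
      case 1
      have "conv_pairs S S u = {(0, 0)}"
      proof -
        have "a = 0 \<and> b = 0" if "a \<in> S" "b \<in> S" "a + b = 0" for a b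
        proof -
          have "v a + v b = 0" using that(3) by (metis inner_add_right inner_zero_right rvec_0 rvec_add)
          then show ?thesis using Spos[OF that(1)] Spos[OF that(2)] by auto
        qed
        then show ?thesis using S0 1 by (auto simp: conv_pairs_def)
      qed
      then show ?thesis using eq x0 1 by (simp add: frob_def y0)
    next
      case 2
      have "conv_pairs S S u = {}" using Sadd 2 by (auto simp: conv_pairs_def)
      then show ?thesis using eq eS[OF 2] by simp
    next
      case 3
      have vu: "v u > 0" using Spos[OF 3(2)] 3(1) by simp
      let ?g = "\<lambda>b. if (b, u) \<in> less then y b else 0"
      have fin: "finite (conv_pairs S S u)" by (rule finite_conv_pairs[OF w S S])
      \<comment> \<open>If a = 0, then i > 0 and division by p^i lowers the positive value of u; if
        a is nonzero, then b already has smaller value than u.\<close>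
      have rest_term: "?g ((1 / of_nat p ^ i) *s b) = y ((1 / of_nat p ^ i) *s b)"
        if ab: "(a, b) \<in> conv_pairs S S u" "\<not> (i = 0 \<and> a = 0)" for i a b
      proof (cases "(1 / of_nat p ^ i) *s b \<in> S")
        case True
        have a: "a \<in> S" "b \<in> S" "u = a + b" using ab(1) by (auto simp: conv_pairs_def)
        have vab: "v u = v a + v b" by (simp add: a(3) inner_add_right)
        have vb: "v ((1 / of_nat p ^ i) *s b) = v b / real p ^ i"
          by (simp add: of_rat_divide of_rat_power)
        have vb0: "v b \<ge> 0" "v a \<ge> 0" using Spos a by force+
        have pi: "real p ^ i \<ge> 1" using p_gt_1 by simp
        have "v b / real p ^ i < v u"
        proof (cases "a = 0")
          case True
          then have "i > 0" "v b = v u" using ab(2) vab by auto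
          moreover have "real p ^ i > 1" using p_gt_1 \<open>i > 0\<close> by simp
          ultimately show ?thesis using vu by (simp add: divide_less_eq)
        next
          case False
          then have "v b < v u" using Spos[OF a(1)] vab by simp
          moreover have "v b / real p ^ i \<le> v b"
            using pi vb0 by (simp add: divide_le_eq mult_le_cancel_left1)
          ultimately show ?thesis by simp
        qed
        then have "((1 / of_nat p ^ i) *s b, u) \<in> less"
          unfolding less_def using True 3(2) vb by simp
        then show ?thesis by simp
      next
        case False
        then show ?thesis using yS by simp
      qed
      have zero_u: "(0, u) \<in> conv_pairs S S u" using S0 3(2) by (simp add: conv_pairs_def)
      define f where "f = (\<lambda>i (a, b). c i a * frob i y b)"
      define f' where "f' = (\<lambda>i (a, b). if i = 0 \<and> a = 0 then 0 else f i (a, b))"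
      have 0: "(\<Sum>z\<in>conv_pairs S S u. f 0 z) = c 0 0 * y u + (\<Sum>z\<in>conv_pairs S S u. f' 0 z)"
      proof -
        have "(\<Sum>z\<in>conv_pairs S S u. f 0 z) = f 0 (0, u) + (\<Sum>z\<in>conv_pairs S S u - {(0, u)}. f 0 z)"
          by (rule sum.remove[OF fin zero_u])
        moreover have "(\<Sum>z\<in>conv_pairs S S u. f' 0 z) = f' 0 (0, u) + (\<Sum>z\<in>conv_pairs S S u - {(0, u)}. f' 0 z)"
          by (rule sum.remove[OF fin zero_u])
        moreover have "(\<Sum>z\<in>conv_pairs S S u - {(0, u)}. f 0 z) = (\<Sum>z\<in>conv_pairs S S u - {(0, u)}. f' 0 z)"
        proof (rule sum.cong[OF refl])
          fix z assume z: "z \<in> conv_pairs S S u - {(0, u)}"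
          obtain a b where ab: "z = (a, b)" by (cases z)
          have "a \<noteq> 0" using z by (auto simp: ab conv_pairs_def)
          then show "f 0 z = f' 0 z" by (simp add: f'_def ab)
        qed
        ultimately show ?thesis by (simp add: f_def f'_def frob_def)
      qed
      have "(\<Sum>i\<le>n. \<Sum>z\<in>conv_pairs S S u. f i z)
          = (\<Sum>z\<in>conv_pairs S S u. f 0 z) + (\<Sum>i\<in>{..n} - {0}. \<Sum>z\<in>conv_pairs S S u. f i z)"
        by (rule sum.remove) auto
      also have "(\<Sum>i\<in>{..n} - {0}. \<Sum>z\<in>conv_pairs S S u. f i z)
          = (\<Sum>i\<in>{..n} - {0}. \<Sum>z\<in>conv_pairs S S u. f' i z)"
        by (intro sum.cong refl) (auto simp: f'_def)
      also have "(\<Sum>z\<in>conv_pairs S S u. f 0 z) + \<dots>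
          = c 0 0 * y u + (\<Sum>i\<le>n. \<Sum>z\<in>conv_pairs S S u. f' i z)"
        by (subst sum.remove[of "{..n}" 0]) (auto simp: 0)
      also have "(\<Sum>i\<le>n. \<Sum>z\<in>conv_pairs S S u. f' i z) = rest ?g u"
        unfolding rest_def
        by (intro sum.cong refl) (auto simp: f'_def f_def frob_def rest_term simp del: split_paired_All)
      also have "c 0 0 * y u = e u - rest ?g u"
        using 3 c00 by (subst y) (simp add: F_def)
      finally show ?thesis unfolding eq f_def by simp
    qed
  qed
  then have "(\<Oplus>i\<in>{..n}. c i \<otimes> y [^] (p ^ i)) = e" by (rule ext)
  then show thesis using that yK y0 by blast
qed

text \<open>Shifting exponents moves the leading term to 0. Inverting is then a linear equation, the
  case n = 0 of \<open>additive_equation_solvable\<close>.\<close>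

lemma ex_inverse:
  assumes \<phi>: "\<phi> \<in> carrier K" "\<phi> \<noteq> \<zero>"
  shows "\<exists>\<psi>\<in>carrier K. \<phi> \<otimes> \<psi> = \<one>"
proof -
  obtain \<gamma> where \<gamma>: "\<phi> \<gamma> \<noteq> 0" "\<And>u. \<phi> u \<noteq> 0 \<Longrightarrow> v \<gamma> \<le> v u"
    by (rule ex_least_in_supp[OF \<phi>]) (rule that)
  define \<theta> where "\<theta> = monomial (- \<gamma>) 1 \<otimes> \<phi>"
  have \<theta>: "\<theta> \<in> carrier K" unfolding \<theta>_def using \<phi>(1) monomial_closed by simp
  have \<theta>_eq: "\<theta> u = \<phi> (u + \<gamma>)" for u
    unfolding \<theta>_def mult_monomial[OF \<phi>(1)] by simp
  define E where "E = supp \<theta> - {0}"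
  have E: "tame p w E" unfolding E_def using \<theta> by (auto simp: carrier_iff elim: tame_subset)
  have pos: "0 < v a" if "a \<in> E" for a
  proof -
    have "\<phi> (a + \<gamma>) \<noteq> 0" "a \<noteq> 0" using that by (auto simp: E_def supp_def \<theta>_eq)
    then have "v \<gamma> \<le> v (a + \<gamma>)" "v a \<noteq> v 0" using \<gamma>(2) v_eq_iff by blast+
    then show ?thesis by (simp add: inner_add_right)
  qed
  obtain y where y: "y \<in> carrier K" "(\<Oplus>i\<in>{..0::nat}. \<theta> \<otimes> y [^] (p ^ i)) = \<one>"
  proof (rule additive_equation_solvable[OF E pos, of 0 "\<lambda>_. \<theta>" "\<one>" "1 / \<phi> \<gamma>"])
    show "supp \<theta> \<subseteq> insert 0 E" by (auto simp: E_def)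
    show "supp \<one> \<subseteq> insert 0 E" unfolding one_eq using supp_monomial by blast
    show "\<theta> 0 \<noteq> 0" using \<gamma>(1) by (simp add: \<theta>_eq)
    show "(\<Sum>i\<le>0. \<theta> 0 * (1 / \<phi> \<gamma>) ^ p ^ i) = \<one> 0"
      using \<gamma>(1) by (simp add: \<theta>_eq one_eq monomial_def)
  qed (use that in auto)
  have "\<theta> \<otimes> y = \<one>" using y \<theta> by simp
  then have "\<phi> \<otimes> (monomial (- \<gamma>) 1 \<otimes> y) = \<one>"
    unfolding \<theta>_def using \<phi>(1) y(1) monomial_closed by (simp add: m_ac)
  then show ?thesis using y(1) monomial_closed by (intro bexI[of _ "monomial (- \<gamma>) 1 \<otimes> y"]) auto
qed

lemma field: "field K"
proof (rule cring_fieldI2)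
  show "\<zero> \<noteq> \<one>" by (auto simp: zero_eq one_eq monomial_def dest: fun_cong[of _ _ 0])
qed (rule ex_inverse)

section \<open>Perfectness and Artin-Schreier equations\<close>

definition pth_root :: "'k \<Rightarrow> 'k" where
  "pth_root x = (SOME z. z ^ p = x)"

lemma pth_root_pow [simp]: "pth_root x ^ p = x"
proof -
  let ?f = "\<lambda>k. if k = 0 then - x else if k = p then 1 else (0 :: 'k)"
  obtain z where z: "(\<Sum>k\<le>p. ?f k * z ^ k) = 0"
    using alg_closed[of p ?f] p_gt_0 by auto
  have "(\<Sum>k\<le>p. ?f k * z ^ k) = (\<Sum>k\<in>{0, p}. ?f k * z ^ k)"
    by (rule sum.mono_neutral_right) auto
  also have "\<dots> = - x + z ^ p" using p_gt_0 by simp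
  finally have "z ^ p = x" using z by simp
  then show ?thesis unfolding pth_root_def by (rule someI)
qed

lemma pth_root_0 [simp]: "pth_root 0 = 0"
  using pth_root_pow[of 0] p_gt_0 by (metis power_eq_0_iff)

lemma perfect:
  assumes "\<phi> \<in> carrier K"
  shows "\<exists>\<psi>\<in>carrier K. \<psi> [^] p = \<phi>"
proof -
  define \<psi> where "\<psi> = (\<lambda>u. pth_root (\<phi> (of_nat p *s u)))"
  have inv: "(1 / of_nat p) * of_nat p = (1 :: rat)" "of_nat p * (1 / of_nat p) = (1 :: rat)"
    using p_gt_0 by simp_all
  have "supp \<psi> \<subseteq> (*s) (1 / of_nat p) ` supp \<phi>"
  proof
    fix u assume "u \<in> supp \<psi>"
    then have "of_nat p *s u \<in> supp \<phi>" by (auto simp: supp_def \<psi>_def)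
    moreover have "u = (1 / of_nat p) *s (of_nat p *s u)"
      by (simp only: vector_smult_assoc inv vector_smult_lid)
    ultimately show "u \<in> (*s) (1 / of_nat p) ` supp \<phi>" by blast
  qed
  moreover have "tame p w ((*s) (1 / of_nat p) ` supp \<phi>)"
    using assms p_gt_0 by (intro tame_scale) (auto simp: carrier_iff)
  ultimately have \<psi>: "\<psi> \<in> carrier K" by (rule carrierI[rotated])
  have "frob 1 \<psi> u = \<phi> u" for u
    unfolding frob_def \<psi>_def by (simp only: power_one_right pth_root_pow vector_smult_assoc inv vector_smult_lid)
  then have "\<psi> [^] p = \<phi>" using pow_p_eq_frob[OF \<psi>] by (simp add: fun_eq_iff)
  then show ?thesis using \<psi> by blast
qed

lemma ex_artin_schreier_root: "\<exists>x::'k. x ^ p - x = a"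
proof -
  let ?f = "\<lambda>k. if k = 0 then - a else if k = 1 then - 1 else if k = p then 1 else (0 :: 'k)"
  obtain z where z: "(\<Sum>k\<le>p. ?f k * z ^ k) = 0"
    using alg_closed[of p ?f] p_gt_1 by auto
  have "(\<Sum>k\<le>p. ?f k * z ^ k) = (\<Sum>k\<in>{0, 1, p}. ?f k * z ^ k)"
    by (rule sum.mono_neutral_right) (use p_gt_1 in auto)
  also have "\<dots> = - a - z + z ^ p" using p_gt_1 by simp
  finally show ?thesis using z by (intro exI[of _ z]) (simp add: algebra_simps)
qed

lemma artin_schreier_nonneg:
  assumes \<phi>: "\<phi> \<in> carrier K" and nonneg: "\<And>u. \<phi> u \<noteq> 0 \<Longrightarrow> 0 \<le> v u"
  shows "\<exists>\<psi>\<in>carrier K. \<psi> [^] p \<ominus> \<psi> = \<phi>"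
proof -
  define E where "E = supp \<phi> - {0}"
  have E: "tame p w E" unfolding E_def using \<phi> by (auto simp: carrier_iff elim: tame_subset)
  have pos: "0 < v a" if "a \<in> E" for a
  proof -
    have "0 \<le> v a" "v a \<noteq> v 0" using that nonneg[of a] v_eq_iff[of a 0] by (auto simp: E_def supp_def)
    then show ?thesis by simp
  qed
  \<comment> \<open>The condition at exponent 0 is an Artin-Schreier equation over the coefficient
    field; it provides the prescribed initial value.\<close>
  obtain x where x: "x ^ p - x = \<phi> 0" using ex_artin_schreier_root by blast
  define c :: "nat \<Rightarrow> rat ^ 'd \<Rightarrow> 'k" where "c = (\<lambda>i. if i = 0 then monomial 0 (- 1) else monomial 0 (1 :: 'k))"
  have cK: "c i \<in> carrier K" for i by (simp add: c_def monomial_closed)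
  obtain y where y: "y \<in> carrier K" "(\<Oplus>i\<in>{..1::nat}. c i \<otimes> y [^] (p ^ i)) = \<phi>"
  proof (rule additive_equation_solvable[OF E pos, of 1 c \<phi> x])
    show "supp (c i) \<subseteq> insert 0 E" for i
      using supp_monomial[of 0] by (auto simp: c_def)
    show "supp \<phi> \<subseteq> insert 0 E" by (auto simp: E_def)
    show "c 0 0 \<noteq> 0" by (simp add: c_def monomial_def)
    show "(\<Sum>i\<le>1. c i 0 * x ^ p ^ i) = \<phi> 0" using x by (simp add: c_def monomial_def)
  qed (use that in auto)
  have "\<phi> u = - y u + (y [^] p) u" for u
  proof -
    have "\<phi> u = (\<Sum>i\<in>{..1}. (c i \<otimes> y [^] (p ^ i)) u)"
      unfolding y(2)[symmetric] using cK y(1) by (intro finsum_eq) auto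
    then show ?thesis using y(1) by (simp add: c_def mult_monomial)
  qed
  then have "y [^] p \<ominus> y = \<phi>" using y(1) by (simp add: a_minus_eq fun_eq_iff)
  then show ?thesis using y(1) by blast
qed

lemma pth_root_iter_pow: "(pth_root ^^ Suc j) x ^ p = (pth_root ^^ j) x"
  by simp

lemma pth_root_iter_0 [simp]: "(pth_root ^^ j) 0 = 0"
  by (induction j) auto

text \<open>The root is the sum of the p^j-th roots of \<phi> for j > 0: raising it to the power p
  shifts the index by one and thereby adds \<phi> itself. At exponent u the j-th summand contributes
  the p^j-th root of the coefficient of \<phi> at p^j u.\<close>

lemma artin_schreier_neg:
  assumes \<phi>: "\<phi> \<in> carrier K" and neg: "\<And>u. \<phi> u \<noteq> 0 \<Longrightarrow> v u < 0"
  shows "\<exists>\<psi>\<in>carrier K. \<psi> [^] p \<ominus> \<psi> = \<phi>"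
proof -
  define J where "J = (\<lambda>u. {j. \<phi> (of_nat p ^ j *s u) \<noteq> 0})"
  have tame: "tame p w (supp \<phi>)" using \<phi> by (simp add: carrier_iff)
  \<comment> \<open>A contributing u has negative value, and p^j times this value must stay above
    the lower bound of v on the support of \<phi>.\<close>
  have finJ: "finite (J u)" for u
  proof (cases "J u = {}")
    case False
    then obtain j where "\<phi> (of_nat p ^ j *s u) \<noteq> 0" by (auto simp: J_def)
    then have "real p ^ j * v u < 0" using neg by (fastforce simp: of_rat_power)
    then have vu: "v u < 0" using p_gt_0 by (simp add: mult_less_0_iff)
    obtain e N c M where cM: "c > 0" "\<And>a. a \<in> supp \<phi> \<Longrightarrow> c * norm (rvec a) \<le> w \<bullet> rvec a + M"
      by (rule tameE[OF tame]) (rule that)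
    have M: "v a \<ge> - M" if "a \<in> supp \<phi>" for a
    proof -
      have "0 \<le> c * norm (rvec a)" using cM(1) by simp
      then show ?thesis using cM(2)[OF that] by linarith
    qed
    obtain k :: nat where k: "M / - v u < real k" using reals_Archimedean2 by blast
    have "J u \<subseteq> {..k}"
    proof
      fix j assume "j \<in> J u"
      then have "- M \<le> v (of_nat p ^ j *s u)" by (intro M) (simp add: J_def supp_def)
      then have "real p ^ j * - v u \<le> M" by (simp add: of_rat_power)
      then have "real p ^ j \<le> M / - v u" by (subst pos_le_divide_eq) (use vu in auto)
      moreover have "j < p ^ j" using p_gt_1 by (intro power_gt_expt) simp
      then have "real j \<le> real p ^ j" by (metis less_imp_le of_nat_le_iff of_nat_power)
      ultimately have "real j < real k" using k by linarith
      then show "j \<in> {..k}" by simp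
    qed
    then show ?thesis using finite_subset by blast
  qed simp
  define g where "g = (\<lambda>u j. (pth_root ^^ j) (\<phi> (of_nat p ^ j *s u)))"
  \<comment> \<open>The index 0 is left out: it is the term \<phi> by which \<psi>^p and \<psi>
    differ.\<close>
  define \<psi> where "\<psi> = (\<lambda>u. \<Sum>j\<in>J u - {0}. g u j)"
  have g0: "g u j = 0" if "j \<notin> J u" for u j using that by (simp add: g_def J_def)
  have inv: "(1 / of_nat p ^ j) * of_nat p ^ j = (1 :: rat)" for j using p_gt_0 by simp
  have "supp \<psi> \<subseteq> (\<Union>j. (*s) (1 / of_nat p ^ j) ` supp \<phi>)"
  proof
    fix u assume "u \<in> supp \<psi>"
    then have "J u \<noteq> {}" by (auto simp: supp_def \<psi>_def)
    then obtain j where j: "of_nat p ^ j *s u \<in> supp \<phi>" by (auto simp: J_def supp_def)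
    have "u = (1 / of_nat p ^ j) *s (of_nat p ^ j *s u)"
      by (simp only: vector_smult_assoc inv vector_smult_lid)
    then show "u \<in> (\<Union>j. (*s) (1 / of_nat p ^ j) ` supp \<phi>)" using j by blast
  qed
  moreover have "tame p w (\<Union>j. (*s) (1 / of_nat p ^ j) ` supp \<phi>)"
    using neg by (intro tame_UN_divide_powers[OF p_gt_1 w tame]) (simp add: supp_def)
  ultimately have \<psi>: "\<psi> \<in> carrier K" by (rule carrierI[rotated])
  have "frob 1 \<psi> u = \<phi> u + \<psi> u" for u
  proof -
    let ?u = "(1 / of_nat p) *s u"
    have sh: "of_nat p ^ Suc j *s ?u = of_nat p ^ j *s u" for j
    proof -
      have "of_nat p ^ Suc j * (1 / of_nat p) = (of_nat p ^ j :: rat)" using p_gt_0 by simp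
      then show ?thesis by (simp only: vector_smult_assoc)
    qed
    have J_sh: "Suc j \<in> J ?u \<longleftrightarrow> j \<in> J u" for j
      unfolding J_def mem_Collect_eq sh ..
    have "frob 1 \<psi> u = (\<Sum>j\<in>J ?u - {0}. g ?u j) ^ p" by (simp add: frob_def \<psi>_def)
    also have "\<dots> = (\<Sum>j\<in>J ?u - {0}. g ?u j ^ p)"
      using p char by (intro freshmans_dream_sum) auto
    also have "\<dots> = (\<Sum>j\<in>J u. g u j)"
    proof (rule sum.reindex_bij_witness[where i = Suc and j = "\<lambda>j. j - 1"])
      fix j assume "j \<in> J ?u - {0}"
      then obtain i where i: "j = Suc i" by (metis DiffD2 insertI1 not0_implies_Suc)
      show "Suc (j - 1) = j" using i by simp
      show "j - 1 \<in> J u" using \<open>j \<in> J ?u - {0}\<close> J_sh[of i] unfolding i by simp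
      show "g u (j - 1) = g ?u j ^ p"
        unfolding g_def i diff_Suc_1 sh pth_root_iter_pow ..
    next
      fix j assume "j \<in> J u"
      then show "Suc j \<in> J ?u - {0}" using J_sh[of j] by simp
    qed simp
    also have "\<dots> = (\<Sum>j\<in>insert 0 (J u). g u j)"
      by (rule sum.mono_neutral_left) (use finJ g0 in auto)
    also have "\<dots> = g u 0 + (\<Sum>j\<in>insert 0 (J u) - {0}. g u j)"
      by (rule sum.remove) (use finJ in auto)
    also have "insert 0 (J u) - {0} = J u - {0}" by blast
    also have "g u 0 = \<phi> u" by (simp add: g_def)
    finally show ?thesis by (simp add: \<psi>_def)
  qed
  then have "\<psi> [^] p \<ominus> \<psi> = \<phi>"
    using pow_p_eq_frob[OF \<psi>] a_minus_eq[OF nat_pow_closed[OF \<psi>] \<psi>] by (simp add: fun_eq_iff)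
  then show ?thesis using \<psi> by blast
qed

lemma artin_schreier:
  assumes \<phi>: "\<phi> \<in> carrier K"
  shows "\<exists>\<psi>\<in>carrier K. \<psi> [^] p \<ominus> \<psi> = \<phi>"
proof -
  define hi where "hi = (\<lambda>u. if v u < 0 then 0 else \<phi> u)"
  define lo where "lo = (\<lambda>u. if v u < 0 then \<phi> u else 0)"
  have cl: "lo \<in> carrier K" "hi \<in> carrier K"
    using \<phi> by (auto simp: carrier_iff lo_def hi_def supp_def elim!: tame_subset)
  have "\<exists>\<psi>\<in>carrier K. \<psi> [^] p \<ominus> \<psi> = hi"
    by (rule artin_schreier_nonneg[OF cl(2)]) (auto simp: hi_def split: if_splits)
  then obtain y where y: "y \<in> carrier K" "y [^] p \<ominus> y = hi" by blast
  have "\<exists>\<psi>\<in>carrier K. \<psi> [^] p \<ominus> \<psi> = lo"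
    by (rule artin_schreier_neg[OF cl(1)]) (auto simp: lo_def split: if_splits)
  then obtain z where z: "z \<in> carrier K" "z [^] p \<ominus> z = lo" by blast
  have "(y \<oplus> z) [^] p \<ominus> (y \<oplus> z) = (y [^] p \<oplus> z [^] p) \<ominus> (y \<oplus> z)"
    using y z by (simp add: freshmans_dream_pow[OF p char_eq_zero])
  also have "\<dots> = (y [^] p \<ominus> y) \<oplus> (z [^] p \<ominus> z)"
    using y(1) z(1) by (simp add: a_minus_eq) (simp add: add_eq fun_eq_iff)
  also have "\<dots> = \<phi>" unfolding y(2) z(2) by (auto simp: add_eq lo_def hi_def fun_eq_iff)
  finally show ?thesis using y(1) z(1) by blast
qed

text \<open>Dividing the additive polynomial by X gives \<open>P\<close>, with nonzero constant term
  \<open>a 0\<close>, so no root of \<open>P\<close> is 0. The coefficient \<open>a m\<close> makes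
  \<open>P\<close> nonconstant.\<close>

lemma ex_residual_root:
  fixes a :: "nat \<Rightarrow> 'k"
  assumes "a 0 \<noteq> 0" "0 < m" "m \<le> n" "a m \<noteq> 0"
  obtains x where "x \<noteq> 0" "(\<Sum>i\<le>n. a i * x ^ (p ^ i)) = 0"
proof -
  define P where "P = (\<Sum>i\<le>n. Polynomial.monom (a i) (p ^ i - 1))"
  have inj: "p ^ i - 1 = p ^ j - 1 \<longleftrightarrow> i = j" for i j
  proof
    assume "p ^ i - 1 = p ^ j - 1"
    moreover have "p ^ i > 0" "p ^ j > 0" using p_gt_0 by auto
    ultimately have "p ^ i = p ^ j" by linarith
    then show "i = j" using p_gt_1 by (simp add: power_inject_exp)
  qed simp
  have "Polynomial.coeff P (p ^ m - 1) = (\<Sum>i\<le>n. if i = m then a i else 0)"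
    unfolding P_def Polynomial.coeff_sum by (intro sum.cong refl) (auto simp: inj simp del: One_nat_def)
  also have "\<dots> = a m" using assms(3) by simp
  finally have "p ^ m - 1 \<le> Polynomial.degree P" using assms(4) by (intro le_degree) simp
  moreover have "p ^ m > 1" using p_gt_1 assms(2) by (rule one_less_power)
  ultimately have "Polynomial.degree P > 0" by linarith
  then obtain x where x: "poly P x = 0" using alg_closed_imp_poly_has_root by blast
  have ev: "poly P x = (\<Sum>i\<le>n. a i * x ^ (p ^ i - 1))" for x
    unfolding P_def by (simp add: poly_sum poly_monom)
  have "x \<noteq> 0"
  proof
    assume "x = 0"
    have "(\<Sum>i\<le>n. a i * 0 ^ (p ^ i - 1)) = (\<Sum>i\<le>n. if i = 0 then a i else 0)"
    proof (intro sum.cong refl)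
      fix i
      show "a i * 0 ^ (p ^ i - 1) = (if i = 0 then a i else 0)"
        using one_less_power[OF p_gt_1, of i] by (cases "i = 0") (auto simp: power_0_left)
    qed
    then have "poly P 0 = a 0" unfolding ev by simp
    then show False using x \<open>x = 0\<close> assms(1) by simp
  qed
  moreover have "(\<Sum>i\<le>n. a i * x ^ (p ^ i)) = x * poly P x"
  proof -
    have *: "a i * x ^ (p ^ i) = x * (a i * x ^ (p ^ i - 1))" for i
      using p_gt_0 power_Suc[of x "p ^ i - 1"] by (simp add: mult_ac)
    show ?thesis unfolding ev sum_distrib_left by (intro sum.cong refl *)
  qed
  ultimately show thesis using that x by simp
qed

text \<open>Newton polygon step: substituting \<open>x = t\<^sup>s y\<close> with \<open>s\<close> the largest slope at the index 0 and
  dividing by the order of the linear term makes all coefficients integral, with the linear and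
  another coefficient units.\<close>

lemma additive_poly_root:
  assumes c: "\<And>i. c i \<in> carrier K" and c0: "c 0 \<noteq> \<zero>" and n: "n > 0" and cn: "c n \<noteq> \<zero>"
  shows "\<exists>\<alpha>\<in>carrier K. \<alpha> \<noteq> \<zero> \<and> (\<Oplus>i\<in>{..n}. c i \<otimes> \<alpha> [^] (p ^ i)) = \<zero>"
proof -
  define I where "I = {i. i \<le> n \<and> c i \<noteq> \<zero>}"
  have "\<exists>\<gamma>. c i \<gamma> \<noteq> 0 \<and> (\<forall>u. c i u \<noteq> 0 \<longrightarrow> v \<gamma> \<le> v u)" if "c i \<noteq> \<zero>" for i
    by (rule ex_least_in_supp[OF c that]) blast
  then obtain \<gamma> where \<gamma>: "\<And>i. c i \<noteq> \<zero> \<Longrightarrow> c i (\<gamma> i) \<noteq> 0"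
    "\<And>i u. c i \<noteq> \<zero> \<Longrightarrow> c i u \<noteq> 0 \<Longrightarrow> v (\<gamma> i) \<le> v u" by metis
  \<comment> \<open>At x = t^s the leading exponents of c_0 x and c_i x^(p^i) agree when \<gamma>_0
    + s = \<gamma>_i + p^i s; this is the solution s.\<close>
  define slope where "slope = (\<lambda>i. (1 / (of_nat p ^ i - 1)) *s (\<gamma> 0 - \<gamma> i))"
  have fin: "finite (I - {0})" by (simp add: I_def)
  have "n \<in> I - {0}" using n cn by (simp add: I_def)
  then have "Max ((\<lambda>i. v (slope i)) ` (I - {0})) \<in> (\<lambda>i. v (slope i)) ` (I - {0})"
    using fin by (intro Max_in) auto
  then obtain m where m: "m \<in> I - {0}" "v (slope m) = Max ((\<lambda>i. v (slope i)) ` (I - {0}))" by force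
  define s where "s = slope m"
  have s_ge: "v (slope i) \<le> v s" if "i \<in> I - {0}" for i
    unfolding s_def m(2) using fin that by (intro Max_ge) auto
  have pi: "(of_nat p ^ i - 1 :: rat) > 0" if "i > 0" for i
    using one_less_power[of "of_nat p :: rat" i] p_gt_1 that by simp
  \<comment> \<open>The substitution x = t^s y contributes p^i s, and division by t^(s + \<gamma>_0)
    the rest. Maximality of s then yields \<open>shift_ge\<close>, with leading exponent 0 for the
    indices 0 and m.\<close>
  define shift where "shift = (\<lambda>i. of_nat p ^ i *s s - s - \<gamma> 0)"
  have shift_m: "shift m = - \<gamma> m"
  proof -
    have "(of_nat p ^ m - 1) *s s = \<gamma> 0 - \<gamma> m"
      using pi[of m] m(1) by (simp add: s_def slope_def)
    moreover have "(of_nat p ^ m - 1) *s s = of_nat p ^ m *s s - s"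
      by (simp add: vector_ssub_ldistrib vec_eq_iff algebra_simps)
    ultimately show ?thesis by (simp add: shift_def)
  qed
  have shift_0: "shift 0 = - \<gamma> 0" by (simp add: shift_def)
  have shift_ge: "0 \<le> v (\<gamma> i) + v (shift i)" if "c i \<noteq> \<zero>" "i \<le> n" for i
  proof (cases "i = 0")
    case True
    then show ?thesis by (simp add: shift_0)
  next
    case False
    define r where "r = (real p ^ i - 1)"
    have r: "r > 0" using one_less_power[of "real p" i] p_gt_1 False by (simp add: r_def)
    have "v (slope i) = (v (\<gamma> 0) - v (\<gamma> i)) / r"
      by (simp add: slope_def r_def of_rat_divide of_rat_diff of_rat_power inner_diff_right diff_divide_distrib)
    then have "(v (\<gamma> 0) - v (\<gamma> i)) / r \<le> v s" using s_ge[of i] that False by (simp add: I_def)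
    then have "v (\<gamma> 0) - v (\<gamma> i) \<le> v s * r" using r by (simp add: pos_divide_le_eq)
    then show ?thesis by (simp add: shift_def r_def inner_diff_right of_rat_power algebra_simps)
  qed
  define d where "d = (\<lambda>i. monomial (shift i) 1 \<otimes> c i)"
  have d_eq: "d i u = c i (u - shift i)" for i u
    unfolding d_def mult_monomial[OF c] by simp
  have dK: "d i \<in> carrier K" for i unfolding d_def using c monomial_closed by simp
  have "m > 0" "m \<le> n" "c m \<noteq> \<zero>" using m(1) by (auto simp: I_def)
  have d0: "d 0 0 \<noteq> 0" "d m 0 \<noteq> 0"
    using \<gamma>(1) c0 \<open>c m \<noteq> \<zero>\<close> by (auto simp: d_eq shift_0 shift_m)
  define E where "E = (\<Union>i\<in>{..n}. supp (d i)) - {0}"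
  have E: "tame p w E"
  proof -
    have "tame p w (\<Union>i\<in>{..n}. supp (d i))"
      using dK by (intro tame_UN_finite[OF p_gt_0]) (auto simp: carrier_iff)
    then show ?thesis unfolding E_def by (rule tame_subset) auto
  qed
  have pos: "0 < v a" if a: "a \<in> E" for a
  proof -
    obtain i where i: "i \<le> n" "c i (a - shift i) \<noteq> 0" "a \<noteq> 0"
      using a by (auto simp: E_def supp_def d_eq)
    then have ci: "c i \<noteq> \<zero>" by (auto simp: zero_eq)
    have "v (\<gamma> i) \<le> v (a - shift i)" by (rule \<gamma>(2)[OF ci i(2)])
    then have "0 \<le> v a" using shift_ge[OF ci i(1)] by (simp add: inner_diff_right)
    moreover have "v a \<noteq> v 0" using i(3) v_eq_iff by blast
    ultimately show ?thesis by simp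
  qed
  obtain x0 where x0: "x0 \<noteq> 0" "(\<Sum>i\<le>n. d i 0 * x0 ^ (p ^ i)) = 0"
    by (rule ex_residual_root[of "\<lambda>i. d i 0" m n, OF d0(1) \<open>m > 0\<close> \<open>m \<le> n\<close> d0(2)]) (rule that)
  obtain y where y: "y \<in> carrier K" "y 0 = x0" "(\<Oplus>i\<in>{..n}. d i \<otimes> y [^] (p ^ i)) = \<zero>"
  proof (rule additive_equation_solvable[OF E pos, of n d "\<zero>" x0])
    show "supp (d i) \<subseteq> insert 0 E" if "i \<le> n" for i using that by (auto simp: E_def)
    show "supp \<zero> \<subseteq> insert 0 E" by (simp add: zero_eq)
    show "(\<Sum>i\<le>n. d i 0 * x0 ^ p ^ i) = \<zero> 0" using x0(2) by (simp add: zero_eq)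
  qed (use d0 that in auto)
  define \<alpha> where "\<alpha> = monomial s 1 \<otimes> y"
  have \<alpha>: "\<alpha> \<in> carrier K" unfolding \<alpha>_def using y(1) monomial_closed by simp
  have "\<alpha> s = x0" unfolding \<alpha>_def mult_monomial[OF y(1)] using y(2) by simp
  then have "\<alpha> \<noteq> \<zero>" using x0(1) by (auto simp: zero_eq)
  have "c i \<otimes> \<alpha> [^] (p ^ i) = monomial (s + \<gamma> 0) 1 \<otimes> (d i \<otimes> y [^] (p ^ i))" for i
  proof -
    have "c i \<otimes> \<alpha> [^] (p ^ i) = c i \<otimes> (monomial (of_nat p ^ i *s s) 1 \<otimes> y [^] (p ^ i))"
      unfolding \<alpha>_def using y(1) monomial_closed by (simp add: nat_pow_distrib monomial_pow)
    also have "monomial (of_nat p ^ i *s s) (1::'k) = monomial (s + \<gamma> 0) 1 \<otimes> monomial (shift i) 1"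
      by (simp add: monomial_mult shift_def)
    finally show ?thesis
      unfolding d_def using c y(1) monomial_closed by (simp add: m_ac)
  qed
  then have "(\<Oplus>i\<in>{..n}. c i \<otimes> \<alpha> [^] (p ^ i))
      = (\<Oplus>i\<in>{..n}. monomial (s + \<gamma> 0) 1 \<otimes> (d i \<otimes> y [^] (p ^ i)))" by simp
  also have "\<dots> = monomial (s + \<gamma> 0) 1 \<otimes> (\<Oplus>i\<in>{..n}. d i \<otimes> y [^] (p ^ i))"
    using dK y(1) monomial_closed by (intro finsum_rdistr[symmetric]) auto
  also have "\<dots> = \<zero>" unfolding y(3) using monomial_closed by simp
  finally show ?thesis using \<alpha> \<open>\<alpha> \<noteq> \<zero>\<close> by blast
qed

lemma algebraically_closed: "algebraically_closed K"
  by (rule field.algebraically_closed_of_additive_polys[OF field p char_eq_zero])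
     (fact perfect artin_schreier additive_poly_root)+

end

theorem theorem3p4:
  fixes w :: "real ^ 'd" and p :: nat
  assumes "CHAR('k::alg_closed_field) = p" and "p > 0"
    and "w \<in> Rli"
  shows "algebraically_closed
           (series_ring (p_discrete_sets p w) :: (rat ^ 'd \<Rightarrow> 'k) ring)"
proof -
  have "Factorial_Ring.prime p"
    using prime_CHAR_semidom[where ?'a = 'k] assms(1,2) by simp
  then interpret p_discrete_series w p "series_ring (p_discrete_sets p w) :: (rat ^ 'd \<Rightarrow> 'k) ring"
    using assms by unfold_locales auto
  show ?thesis by (rule algebraically_closed)
qed

end
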